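(* Let $q\ge 2$, let $W=\{W_x,x\in\mathbb{R}\}$ be a two-sided Brownian motion on a probability space $(\Omega,\mathcal{F},P)$, and for $\gamma=(\gamma_1,\dots,\gamma_q)\in\Delta_q$ let $Z_\gamma(t)$, $t\ge0$, be the generalized Rosenblatt process. Fix $\gamma_2,\dots,\gamma_q$ with $(\gamma_2,\dots,\gamma_q)\in\Delta_{q-1}$ and let $t\ge0$. Then, as $\gamma_1$ converges to $-\frac12$ (with $\gamma=(\gamma_1,\gamma_2,\dots,\gamma_q)\in\Delta_q$), the random variable $Z_\gamma(t)$ converges stably to a random variable whose distribution given $W$ is Gaussian with zero mean and variance $Z_{\gamma_2,\dots,\gamma_q}^2(t)$, where $Z_{\gamma_2,\dots,\gamma_q}$ is the generalized Rosenblatt process of order $q-1$ with parameter $(\gamma_2,\dots,\gamma_q)$ built from the same $W$.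
   Context: For an integer $m\ge1$ put $$\Delta_m=\Big\{\gamma\in\mathbb{R}^m:\ -1<\gamma_i<-\tfrac12,\ 1\le i\le m,\ \ \gamma_1+\cdots+\gamma_m>-\tfrac{m+1}2\Big\}.$$ For $\gamma\in\Delta_m$ the generalized Rosenblatt process of order $m$ is $$Z_\gamma(t)=\int_{\mathbb{R}^m}f_\gamma(x_1,\dots,x_m)\,dW_{x_1}\cdots dW_{x_m},\qquad f_\gamma(x)=A_\gamma\int_0^t(s-x_1)_+^{\gamma_1}\cdots(s-x_m)_+^{\gamma_m}\,ds,$$ where $(u)_+^{a}=u^a$ if $u>0$ and $0$ otherwise, and $A_\gamma>0$ is the normalizing constant (independent of $t$) such that $E[Z_\gamma(t)^2]=t^{2\bar\gamma+2+m}$ with $\bar\gamma=\gamma_1+\cdots+\gamma_m$. For $m=1$ this is fractional Brownian motion with Hurst parameter $\gamma_1+\frac32$. The integral is the multiple Wiener–Itô integral $I_m(f_\gamma)$: for symmetric $f\in L^2(\mathbb{R}^m)$, $I_m(f)$ is normalized by $E[I_m(f)^2]=m!\|f\|^2_{L^2(\mathbb{R}^m)}$, and for non-symmetric $f$, $I_m(f):=I_m(\tilde f)$ with $\tilde f$ the symmetrization of $f$ (average over all permutations of the variables). Random variables $F_n$ on $(\Omega,\mathcal{F},P)$ converge stably to a random variable $F$ on an extended probability space $(\Omega',\mathcal{F}',P')$ if $\lim_nE[Ze^{i\lambda F_n}]=E'[Ze^{i\lambda F}]$ for every $\lambda\in\mathbb{R}$ and every bounded $\mathcal{F}$-measurable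 $Z$. Stable convergence to a random variable whose distribution given $W$ is $N(0,S^2)$ means that the limit is $S\eta$, with $\eta$ a standard normal variable on the extension independent of $\mathcal{F}$; that is, the limit of $E[Ze^{i\lambda F_n}]$ equals $E[Ze^{-\lambda^2S^2/2}]$ for all such $\lambda$ and $Z$. Convergence as $\gamma_1\to-\frac12$ means convergence along every sequence of values of $\gamma_1$ tending to $-\frac12$. *)

theory Defs
  imports "HOL-Probability.Probability" "HOL-Combinatorics.Permutations"
begin

definition two_sided_brownian_motion :: "'a measure \<Rightarrow> (real \<Rightarrow> 'a \<Rightarrow> real) \<Rightarrow> bool" where
  "two_sided_brownian_motion M W \<longleftrightarrow>
     prob_space M \<and>
     (\<forall>x. W x \<in> borel_measurable M) \<and>
     (AE \<omega> in M. W 0 \<omega> = 0) \<and>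
     (\<forall>x y. x < y \<longrightarrow>
        distributed M lborel (\<lambda>\<omega>. W y \<omega> - W x \<omega>) (normal_density 0 (sqrt (y - x)))) \<and>
     (\<forall>N (u :: nat \<Rightarrow> real). strict_mono_on {..N} u \<longrightarrow>
        prob_space.indep_vars M (\<lambda>_. borel) (\<lambda>k \<omega>. W (u (Suc k)) \<omega> - W (u k) \<omega>) {..<N}) \<and>
     (AE \<omega> in M. continuous_on UNIV (\<lambda>x. W x \<omega>))"


text \<open>
  Multiple Wiener--Ito integrals. Points of \<open>\<real>\<^sup>m\<close> are functions in
  \<open>space (\<Pi>\<^sub>M i\<in>{..<m}. lborel)\<close>, so coordinates are numbered from 0.
  The elementary integrands are the step functions on a grid
  \<open>u 0 < \<dots> < u N\<close> which vanish on all diagonal cells: only injective multi-indices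
  \<open>j\<close> occur.
\<close>

definition offdiag_indices :: "nat \<Rightarrow> nat \<Rightarrow> (nat \<Rightarrow> nat) set" where
  "offdiag_indices m N = {j \<in> {..<m} \<rightarrow>\<^sub>E {..<N}. inj_on j {..<m}}"

definition step_fun ::
    "nat \<Rightarrow> nat \<Rightarrow> (nat \<Rightarrow> real) \<Rightarrow> ((nat \<Rightarrow> nat) \<Rightarrow> real) \<Rightarrow> (nat \<Rightarrow> real) \<Rightarrow> real" where
  "step_fun m N u a x =
     (\<Sum>j\<in>offdiag_indices m N. a j * (\<Prod>i<m. indicator {u (j i)<..u (Suc (j i))} (x i)))"

definition step_integral ::
    "(real \<Rightarrow> 'a \<Rightarrow> real) \<Rightarrow> nat \<Rightarrow> nat \<Rightarrow> (nat \<Rightarrow> real) \<Rightarrow> ((nat \<Rightarrow> nat) \<Rightarrow> real) \<Rightarrow> 'a \<Rightarrow> real" where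
  "step_integral W m N u a \<omega> =
     (\<Sum>j\<in>offdiag_indices m N. a j * (\<Prod>i<m. W (u (Suc (j i))) \<omega> - W (u (j i)) \<omega>))"

definition symmetrization :: "nat \<Rightarrow> ((nat \<Rightarrow> real) \<Rightarrow> real) \<Rightarrow> (nat \<Rightarrow> real) \<Rightarrow> real" where
  "symmetrization m f x = (\<Sum>\<sigma> | \<sigma> permutes {..<m}. f (x \<circ> \<sigma>)) / fact m"

text \<open>
  \<open>has_wiener_ito M W m f X\<close>: the random variable \<open>X\<close> is a version of \<open>I\<^sub>m(f)\<close>.
  The integral of the symmetrization is the \<open>L\<^sup>2\<close>-limit of the integrals of elementary
  integrands converging to it in \<open>L\<^sup>2(\<real>\<^sup>m)\<close>. The elementary integrands need not be symmetric,
  as \<open>step_integral\<close> does not distinguish one from its symmetrization. This is the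
  normalization \<open>E[I\<^sub>m(f)\<^sup>2] = m! \<parallel>f\<parallel>\<^sup>2\<close> for symmetric \<open>f\<close>.
  The squared distances are \<open>nn_integral\<close>s, so their convergence to 0 forces \<open>X\<close> to be
  square integrable.
\<close>

definition has_wiener_ito ::
    "'a measure \<Rightarrow> (real \<Rightarrow> 'a \<Rightarrow> real) \<Rightarrow> nat \<Rightarrow> ((nat \<Rightarrow> real) \<Rightarrow> real) \<Rightarrow> ('a \<Rightarrow> real) \<Rightarrow> bool" where
  "has_wiener_ito M W m f X \<longleftrightarrow>
     f \<in> borel_measurable (\<Pi>\<^sub>M i\<in>{..<m}. lborel) \<and>
     (\<integral>\<^sup>+ x. ennreal ((f x)\<^sup>2) \<partial>(\<Pi>\<^sub>M i\<in>{..<m}. lborel)) < \<infinity> \<and>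
     X \<in> borel_measurable M \<and>
     (\<exists>N u a. (\<forall>n. strict_mono_on {..N n} (u n)) \<and>
        (\<lambda>n. \<integral>\<^sup>+ x. ennreal ((step_fun m (N n) (u n) (a n) x - symmetrization m f x)\<^sup>2)
                \<partial>(\<Pi>\<^sub>M i\<in>{..<m}. lborel)) \<longlonglongrightarrow> 0 \<and>
        (\<lambda>n. \<integral>\<^sup>+ \<omega>. ennreal ((step_integral W m (N n) (u n) (a n) \<omega> - X \<omega>)\<^sup>2) \<partial>M) \<longlonglongrightarrow> 0)"


definition Delta :: "nat \<Rightarrow> real list set" where
  "Delta m = {\<gamma>. length \<gamma> = m \<and> (\<forall>c\<in>set \<gamma>. - 1 < c \<and> c < - 1/2) \<and>
                 sum_list \<gamma> > - (real m + 1) / 2}"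

definition pos_powr :: "real \<Rightarrow> real \<Rightarrow> real" where
  "pos_powr u c = (if u > 0 then u powr c else 0)"

text \<open>
  The inner integral is a Bochner integral, hence 0 where the nonnegative integrand is not
  integrable; for \<open>\<gamma> \<in> Delta m\<close> this only affects a null set of \<open>x\<close>.
\<close>

definition rosenblatt_kernel :: "real \<Rightarrow> real list \<Rightarrow> real \<Rightarrow> (nat \<Rightarrow> real) \<Rightarrow> real" where
  "rosenblatt_kernel A \<gamma> t x =
     A * (LBINT s:{0..t}. (\<Prod>i<length \<gamma>. pos_powr (s - x i) (\<gamma> ! i)))"

text \<open>
  The process is determined up to modification, so it is introduced by a predicate. The normalizing
  constant \<open>A\<close>, common to all \<open>t\<close>, is determined by the second moment condition.
\<close>

definition generalized_rosenblatt ::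
    "'a measure \<Rightarrow> (real \<Rightarrow> 'a \<Rightarrow> real) \<Rightarrow> real list \<Rightarrow> (real \<Rightarrow> 'a \<Rightarrow> real) \<Rightarrow> bool" where
  "generalized_rosenblatt M W \<gamma> Z \<longleftrightarrow>
     (\<exists>A>0. \<forall>t\<ge>0.
        has_wiener_ito M W (length \<gamma>) (rosenblatt_kernel A \<gamma> t) (Z t) \<and>
        (LINT \<omega>|M. (Z t \<omega>)\<^sup>2) = t powr (2 * sum_list \<gamma> + 2 + real (length \<gamma>)))"


text \<open>
  An extension of a probability space \<open>M\<close> is a probability space \<open>M'\<close> with a measure preserving
  map \<open>\<pi>\<close> to \<open>M\<close>, along which random variables on \<open>M\<close> are lifted.
\<close>

definition prob_extension :: "'a measure \<Rightarrow> 'b measure \<Rightarrow> ('b \<Rightarrow> 'a) \<Rightarrow> bool" where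
  "prob_extension M M' \<pi> \<longleftrightarrow>
     prob_space M \<and> prob_space M' \<and> \<pi> \<in> measurable M' M \<and> distr M' M \<pi> = M"

definition stable_conv ::
    "'a measure \<Rightarrow> (nat \<Rightarrow> 'a \<Rightarrow> real) \<Rightarrow> 'b measure \<Rightarrow> ('b \<Rightarrow> 'a) \<Rightarrow> ('b \<Rightarrow> real) \<Rightarrow> bool" where
  "stable_conv M F M' \<pi> G \<longleftrightarrow>
     prob_extension M M' \<pi> \<and>
     (\<forall>n. F n \<in> borel_measurable M) \<and> G \<in> borel_measurable M' \<and>
     (\<forall>(l :: real) (Y :: 'a \<Rightarrow> real).
        Y \<in> borel_measurable M \<and> (\<exists>C. \<forall>\<omega>\<in>space M. \<bar>Y \<omega>\<bar> \<le> C) \<longrightarrow>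
        (\<lambda>n. LINT \<omega>|M. complex_of_real (Y \<omega>) * iexp (l * F n \<omega>))
          \<longlonglongrightarrow> (LINT \<omega>'|M'. complex_of_real (Y (\<pi> \<omega>')) * iexp (l * G \<omega>')))"

text \<open>
  Stable convergence to \<open>S \<eta>\<close>, where \<open>\<eta>\<close> is standard normal and independent of the
  \<open>\<sigma>\<close>-algebra of \<open>M\<close>. The type \<open>'a \<times> real\<close> accommodates the product of \<open>M\<close> with the
  standard normal distribution.
\<close>

definition stable_conv_mixed_normal ::
    "'a measure \<Rightarrow> (nat \<Rightarrow> 'a \<Rightarrow> real) \<Rightarrow> ('a \<Rightarrow> real) \<Rightarrow> bool" where
  "stable_conv_mixed_normal M F S \<longleftrightarrow>
     S \<in> borel_measurable M \<and>
     (\<exists>(M' :: ('a \<times> real) measure) \<pi> \<eta>.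
        distributed M' lborel \<eta> std_normal_density \<and>
        prob_space.indep_set M' (sets (vimage_algebra (space M') \<pi> M))
                                (sets (vimage_algebra (space M') \<eta> borel)) \<and>
        stable_conv M F M' \<pi> (\<lambda>\<omega>'. S (\<pi> \<omega>') * \<eta> \<omega>'))"

end

theory Submission
  imports Defs
begin

text \<open>
  As \<open>\<gamma>\<^sub>1\<close> tends to \<open>-1/2\<close>, the \<open>L\<^sup>2\<close> mass of the normalized kernel escapes to \<open>-\<infinity>\<close> in the first
  variable, where \<open>(s - x\<^sub>1) powr \<gamma>\<^sub>1\<close> hardly depends on \<open>s\<close>. Hence the kernel is close in \<open>L\<^sup>2\<close> to the tensor
  product of a step function \<open>h\<close> of unit norm, supported far to the left, and the kernel of order
  \<open>q - 1\<close>. Replacing the latter by a step function supported to the right of \<open>h\<close> makes the multiple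
  integral an exact product \<open>S \<eta>\<close>, with \<open>\<eta> = I\<^sub>1(h)\<close> standard normal and independent of \<open>S\<close>. Along a
  subsequence the supports of the functions \<open>h\<close> are disjoint, so the variables \<open>\<eta>\<close> are independent, and
  Bessel's inequality for \<open>f(\<eta>\<^sub>k) - E f(\<eta>\<^sub>k)\<close> gives \<open>E[U f(\<eta>\<^sub>k)] \<rightarrow> E[U] E[f(\<eta>)]\<close> for every bounded \<open>U\<close>.
\<close>

section \<open>Spans of off-diagonal box monomials\<close>

text \<open>At the exponent -1/2 the square
  \<open>(s - x\<^sub>1) powr (2 * \<gamma>\<^sub>1)\<close> decays like the harmonic series, so its
  tail integral diverges, while the part with \<open>x\<^sub>1\<close> bounded below keeps a bounded
  norm; after normalization only far cells count. A product of two multiple integrals in general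
  carries contraction terms. They are absent when one integrand lives to the left of the other,
  which is why the kernel of order \<open>q - 1\<close> is first cut down to a step function with a
  leftmost point and the cells are then taken beyond that point. Stable convergence has to be tested
  against every bounded variable on \<open>M\<close>, not only against functionals of
  \<open>W\<close>. A density argument inside the chaos would not reach all of them, whereas
  Bessel's inequality makes no assumption on how the test variable depends on \<open>W\<close>. The
  independence is available only along subsequences; since the limit is the same for each of them,
  the whole sequence converges.\<close>

text \<open>A functional of \<open>V\<close> encodes an elementary integrand and its integral at once: the integrand at
  \<open>x\<close> is its value at \<open>V i y = of_bool (x i \<le> y)\<close>, the integral its value at \<open>V i y = W y\<close>.\<close>

definition box_monomial :: "nat \<Rightarrow> (nat \<Rightarrow> real) \<Rightarrow> (nat \<Rightarrow> real) \<Rightarrow> (nat \<Rightarrow> real \<Rightarrow> real) \<Rightarrow> real" where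
  "box_monomial m lo hi V = (\<Prod>i<m. V i (hi i) - V i (lo i))"

definition disjoint_sides :: "nat \<Rightarrow> (nat \<Rightarrow> real) \<Rightarrow> (nat \<Rightarrow> real) \<Rightarrow> bool" where
  "disjoint_sides m lo hi \<longleftrightarrow>
     (\<forall>i<m. lo i < hi i) \<and> (\<forall>i<m. \<forall>k<m. i \<noteq> k \<longrightarrow> hi i \<le> lo k \<or> hi k \<le> lo i)"

text \<open>The endpoint set \<open>B\<close> records where an integrand lives: tensor products and
  independence depend only on the relative position of two such sets. No grid is fixed, so sums need
  no common refinement; a grid is recovered only where single cells matter.\<close>

inductive elementary :: "nat \<Rightarrow> real set \<Rightarrow> ((nat \<Rightarrow> real \<Rightarrow> real) \<Rightarrow> real) \<Rightarrow> bool" for m B where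
  elementary_zero: "elementary m B (\<lambda>V. 0)"
| elementary_add_monomial:
    "elementary m B F \<Longrightarrow> disjoint_sides m lo hi \<Longrightarrow> lo ` {..<m} \<subseteq> B \<Longrightarrow> hi ` {..<m} \<subseteq> B \<Longrightarrow>
     elementary m B (\<lambda>V. F V + c * box_monomial m lo hi V)"

definition grid_functional ::
    "nat \<Rightarrow> nat \<Rightarrow> (nat \<Rightarrow> real) \<Rightarrow> ((nat \<Rightarrow> nat) \<Rightarrow> real) \<Rightarrow> (nat \<Rightarrow> real \<Rightarrow> real) \<Rightarrow> real" where
  "grid_functional m N u a V =
     (\<Sum>j\<in>offdiag_indices m N. a j * (\<Prod>i<m. V i (u (Suc (j i))) - V i (u (j i))))"

lemma elementary_mono: "elementary m B F \<Longrightarrow> B \<subseteq> B' \<Longrightarrow> elementary m B' F"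
  by (induction rule: elementary.induct) (auto intro!: elementary.intros)

text \<open>A grid has finitely many points, whereas in the applications \<open>B\<close> may be a
  half-line or all of \<open>UNIV\<close>.\<close>

lemma elementary_finite_support:
  "elementary m B F \<Longrightarrow> \<exists>P. finite P \<and> P \<subseteq> B \<and> elementary m P F"
proof (induction rule: elementary.induct)
  case elementary_zero
  then show ?case by (auto intro!: exI[of _ "{}"] elementary.intros)
next
  case (elementary_add_monomial F lo hi c)
  then obtain P where P: "finite P" "P \<subseteq> B" "elementary m P F" by auto
  let ?P = "P \<union> lo ` {..<m} \<union> hi ` {..<m}"
  have "elementary m ?P (\<lambda>V. F V + c * box_monomial m lo hi V)"
    using P(3) elementary_add_monomial by (intro elementary.intros) (auto intro: elementary_mono)
  then show ?case using P elementary_add_monomial by (intro exI[of _ ?P]) auto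
qed

lemma elementary_monomial:
  assumes "disjoint_sides m lo hi" "lo ` {..<m} \<subseteq> B" "hi ` {..<m} \<subseteq> B"
  shows "elementary m B (\<lambda>V. c * box_monomial m lo hi V)"
  using elementary_add_monomial[OF elementary_zero assms] by simp

lemma elementary_plus:
  assumes "elementary m B F" "elementary m B G"
  shows "elementary m B (\<lambda>V. F V + G V)"
  using assms(2)
proof (induction rule: elementary.induct)
  case elementary_zero
  then show ?case using assms by simp
next
  case (elementary_add_monomial G lo hi c)
  have "elementary m B (\<lambda>V. (F V + G V) + c * box_monomial m lo hi V)"
    using elementary_add_monomial by (intro elementary.intros)
  then show ?case by (simp add: add.assoc)
qed

lemma elementary_scale:
  assumes "elementary m B F"
  shows "elementary m B (\<lambda>V. r * F V)"
  using assms
proof (induction rule: elementary.induct)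
  case elementary_zero
  then show ?case by (simp add: elementary.intros)
next
  case (elementary_add_monomial G lo hi c)
  have "elementary m B (\<lambda>V. r * G V + (r * c) * box_monomial m lo hi V)"
    using elementary_add_monomial by (intro elementary.intros)
  then show ?case by (simp add: algebra_simps)
qed

lemma elementary_diff:
  assumes "elementary m B F" "elementary m B G"
  shows "elementary m B (\<lambda>V. F V - G V)"
  using elementary_plus[OF assms(1) elementary_scale[OF assms(2), of "-1"]] by simp

lemma elementary_sum:
  assumes "\<And>k. k \<in> K \<Longrightarrow> elementary m B (F k)"
  shows "elementary m B (\<lambda>V. \<Sum>k\<in>K. F k V)"
proof (cases "finite K")
  case True
  then show ?thesis using assms
    by (induction K) (auto intro!: elementary.intros elementary_plus)
qed (auto intro: elementary.intros)

text \<open>Reindexing the product by \<open>\<sigma>\<close> moves the permutation from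
  \<open>V\<close> to the sides, where it appears as its inverse. Disjointness concerns all pairs of
  sides and is not affected by relabelling.\<close>

lemma elementary_permute:
  assumes "elementary m B F" "\<sigma> permutes {..<m}"
  shows "elementary m B (\<lambda>V. F (\<lambda>i. V (\<sigma> i)))"
  using assms(1)
proof (induction rule: elementary.induct)
  case elementary_zero
  then show ?case by (simp add: elementary.intros)
next
  case (elementary_add_monomial F lo hi c)
  define \<tau> where "\<tau> = inv \<sigma>"
  have \<tau>: "\<tau> permutes {..<m}" using assms(2) by (simp add: \<tau>_def permutes_inv)
  have \<tau>\<sigma>: "\<tau> (\<sigma> i) = i" for i using assms(2) by (simp add: \<tau>_def permutes_inverses)
  have "box_monomial m lo hi (\<lambda>i. V (\<sigma> i)) = box_monomial m (lo \<circ> \<tau>) (hi \<circ> \<tau>) V" for V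
    unfolding box_monomial_def
    by (subst (2) prod.permute[OF assms(2)]) (simp add: o_def \<tau>\<sigma>)
  moreover have "disjoint_sides m (lo \<circ> \<tau>) (hi \<circ> \<tau>)"
    using elementary_add_monomial(2) permutes_in_image[OF \<tau>] permutes_inj[OF \<tau>]
    unfolding disjoint_sides_def by (auto simp: inj_eq)
  moreover have "(lo \<circ> \<tau>) ` {..<m} \<subseteq> B" "(hi \<circ> \<tau>) ` {..<m} \<subseteq> B"
    using elementary_add_monomial permutes_in_image[OF \<tau>] by (auto simp: image_subset_iff)
  ultimately show ?case using elementary_add_monomial(5)
    by (simp add: elementary.intros)
qed

lemma box_monomial_Suc:
  "box_monomial (Suc m) (case_nat l lo) (case_nat h hi) V =
     (V 0 h - V 0 l) * box_monomial m lo hi (\<lambda>i. V (Suc i))"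
  by (simp add: box_monomial_def prod.lessThan_Suc_shift del: prod.lessThan_Suc)

text \<open>Every point of \<open>B1\<close> lies weakly to the left of \<open>B2\<close>, so the
  new first side overlaps no side of \<open>G\<close> and the product is again off-diagonal. This is
  what makes the integral of a tensor product equal to the product of the integrals. A common
  endpoint is harmless because the sides are half-open intervals.\<close>

lemma elementary_tensor:
  assumes H: "elementary 1 B1 H" and G: "elementary m B2 G"
    and sep: "\<And>x y. x \<in> B1 \<Longrightarrow> y \<in> B2 \<Longrightarrow> x \<le> y" and B: "B1 \<subseteq> B" "B2 \<subseteq> B"
  shows "elementary (Suc m) B (\<lambda>V. H V * G (\<lambda>i. V (Suc i)))"
  using H
proof (induction rule: elementary.induct)
  case elementary_zero
  then show ?case by (simp add: elementary.intros)
next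
  case (elementary_add_monomial H l h c)
  have "elementary (Suc m) B (\<lambda>V. (V 0 (h 0) - V 0 (l 0)) * G (\<lambda>i. V (Suc i)))"
    using G
  proof (induction rule: elementary.induct)
    case elementary_zero
    then show ?case by (simp add: elementary.intros)
  next
    case (elementary_add_monomial G lo hi d)
    have l: "l 0 \<in> B1" "h 0 \<in> B1" "l 0 < h 0"
      using \<open>disjoint_sides 1 l h\<close> \<open>l ` {..<1} \<subseteq> B1\<close> \<open>h ` {..<1} \<subseteq> B1\<close>
      by (auto simp: disjoint_sides_def)
    have "disjoint_sides (Suc m) (case_nat (l 0) lo) (case_nat (h 0) hi)"
      using l elementary_add_monomial(2,3,4) sep unfolding disjoint_sides_def
      by (auto split: nat.split simp: image_subset_iff)
    moreover have "case_nat (l 0) lo ` {..<Suc m} \<subseteq> B" "case_nat (h 0) hi ` {..<Suc m} \<subseteq> B"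
      using l elementary_add_monomial(3,4) B by (auto simp: subset_iff image_subset_iff split: nat.splits)
    ultimately have "elementary (Suc m) B (\<lambda>V. (V 0 (h 0) - V 0 (l 0)) * G (\<lambda>i. V (Suc i)) +
       d * box_monomial (Suc m) (case_nat (l 0) lo) (case_nat (h 0) hi) V)"
      using elementary_add_monomial by (intro elementary.intros) auto
    then show ?case by (simp add: box_monomial_Suc algebra_simps)
  qed
  from elementary_plus[OF elementary_add_monomial(5) elementary_scale[OF this, of c]]
  show ?case by (simp add: box_monomial_def algebra_simps)
qed

section \<open>Elementary functionals on a grid\<close>

lemma elementary_grid_functional:
  assumes u: "strict_mono_on {..N} u"
  shows "elementary m (u ` {..N}) (grid_functional m N u a)"
proof -
  have "elementary m (u ` {..N}) (\<lambda>V. a j * (\<Prod>i<m. V i (u (Suc (j i))) - V i (u (j i))))"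
    if j: "j \<in> offdiag_indices m N" for j
  proof -
    have less: "j i < N" if "i < m" for i
      using j that by (auto simp: offdiag_indices_def)
    have "disjoint_sides m (\<lambda>i. u (j i)) (\<lambda>i. u (Suc (j i)))"
      unfolding disjoint_sides_def
    proof (intro conjI allI impI)
      fix i assume "i < m"
      then show "u (j i) < u (Suc (j i))"
        using u less[of i] by (auto simp: strict_mono_on_def)
    next
      fix i k assume ik: "i < m" "k < m" "i \<noteq> k"
      then have "j i \<noteq> j k" using j by (auto simp: offdiag_indices_def inj_on_def)
      then have "Suc (j i) \<le> j k \<or> Suc (j k) \<le> j i" by auto
      then show "u (Suc (j i)) \<le> u (j k) \<or> u (Suc (j k)) \<le> u (j i)"
        using strict_mono_on_leD[OF u] less[of i] less[of k] ik by fastforce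
    qed
    then have "elementary m (u ` {..N}) (\<lambda>V. a j * box_monomial m (\<lambda>i. u (j i)) (\<lambda>i. u (Suc (j i))) V)"
      using less by (intro elementary_monomial) force+
    then show ?thesis by (simp add: box_monomial_def)
  qed
  then show ?thesis unfolding grid_functional_def[abs_def] by (rule elementary_sum)
qed

lemma grid_functional_add:
  "grid_functional m N u a V + grid_functional m N u b V = grid_functional m N u (\<lambda>j. a j + b j) V"
  by (simp add: grid_functional_def sum.distrib distrib_right)

lemma grid_functional_scale:
  "c * grid_functional m N u a V = grid_functional m N u (\<lambda>j. c * a j) V"
  by (simp add: grid_functional_def sum_distrib_left mult.assoc)

text \<open>Every side telescopes into the grid cells that it contains, and expanding the product of
  these sums gives one term for each choice of a cell in every side. Disjointness of the sides makes
  the choices injective, as \<open>offdiag_indices\<close> demands.\<close>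

lemma elementary_on_grid:
  assumes "elementary m B F" and w: "strict_mono_on {..L} w" and B: "B \<subseteq> w ` {..L}"
  shows "\<exists>a. F = grid_functional m L w a"
  using assms(1)
proof (induction rule: elementary.induct)
  case elementary_zero
  then show ?case by (auto intro!: exI[of _ "\<lambda>_. 0"] simp: grid_functional_def)
next
  case (elementary_add_monomial F lo hi c)
  then obtain a where a: "F = grid_functional m L w a" by auto
  have "\<exists>p. p \<le> L \<and> w p = lo i" if "i < m" for i
    using that elementary_add_monomial(3) B by force
  then obtain p where p: "\<And>i. i < m \<Longrightarrow> p i \<le> L" "\<And>i. i < m \<Longrightarrow> w (p i) = lo i" by metis
  have "\<exists>p. p \<le> L \<and> w p = hi i" if "i < m" for i
    using that elementary_add_monomial(4) B by force
  then obtain r where r: "\<And>i. i < m \<Longrightarrow> r i \<le> L" "\<And>i. i < m \<Longrightarrow> w (r i) = hi i" by metis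
  have le: "x \<le> y" if "w x \<le> w y" "x \<le> L" "y \<le> L" for x y
    using that strict_mono_onD[OF w, of y x] by fastforce
  have pr: "p i < r i" if "i < m" for i
  proof -
    have "w (p i) < w (r i)" using p r that elementary_add_monomial(2) by (auto simp: disjoint_sides_def)
    then show ?thesis using le[of "p i" "r i"] p(1) r(1) that by (metis less_irrefl nless_le order_less_imp_le)
  qed
  have dis: "r i \<le> p k \<or> r k \<le> p i" if "i < m" "k < m" "i \<noteq> k" for i k
  proof -
    have "w (r i) \<le> w (p k) \<or> w (r k) \<le> w (p i)"
      using p r that elementary_add_monomial(2) by (auto simp: disjoint_sides_def)
    then show ?thesis using le p r that by blast
  qed
  define b :: "(nat \<Rightarrow> nat) \<Rightarrow> real" where "b j = of_bool (\<forall>i<m. p i \<le> j i \<and> j i < r i)" for j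
  have sub: "PiE {..<m} (\<lambda>i. {p i..<r i}) = {j \<in> offdiag_indices m L. \<forall>i<m. p i \<le> j i \<and> j i < r i}"
  proof (intro set_eqI iffI)
    fix j assume j: "j \<in> PiE {..<m} (\<lambda>i. {p i..<r i})"
    have "inj_on j {..<m}"
    proof (rule inj_onI, rule ccontr)
      fix i k assume ik: "i \<in> {..<m}" "k \<in> {..<m}" "j i = j k" "i \<noteq> k"
      then have "p i \<le> j i" "j i < r i" "p k \<le> j k" "j k < r k" using PiE_mem[OF j, of i] PiE_mem[OF j, of k] by auto
      then show False using dis[of i k] ik by auto
    qed
    moreover have "j \<in> {..<m} \<rightarrow>\<^sub>E {..<L}"
      using j order.strict_trans2[OF _ r(1)] by (auto simp: PiE_iff)
    ultimately show "j \<in> {j \<in> offdiag_indices m L. \<forall>i<m. p i \<le> j i \<and> j i < r i}"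
      using j by (auto simp: offdiag_indices_def PiE_iff)
  qed (auto simp: offdiag_indices_def PiE_iff)
  have fin: "finite (offdiag_indices m L)"
    unfolding offdiag_indices_def by (rule finite_subset[of _ "{..<m} \<rightarrow>\<^sub>E {..<L}"]) (auto intro: finite_PiE)
  have "box_monomial m lo hi V = grid_functional m L w b V" for V
  proof -
    have "box_monomial m lo hi V = (\<Prod>i<m. \<Sum>l=p i..<r i. V i (w (Suc l)) - V i (w l))"
      unfolding box_monomial_def
    proof (rule prod.cong[OF refl])
      fix i assume "i \<in> {..<m}"
      then show "V i (hi i) - V i (lo i) = (\<Sum>l=p i..<r i. V i (w (Suc l)) - V i (w l))"
        using sum_Suc_diff'[of "p i" "r i" "\<lambda>l. V i (w l)"] pr[of i] p r by auto
    qed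
    also have "\<dots> = (\<Sum>j\<in>PiE {..<m} (\<lambda>i. {p i..<r i}). \<Prod>i<m. V i (w (Suc (j i))) - V i (w (j i)))"
      by (rule prod_sum_PiE) auto
    also have "\<dots> = grid_functional m L w b V"
      unfolding sub grid_functional_def b_def
      by (rule sum.mono_neutral_cong_left[OF fin]) auto
    finally show ?thesis .
  qed
  then have "(\<lambda>V. F V + c * box_monomial m lo hi V) = grid_functional m L w (\<lambda>j. a j + c * b j)"
    by (simp add: fun_eq_iff a grid_functional_add grid_functional_scale)
  then show ?case by blast
qed

lemma finite_grid:
  assumes "finite (P :: real set)" "P \<noteq> {}"
  obtains L :: nat and w where "strict_mono_on {..L} w" "w ` {..L} = P"
proof -
  let ?l = "sorted_list_of_set P"
  have len: "length ?l = card P" by simp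
  have "card P > 0" using assms by (simp add: card_gt_0_iff)
  then have L: "{..card P - 1} = {..<card P}" by auto
  have "strict_mono_on {..card P - 1} (\<lambda>i. ?l ! i)"
    unfolding strict_mono_on_def L
    using sorted_wrt_nth_less[OF strict_sorted_list_of_set[of P]] by (auto simp: len)
  moreover have "(\<lambda>i. ?l ! i) ` {..card P - 1} = P"
    unfolding L using assms set_sorted_list_of_set[of P] len
    by (auto simp: set_conv_nth image_def)
  ultimately show ?thesis by (rule that)
qed

lemma elementary_obtain_grid:
  assumes "elementary m B F"
  obtains L :: nat and w a where "strict_mono_on {..L} w" "F = grid_functional m L w a"
proof -
  obtain P where P: "finite P" "elementary m P F"
    using elementary_finite_support[OF assms] by auto
  \<comment> \<open>\<open>P\<close> may be empty, as for the zero functional, while a grid on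
    \<open>{..L}\<close> has at least one point; hence the extra point 0.\<close>
  then obtain L :: nat and w where w: "strict_mono_on {..L} w" "w ` {..L} = insert 0 P"
    using finite_grid[of "insert 0 P"] by auto
  then show ?thesis using elementary_on_grid[OF P(2) w(1)] that by blast
qed

section \<open>Lebesgue measure on \<open>\<real>\<^sup>m\<close> and symmetrization\<close>

definition elementary_fun :: "((nat \<Rightarrow> real \<Rightarrow> real) \<Rightarrow> real) \<Rightarrow> (nat \<Rightarrow> real) \<Rightarrow> real" where
  "elementary_fun F x = F (\<lambda>i y. of_bool (x i \<le> y))"

abbreviation leb_pow :: "nat \<Rightarrow> (nat \<Rightarrow> real) measure" where
  "leb_pow m \<equiv> \<Pi>\<^sub>M i\<in>{..<m}. lborel"

interpretation lborel_PiM: product_sigma_finite "\<lambda>_::nat. lborel :: real measure"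
  by unfold_locales

lemma step_fun_eq_grid_functional:
  assumes "strict_mono_on {..N} u"
  shows "step_fun m N u a = elementary_fun (grid_functional m N u a)"
proof
  fix x
  show "step_fun m N u a x = elementary_fun (grid_functional m N u a) x"
    unfolding step_fun_def elementary_fun_def grid_functional_def
  proof (intro sum.cong refl arg_cong2[where f="(*)"] prod.cong)
    fix j i assume "j \<in> offdiag_indices m N" "i \<in> {..<m}"
    then have "j i < N" by (auto simp: offdiag_indices_def)
    then have "u (j i) < u (Suc (j i))" using assms by (auto simp: strict_mono_on_def)
    then show "indicator {u (j i)<..u (Suc (j i))} (x i) =
        (of_bool (x i \<le> u (Suc (j i))) - of_bool (x i \<le> u (j i)) :: real)"
      by (auto simp: indicator_def)
  qed
qed

lemma measurable_elementary_fun: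
  "elementary m B F \<Longrightarrow> elementary_fun F \<in> borel_measurable (leb_pow m)"
proof (induction rule: elementary.induct)
  case elementary_zero
  then show ?case by (simp add: elementary_fun_def[abs_def])
next
  case (elementary_add_monomial F lo hi c)
  have "(\<lambda>x. \<Prod>i<m. of_bool (x i \<le> hi i) - of_bool (x i \<le> lo i) :: real) \<in> borel_measurable (leb_pow m)"
    by measurable
  then have "(\<lambda>x. elementary_fun F x + c * (\<Prod>i<m. of_bool (x i \<le> hi i) - of_bool (x i \<le> lo i)))
      \<in> borel_measurable (leb_pow m)"
    by (intro borel_measurable_add borel_measurable_times elementary_add_monomial(5)) auto
  then show ?case by (simp add: elementary_fun_def[abs_def] box_monomial_def)
qed

lemma finite_offdiag_indices [simp]: "finite (offdiag_indices m N)"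
  unfolding offdiag_indices_def by (rule finite_subset[of _ "{..<m} \<rightarrow>\<^sub>E {..<N}"]) (auto intro: finite_PiE)

text \<open>Distinct multi-indices belong to disjoint boxes, so squaring the step function leaves no
  cross terms.\<close>

lemma nn_integral_step_fun_square:
  assumes u: "strict_mono_on {..N} u"
  shows "(\<integral>\<^sup>+x. ennreal ((step_fun m N u a x)\<^sup>2) \<partial>(leb_pow m)) =
    ennreal (\<Sum>j\<in>offdiag_indices m N. (a j)\<^sup>2 * (\<Prod>i<m. u (Suc (j i)) - u (j i)))"
proof -
  define P :: "(nat \<Rightarrow> nat) \<Rightarrow> (nat \<Rightarrow> real) \<Rightarrow> real" where
    "P j x = (\<Prod>i<m. indicator {u (j i)<..u (Suc (j i))} (x i))" for j x
  have P01: "P j x * P j x = P j x" for j x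
    unfolding P_def prod.distrib[symmetric] by (intro prod.cong refl) (simp add: indicator_def)
  have orth: "P j x * P k x = 0" if jk: "j \<in> offdiag_indices m N" "k \<in> offdiag_indices m N" "j \<noteq> k" for j k x
  proof -
    have "\<exists>i<m. j i \<noteq> k i"
    proof (rule ccontr)
      assume "\<not> ?thesis"
      then have "j = k"
        using jk by (intro PiE_ext[of j "{..<m}" "\<lambda>_. {..<N}" k]) (auto simp: offdiag_indices_def)
      then show False using jk by simp
    qed
    then obtain i where i: "i < m" "j i \<noteq> k i" by blast
    then have "j i < N" "k i < N" using jk by (auto simp: offdiag_indices_def)
    moreover have "Suc (j i) \<le> k i \<or> Suc (k i) \<le> j i" using i by auto
    ultimately have "u (Suc (j i)) \<le> u (k i) \<or> u (Suc (k i)) \<le> u (j i)"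
      using strict_mono_on_leD[OF u] by fastforce
    then have "indicator {u (j i)<..u (Suc (j i))} (x i) * indicator {u (k i)<..u (Suc (k i))} (x i) = (0::real)"
      by (auto simp: indicator_def)
    then show ?thesis using i(1)
      unfolding P_def by (simp flip: prod.distrib) (metis lessThan_iff finite_lessThan prod_zero)
  qed
  have sq: "(step_fun m N u a x)\<^sup>2 = (\<Sum>j\<in>offdiag_indices m N. (a j)\<^sup>2 * P j x)" for x
  proof -
    have "(step_fun m N u a x)\<^sup>2 =
        (\<Sum>j\<in>offdiag_indices m N. \<Sum>k\<in>offdiag_indices m N. (a j * a k) * (P j x * P k x))"
      unfolding step_fun_def P_def[symmetric] power2_eq_square sum_product
      by (simp add: mult_ac)
    also have "\<dots> = (\<Sum>j\<in>offdiag_indices m N. \<Sum>k\<in>offdiag_indices m N.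
        if j = k then (a j)\<^sup>2 * P j x else 0)"
      by (intro sum.cong refl) (auto simp: orth P01 power2_eq_square)
    finally show ?thesis by (simp add: sum.delta)
  qed
  have Pnn: "0 \<le> P j x" for j x by (auto simp: P_def intro!: prod_nonneg)
  have [measurable]: "P j \<in> borel_measurable (leb_pow m)" for j
    unfolding P_def[abs_def] by measurable
  have int: "(\<integral>\<^sup>+x. ennreal (P j x) \<partial>(leb_pow m)) = ennreal (\<Prod>i<m. u (Suc (j i)) - u (j i))"
    and pos: "0 \<le> (\<Prod>i<m. u (Suc (j i)) - u (j i))"
    if j: "j \<in> offdiag_indices m N" for j
  proof -
    have less: "u (j i) \<le> u (Suc (j i))" if "i < m" for i
    proof -
      have "j i < N" using j that by (auto simp: offdiag_indices_def)
      then show ?thesis using strict_mono_on_leD[OF u] by auto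
    qed
    have "(\<integral>\<^sup>+x. ennreal (P j x) \<partial>(leb_pow m)) =
       (\<integral>\<^sup>+x. (\<Prod>i<m. indicator {u (j i)<..u (Suc (j i))} (x i)) \<partial>(leb_pow m))"
      unfolding P_def by (intro nn_integral_cong) (simp add: prod_ennreal[symmetric] ennreal_indicator)
    also have "\<dots> = (\<Prod>i<m. \<integral>\<^sup>+x. indicator {u (j i)<..u (Suc (j i))} x \<partial>lborel)"
      by (rule lborel_PiM.product_nn_integral_prod) auto
    also have "\<dots> = (\<Prod>i<m. ennreal (u (Suc (j i)) - u (j i)))"
      using less by (intro prod.cong) auto
    also have "\<dots> = ennreal (\<Prod>i<m. u (Suc (j i)) - u (j i))"
      using less by (intro prod_ennreal) auto
    finally show "(\<integral>\<^sup>+x. ennreal (P j x) \<partial>(leb_pow m)) = ennreal (\<Prod>i<m. u (Suc (j i)) - u (j i))" .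
    show "0 \<le> (\<Prod>i<m. u (Suc (j i)) - u (j i))" using less by (intro prod_nonneg) auto
  qed
  have "(\<integral>\<^sup>+x. ennreal ((step_fun m N u a x)\<^sup>2) \<partial>(leb_pow m)) =
      (\<integral>\<^sup>+x. (\<Sum>j\<in>offdiag_indices m N. ennreal ((a j)\<^sup>2) * ennreal (P j x)) \<partial>(leb_pow m))"
    unfolding sq by (intro nn_integral_cong) (simp add: sum_ennreal[symmetric] Pnn ennreal_mult'')
  also have "\<dots> = (\<Sum>j\<in>offdiag_indices m N. ennreal ((a j)\<^sup>2) * ennreal (\<Prod>i<m. u (Suc (j i)) - u (j i)))"
    by (subst nn_integral_sum) (auto simp: nn_integral_cmult int)
  also have "\<dots> = ennreal (\<Sum>j\<in>offdiag_indices m N. (a j)\<^sup>2 * (\<Prod>i<m. u (Suc (j i)) - u (j i)))"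
    using pos by (simp add: ennreal_mult''[symmetric] sum_ennreal)
  finally show ?thesis .
qed

section \<open>Coordinate permutations and symmetrization\<close>

lemma measurable_permute_coordinates [measurable]:
  assumes "\<sigma> permutes {..<m}"
  shows "(\<lambda>x. x \<circ> \<sigma>) \<in> measurable (leb_pow m) (leb_pow m)"
proof (rule measurable_PiM_single')
  fix i assume "i \<in> {..<m}"
  then have "\<sigma> i \<in> {..<m}" using permutes_in_image[OF assms] by blast
  then show "(\<lambda>x. (x \<circ> \<sigma>) i) \<in> leb_pow m \<rightarrow>\<^sub>M lborel"
    by (simp add: o_def)
next
  show "(\<lambda>x. x \<circ> \<sigma>) \<in> space (leb_pow m) \<rightarrow> {..<m} \<rightarrow>\<^sub>E space lborel"
    using permutes_not_in[OF assms] by (auto simp: space_PiM PiE_iff extensional_def)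
qed

text \<open>It is enough to compare boxes: the preimage of a box is the box with sides permuted by
  the inverse, which has the same volume.\<close>

lemma distr_permute_coordinates:
  assumes \<sigma>: "\<sigma> permutes {..<m}"
  shows "distr (leb_pow m) (leb_pow m) (\<lambda>x. x \<circ> \<sigma>) = (leb_pow m)"
proof (rule lborel_PiM.PiM_eqI)
  fix A :: "nat \<Rightarrow> real set" assume A: "\<And>i. i \<in> {..<m} \<Longrightarrow> A i \<in> sets lborel"
  define \<tau> where "\<tau> = inv \<sigma>"
  have \<tau>: "\<tau> permutes {..<m}" using \<sigma> by (simp add: \<tau>_def permutes_inv)
  have \<tau>\<sigma>: "\<tau> (\<sigma> i) = i" "\<sigma> (\<tau> i) = i" for i using \<sigma> by (simp_all add: \<tau>_def permutes_inverses)
  have m: "\<sigma> i < m \<longleftrightarrow> i < m" "\<tau> i < m \<longleftrightarrow> i < m" for i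
    using permutes_in_image[OF \<sigma>, of i] permutes_in_image[OF \<tau>, of i] by auto
  have "(\<lambda>x. x \<circ> \<sigma>) -` PiE {..<m} A \<inter> space (leb_pow m) = PiE {..<m} (A \<circ> \<tau>)"
  proof (intro set_eqI iffI)
    fix x assume "x \<in> (\<lambda>x. x \<circ> \<sigma>) -` PiE {..<m} A \<inter> space (leb_pow m)"
    then have x: "x \<circ> \<sigma> \<in> PiE {..<m} A" "x \<in> extensional {..<m}" by (auto simp: space_PiM PiE_iff)
    have "x i \<in> A (\<tau> i)" if "i < m" for i
      using PiE_mem[OF x(1), of "\<tau> i"] that by (simp add: m \<tau>\<sigma>)
    then show "x \<in> PiE {..<m} (A \<circ> \<tau>)" using x(2) by (auto simp: PiE_iff)
  next
    fix x assume x: "x \<in> PiE {..<m} (A \<circ> \<tau>)"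
    have "x (\<sigma> i) \<in> A i" if "i < m" for i
      using PiE_mem[OF x, of "\<sigma> i"] that by (simp add: m \<tau>\<sigma>)
    then show "x \<in> (\<lambda>x. x \<circ> \<sigma>) -` PiE {..<m} A \<inter> space (leb_pow m)"
      using x by (auto simp: space_PiM PiE_iff extensional_def m)
  qed
  then have "emeasure (distr (leb_pow m) (leb_pow m) (\<lambda>x. x \<circ> \<sigma>)) (PiE {..<m} A) =
      emeasure (leb_pow m) (PiE {..<m} (A \<circ> \<tau>))"
    using A \<sigma> by (subst emeasure_distr) (auto intro!: sets_PiM_I_finite)
  also have "\<dots> = (\<Prod>i<m. emeasure lborel (A (\<tau> i)))"
    using A by (subst lborel_PiM.emeasure_PiM) (auto simp: m)
  also have "\<dots> = (\<Prod>i<m. emeasure lborel (A i))"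
    using prod.permute[OF \<tau>, of "\<lambda>i. emeasure lborel (A i)"] by (simp add: o_def)
  finally show "emeasure (distr (leb_pow m) (leb_pow m) (\<lambda>x. x \<circ> \<sigma>)) (PiE {..<m} A) =
    (\<Prod>i<m. emeasure lborel (A i))" .
qed auto

lemma nn_integral_permute_coordinates:
  assumes "\<sigma> permutes {..<m}" "f \<in> borel_measurable (leb_pow m)"
  shows "(\<integral>\<^sup>+x. f (x \<circ> \<sigma>) \<partial>(leb_pow m)) = (\<integral>\<^sup>+x. f x \<partial>(leb_pow m))"
  using nn_integral_distr[OF measurable_permute_coordinates[OF assms(1)], of f] assms
  by (simp add: distr_permute_coordinates)

lemma measurable_symmetrization [measurable]:
  assumes [measurable]: "f \<in> borel_measurable (leb_pow m)"
  shows "symmetrization m f \<in> borel_measurable (leb_pow m)"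
proof -
  have "(\<lambda>x. f (x \<circ> \<sigma>)) \<in> borel_measurable (leb_pow m)" if "\<sigma> permutes {..<m}" for \<sigma>
    using measurable_compose[OF measurable_permute_coordinates[OF that] assms] by simp
  then show ?thesis unfolding symmetrization_def[abs_def] by (auto intro!: borel_measurable_divide borel_measurable_sum)
qed

lemma card_permutes_lessThan: "card {\<sigma>. \<sigma> permutes {..<m}} = fact m"
  by (rule card_permutations) auto

text \<open>Pointwise, the square of an average is at most the average of the squares; after
  integration every permutation contributes the same norm. Kernels can therefore be approximated
  before they are symmetrized.\<close>

lemma nn_integral_symmetrization_square_le:
  assumes f[measurable]: "f \<in> borel_measurable (leb_pow m)"
  shows "(\<integral>\<^sup>+x. ennreal ((symmetrization m f x)\<^sup>2) \<partial>(leb_pow m)) \<le>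
    (\<integral>\<^sup>+x. ennreal ((f x)\<^sup>2) \<partial>(leb_pow m))"
proof -
  let ?S = "{\<sigma>. \<sigma> permutes {..<m}}"
  have fin: "finite ?S" by (rule finite_permutations) simp
  have "(symmetrization m f x)\<^sup>2 \<le> (\<Sum>\<sigma>\<in>?S. (1 / fact m) * (f (x \<circ> \<sigma>))\<^sup>2)" for x
  proof -
    have "(\<Sum>\<sigma>\<in>?S. f (x \<circ> \<sigma>))\<^sup>2 \<le> (\<Sum>\<sigma>\<in>?S. (f (x \<circ> \<sigma>))\<^sup>2) * fact m"
      using sum_squared_le_sum_of_squares[of "\<lambda>\<sigma>. f (x \<circ> \<sigma>)" ?S] by (simp add: card_permutes_lessThan)
    then have "(\<Sum>\<sigma>\<in>?S. f (x \<circ> \<sigma>))\<^sup>2 / (fact m)\<^sup>2 \<le> (\<Sum>\<sigma>\<in>?S. (f (x \<circ> \<sigma>))\<^sup>2) * fact m / (fact m)\<^sup>2"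
      by (intro divide_right_mono) auto
    then have "(symmetrization m f x)\<^sup>2 \<le> (\<Sum>\<sigma>\<in>?S. (f (x \<circ> \<sigma>))\<^sup>2) / fact m"
      by (simp add: symmetrization_def power_divide power2_eq_square[of "fact m"])
    then show ?thesis by (simp add: sum_divide_distrib)
  qed
  then have "(\<integral>\<^sup>+x. ennreal ((symmetrization m f x)\<^sup>2) \<partial>(leb_pow m)) \<le>
      (\<integral>\<^sup>+x. (\<Sum>\<sigma>\<in>?S. ennreal (1 / fact m) * ennreal ((f (x \<circ> \<sigma>))\<^sup>2)) \<partial>(leb_pow m))"
    by (intro nn_integral_mono) (simp add: sum_ennreal ennreal_mult'[symmetric] ennreal_leI)
  also have "\<dots> = (\<Sum>\<sigma>\<in>?S. ennreal (1 / fact m) * (\<integral>\<^sup>+x. ennreal ((f (x \<circ> \<sigma>))\<^sup>2) \<partial>(leb_pow m)))"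
  proof -
    have [measurable]: "(\<lambda>x. f (x \<circ> \<sigma>)) \<in> borel_measurable (leb_pow m)" if "\<sigma> \<in> ?S" for \<sigma>
      using measurable_compose[OF measurable_permute_coordinates f] that by simp
    show ?thesis by (subst nn_integral_sum) (auto simp: nn_integral_cmult)
  qed
  also have "\<dots> = (\<Sum>\<sigma>\<in>?S. ennreal (1 / fact m) * (\<integral>\<^sup>+x. ennreal ((f x)\<^sup>2) \<partial>(leb_pow m)))"
    by (intro sum.cong refl) (simp add: nn_integral_permute_coordinates[where f="\<lambda>x. ennreal ((f x)\<^sup>2)"])
  also have "\<dots> = (\<integral>\<^sup>+x. ennreal ((f x)\<^sup>2) \<partial>(leb_pow m))"
  proof -
    have "of_nat (fact m) * ennreal (1 / fact m) = ennreal (fact m * (1 / fact m))"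
      by (subst ennreal_mult) (auto simp: ennreal_of_nat_eq_real_of_nat)
    then show ?thesis by (simp add: card_permutes_lessThan flip: mult.assoc)
  qed
  finally show ?thesis .
qed

lemma symmetrization_diff:
  "symmetrization m (\<lambda>x. f x - g x) x = symmetrization m f x - symmetrization m g x"
  by (simp add: symmetrization_def sum_subtractf diff_divide_distrib)

lemma symmetrization_scale: "symmetrization m (\<lambda>x. c * f x) x = c * symmetrization m f x"
  by (simp add: symmetrization_def sum_distrib_left)

lemma elementary_symmetrization:
  assumes "elementary m B F"
  shows "elementary m B (\<lambda>V. (\<Sum>\<sigma> | \<sigma> permutes {..<m}. F (\<lambda>i. V (\<sigma> i))) / fact m)"
    (is "elementary m B ?G")
    and "elementary_fun (\<lambda>V. (\<Sum>\<sigma> | \<sigma> permutes {..<m}. F (\<lambda>i. V (\<sigma> i))) / fact m) =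
      symmetrization m (elementary_fun F)"
proof -
  have "elementary m B (\<lambda>V. (1 / fact m) * (\<Sum>\<sigma> | \<sigma> permutes {..<m}. F (\<lambda>i. V (\<sigma> i))))"
    by (intro elementary_scale elementary_sum elementary_permute[OF assms]) auto
  then show "elementary m B ?G" by simp
  show "elementary_fun ?G = symmetrization m (elementary_fun F)"
    by (simp add: fun_eq_iff elementary_fun_def symmetrization_def)
qed

section \<open>Separating the first coordinate from the others\<close>

lemma measurable_tail_coordinates [measurable]:
  "(\<lambda>x. x \<circ> Suc) \<in> measurable (leb_pow (Suc m)) (leb_pow m)"
  by (rule measurable_PiM_single') (auto simp: space_PiM PiE_iff extensional_def o_def)

lemma case_nat_extensional:
  assumes "x \<in> extensional {..<m}"
  shows "case_nat y x \<in> extensional {..<Suc m}"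
proof -
  have "case_nat y x i = undefined" if "i \<notin> {..<Suc m}" for i
    using that assms by (cases i) (auto simp: extensional_def)
  then show ?thesis by (auto simp: extensional_def)
qed

lemma measurable_case_nat_coordinates [measurable]:
  "(\<lambda>(y, x). case_nat y x) \<in>
     measurable (lborel \<Otimes>\<^sub>M (leb_pow m)) (leb_pow (Suc m))"
proof (rule measurable_PiM_single')
  fix i assume "i \<in> {..<Suc m}"
  then show "(\<lambda>\<omega>. (case \<omega> of (y, x) \<Rightarrow> case_nat y x) i) \<in> lborel \<Otimes>\<^sub>M leb_pow m \<rightarrow>\<^sub>M lborel"
    by (cases i) (auto simp: split_beta')
qed (simp add: space_PiM space_pair_measure PiE_iff Pi_iff split_beta' case_nat_extensional)

lemma distr_case_nat_coordinates:
  "distr (lborel \<Otimes>\<^sub>M (leb_pow m)) (leb_pow (Suc m)) (\<lambda>(y, x). case_nat y x) =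
     (leb_pow (Suc m))"
proof (rule lborel_PiM.PiM_eqI)
  interpret m: finite_product_sigma_finite "\<lambda>_::nat. lborel :: real measure" "{..<m}"
    by standard auto
  fix A :: "nat \<Rightarrow> real set" assume A: "\<And>i. i \<in> {..<Suc m} \<Longrightarrow> A i \<in> sets lborel"
  have "case_nat y x \<in> PiE {..<Suc m} A \<longleftrightarrow> y \<in> A 0 \<and> x \<in> PiE {..<m} (\<lambda>i. A (Suc i))"
    if "x \<in> extensional {..<m}" for y x
    using that by (auto simp: PiE_iff Ball_def All_less_Suc2 case_nat_extensional)
  then have "(\<lambda>(y, x). case_nat y x) -` PiE {..<Suc m} A \<inter> space (lborel \<Otimes>\<^sub>M (leb_pow m)) =
      A 0 \<times> PiE {..<m} (\<lambda>i. A (Suc i))"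
    by (force simp: space_PiM space_pair_measure PiE_iff)
  then have "emeasure (distr (lborel \<Otimes>\<^sub>M (leb_pow m)) (leb_pow (Suc m)) (\<lambda>(y, x). case_nat y x))
       (PiE {..<Suc m} A) =
      emeasure (lborel \<Otimes>\<^sub>M (leb_pow m)) (A 0 \<times> PiE {..<m} (\<lambda>i. A (Suc i)))"
    using A by (subst emeasure_distr) (auto intro!: sets_PiM_I_finite)
  also have "\<dots> = emeasure lborel (A 0) * (\<Prod>i<m. emeasure lborel (A (Suc i)))"
    using A lborel_PiM.emeasure_PiM[of "{..<m}" "\<lambda>i. A (Suc i)"]
    by (subst m.emeasure_pair_measure_Times) (auto intro!: sets_PiM_I_finite)
  also have "\<dots> = (\<Prod>i<Suc m. emeasure lborel (A i))"
    by (simp add: prod.lessThan_Suc_shift del: prod.lessThan_Suc)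
  finally show "emeasure (distr (lborel \<Otimes>\<^sub>M (leb_pow m)) (leb_pow (Suc m)) (\<lambda>(y, x). case_nat y x))
       (PiE {..<Suc m} A) = (\<Prod>i<Suc m. emeasure lborel (A i))" .
qed auto

lemma nn_integral_head_tail:
  assumes [measurable]: "f \<in> borel_measurable lborel" "g \<in> borel_measurable (leb_pow m)"
  shows "(\<integral>\<^sup>+x. f (x 0) * g (x \<circ> Suc) \<partial>(leb_pow (Suc m))) =
    (\<integral>\<^sup>+y. f y \<partial>lborel) * (\<integral>\<^sup>+x. g x \<partial>(leb_pow m))"
proof -
  interpret m: finite_product_sigma_finite "\<lambda>_::nat. lborel :: real measure" "{..<m}"
    by standard auto
  have "(\<integral>\<^sup>+x. f (x 0) * g (x \<circ> Suc) \<partial>(leb_pow (Suc m))) =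
    (\<integral>\<^sup>+z. f ((case z of (y, x) \<Rightarrow> case_nat y x) 0) * g ((case z of (y, x) \<Rightarrow> case_nat y x) \<circ> Suc)
       \<partial>(lborel \<Otimes>\<^sub>M (leb_pow m)))"
    by (subst distr_case_nat_coordinates[symmetric], subst nn_integral_distr) auto
  also have "\<dots> = (\<integral>\<^sup>+z. f (fst z) * g (snd z) \<partial>(lborel \<Otimes>\<^sub>M (leb_pow m)))"
    by (intro nn_integral_cong) (auto simp: o_def)
  also have "\<dots> = (\<integral>\<^sup>+y. \<integral>\<^sup>+x. f y * g x \<partial>(leb_pow m) \<partial>lborel)"
    by (subst m.nn_integral_fst[symmetric]) auto
  also have "\<dots> = (\<integral>\<^sup>+y. f y \<partial>lborel) * (\<integral>\<^sup>+x. g x \<partial>(leb_pow m))"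
    by (simp add: nn_integral_cmult nn_integral_multc)
  finally show ?thesis .
qed

lemma permutes_case_nat:
  assumes \<tau>: "\<tau> permutes {..<m}"
  shows "case_nat 0 (Suc \<circ> \<tau>) permutes {..<Suc m}"
proof (rule bij_imp_permutes)
  let ?p = "case_nat 0 (Suc \<circ> \<tau>)"
  have inj: "inj_on ?p {..<Suc m}"
  proof (rule inj_onI)
    fix x y assume "?p x = ?p y"
    then show "x = y" using permutes_inj[OF \<tau>] by (cases x; cases y) (auto dest: injD)
  qed
  have "?p i \<in> {..<Suc m}" if "i \<in> {..<Suc m}" for i
    using that permutes_in_image[OF \<tau>] by (cases i) auto
  then have "?p ` {..<Suc m} \<subseteq> {..<Suc m}" by blast
  then show "bij_betw ?p {..<Suc m} {..<Suc m}"
    using endo_inj_surj[OF _ _ inj] inj by (simp add: bij_betw_def)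
next
  fix x assume "x \<notin> {..<Suc m}"
  then show "case_nat 0 (Suc \<circ> \<tau>) x = x"
    using permutes_not_in[OF \<tau>] by (cases x) auto
qed

text \<open>Averaging over the permutations that fix the first coordinate changes nothing under the
  full average.\<close>

lemma symmetrization_tensor_symmetrization:
  "symmetrization (Suc m) (\<lambda>x. h (x 0) * k (x \<circ> Suc)) x =
   symmetrization (Suc m) (\<lambda>x. h (x 0) * symmetrization m k (x \<circ> Suc)) x"
proof -
  let ?S = "\<lambda>m. {\<sigma>. \<sigma> permutes {..<m}}"
  \<comment> \<open>Right composition with the extension of \<open>\<tau>\<close> that fixes 0
    permutes the range of summation and leaves \<open>(x \<circ> \<sigma>) 0\<close>
    unchanged.\<close>
  have A: "(\<Sum>\<sigma>\<in>?S (Suc m). h ((x \<circ> \<sigma>) 0) * k ((x \<circ> \<sigma>) \<circ> Suc)) =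
      (\<Sum>\<sigma>\<in>?S (Suc m). h ((x \<circ> \<sigma>) 0) * k ((x \<circ> \<sigma>) \<circ> Suc \<circ> \<tau>))" if \<tau>: "\<tau> \<in> ?S m" for \<tau>
  proof -
    have eq: "(x \<circ> (\<sigma> \<circ> case_nat 0 (Suc \<circ> \<tau>)) \<circ> Suc) = x \<circ> \<sigma> \<circ> Suc \<circ> \<tau>" for \<sigma> by (auto simp: fun_eq_iff)
    show ?thesis
      using sum_permutations_compose_right[OF permutes_case_nat[of \<tau> m], of "\<lambda>\<sigma>. h ((x \<circ> \<sigma>) 0) * k ((x \<circ> \<sigma>) \<circ> Suc)"] \<tau>
      by (simp add: eq)
  qed
  have "(\<Sum>\<sigma>\<in>?S (Suc m). h ((x \<circ> \<sigma>) 0) * symmetrization m k ((x \<circ> \<sigma>) \<circ> Suc)) =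
      (\<Sum>\<sigma>\<in>?S (Suc m). \<Sum>\<tau>\<in>?S m. h ((x \<circ> \<sigma>) 0) * k ((x \<circ> \<sigma>) \<circ> Suc \<circ> \<tau>)) / fact m"
    by (simp add: symmetrization_def sum_distrib_left sum_divide_distrib mult_ac)
  also have "\<dots> = (\<Sum>\<tau>\<in>?S m. \<Sum>\<sigma>\<in>?S (Suc m). h ((x \<circ> \<sigma>) 0) * k ((x \<circ> \<sigma>) \<circ> Suc \<circ> \<tau>)) / fact m"
    by (subst sum.swap) simp
  also have "\<dots> = (\<Sum>\<tau>\<in>?S m. \<Sum>\<sigma>\<in>?S (Suc m). h ((x \<circ> \<sigma>) 0) * k ((x \<circ> \<sigma>) \<circ> Suc)) / fact m"
    by (intro arg_cong2[where f="(/)"] refl sum.cong[OF refl A[symmetric]])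
  also have "\<dots> = (\<Sum>\<sigma>\<in>?S (Suc m). h ((x \<circ> \<sigma>) 0) * k ((x \<circ> \<sigma>) \<circ> Suc))"
    by (simp add: card_permutes_lessThan)
  finally show ?thesis unfolding symmetrization_def by simp
qed

text \<open>Integrating out coordinate \<open>i\<close> first reduces the set where it equals
  coordinate \<open>k\<close> to a single point. The diagonals have to be discarded because the
  kernel estimates below hold only off them.\<close>

lemma AE_inj_on_coordinates:
  "AE x in (leb_pow m). inj_on x {..<m}"
proof -
  have "AE x in (leb_pow m). x i \<noteq> x k" if ik: "i < m" "k < m" "i \<noteq> k" for i k
  proof -
    let ?I = "{..<m} - {i}"
    have I: "insert i ?I = {..<m}" using ik by auto
    have k: "k \<in> ?I" using ik by auto
    have mb: "(\<lambda>x. indicator {x. x i = x k} x :: ennreal) \<in> borel_measurable (leb_pow m)"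
    proof -
      have "(\<lambda>x. x i) \<in> borel_measurable (leb_pow m)"
        "(\<lambda>x. x k) \<in> borel_measurable (leb_pow m)" using ik by auto
      note [measurable] = this
      have "(\<lambda>x. indicator {0} (x i - x k) :: ennreal) \<in> borel_measurable (leb_pow m)"
        by measurable
      then show ?thesis by (simp add: indicator_def)
    qed
    then have mb': "(\<lambda>x. indicator {x. x i = x k} x :: ennreal) \<in> borel_measurable (Pi\<^sub>M (insert i ?I) (\<lambda>_. lborel :: real measure))"
      by (simp only: I)
    have "(\<integral>\<^sup>+x. indicator {x. x i = x k} x \<partial>(leb_pow m)) =
        (\<integral>\<^sup>+x. \<integral>\<^sup>+y. indicator {x. x i = x k} (x(i := y)) \<partial>lborel \<partial>(Pi\<^sub>M ?I (\<lambda>_. lborel :: real measure)))"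
      using lborel_PiM.product_nn_integral_insert[of ?I i, OF _ _ mb'] by (simp only: I) simp
    also have "\<dots> = (\<integral>\<^sup>+x. \<integral>\<^sup>+y. indicator {x k} y \<partial>lborel \<partial>(Pi\<^sub>M ?I (\<lambda>_. lborel :: real measure)))"
      using ik by (intro nn_integral_cong) (auto simp: indicator_def)
    also have "\<dots> = 0" by simp
    finally have "AE x in (leb_pow m). indicator {x. x i = x k} x = (0::ennreal)"
      using nn_integral_0_iff_AE[OF mb] by simp
    then show ?thesis by eventually_elim (auto simp: indicator_def split: if_splits)
  qed
  then have "AE x in (leb_pow m). \<forall>i\<in>{..<m}. \<forall>k\<in>{..<m}-{i}. x i \<noteq> x k"
    by (intro AE_finite_allI) auto
  then show ?thesis by eventually_elim (auto simp: inj_on_def)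
qed

section \<open>Elementary integrals of Brownian motion\<close>

text \<open>Pointwise this is \<open>(a + b)\<^sup>2 \<le> 2 * a\<^sup>2 + 2 * b\<^sup>2\<close>.
  With \<open>nn_integral\<close> it also covers infinite distances. The factors 2 are the origin of
  the constants 4 and 8 in the distance bounds below.\<close>

lemma nn_integral_square_diff_triangle:
  fixes f g h :: "'a \<Rightarrow> real"
  assumes [measurable]: "f \<in> borel_measurable M" "g \<in> borel_measurable M" "h \<in> borel_measurable M"
  shows "(\<integral>\<^sup>+x. ennreal ((f x - h x)\<^sup>2) \<partial>M) \<le>
    2 * (\<integral>\<^sup>+x. ennreal ((f x - g x)\<^sup>2) \<partial>M) + 2 * (\<integral>\<^sup>+x. ennreal ((g x - h x)\<^sup>2) \<partial>M)"
proof -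
  have "(f x - h x)\<^sup>2 \<le> 2 * (f x - g x)\<^sup>2 + 2 * (g x - h x)\<^sup>2" for x
    using zero_le_power2[of "(f x - g x) - (g x - h x)"] by (simp add: power2_eq_square algebra_simps)
  then have "(\<integral>\<^sup>+x. ennreal ((f x - h x)\<^sup>2) \<partial>M) \<le>
      (\<integral>\<^sup>+x. ennreal 2 * ennreal ((f x - g x)\<^sup>2) + ennreal 2 * ennreal ((g x - h x)\<^sup>2) \<partial>M)"
  proof (intro nn_integral_mono)
    fix x
    have "ennreal ((f x - h x)\<^sup>2) \<le> ennreal (2 * (f x - g x)\<^sup>2 + 2 * (g x - h x)\<^sup>2)"
      using \<open>\<And>x. (f x - h x)\<^sup>2 \<le> 2 * (f x - g x)\<^sup>2 + 2 * (g x - h x)\<^sup>2\<close> by (rule ennreal_leI)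
    also have "\<dots> = ennreal 2 * ennreal ((f x - g x)\<^sup>2) + ennreal 2 * ennreal ((g x - h x)\<^sup>2)"
      by (subst ennreal_plus) (auto simp del: ennreal_numeral simp: ennreal_mult')
    finally show "ennreal ((f x - h x)\<^sup>2) \<le> ennreal 2 * ennreal ((f x - g x)\<^sup>2) + ennreal 2 * ennreal ((g x - h x)\<^sup>2)" .
  qed
  also have "\<dots> = 2 * (\<integral>\<^sup>+x. ennreal ((f x - g x)\<^sup>2) \<partial>M) + 2 * (\<integral>\<^sup>+x. ennreal ((g x - h x)\<^sup>2) \<partial>M)"
    by (simp add: nn_integral_add nn_integral_cmult)
  finally show ?thesis .
qed

lemma nn_integral_square_scaled_diff:
  fixes f g :: "'a \<Rightarrow> real"
  assumes [measurable]: "f \<in> borel_measurable M" "g \<in> borel_measurable M"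
  shows "(\<integral>\<^sup>+x. ennreal ((\<rho> * f x - \<rho> * g x)\<^sup>2) \<partial>M) = ennreal (\<rho>\<^sup>2) * (\<integral>\<^sup>+x. ennreal ((f x - g x)\<^sup>2) \<partial>M)"
proof -
  have "ennreal ((\<rho> * f x - \<rho> * g x)\<^sup>2) = ennreal (\<rho>\<^sup>2) * ennreal ((f x - g x)\<^sup>2)" for x
    by (simp add: ennreal_mult'[symmetric] power_mult_distrib[symmetric] right_diff_distrib)
  then show ?thesis by (simp add: nn_integral_cmult)
qed

definition elementary_int :: "(real \<Rightarrow> 'a \<Rightarrow> real) \<Rightarrow> ((nat \<Rightarrow> real \<Rightarrow> real) \<Rightarrow> real) \<Rightarrow> 'a \<Rightarrow> real" where
  "elementary_int W F z = F (\<lambda>i y. W y z)"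

lemma step_integral_eq_grid_functional:
  "step_integral W m N u a = elementary_int W (grid_functional m N u a)"
  by (simp add: fun_eq_iff step_integral_def elementary_int_def grid_functional_def)

text \<open>Two injective multi-indices with the same image differ by a permutation of
  \<open>{..<m}\<close> and yield the same product of increments. This count is the source of the
  factor \<open>fact m\<close> in the second moment bound.\<close>

lemma card_offdiag_same_image:
  assumes j: "j \<in> offdiag_indices m N"
  shows "card {k \<in> offdiag_indices m N. k ` {..<m} = j ` {..<m}} \<le> fact m"
proof -
  let ?S = "{\<sigma>. \<sigma> permutes {..<m}}"
  have "{k \<in> offdiag_indices m N. k ` {..<m} = j ` {..<m}} \<subseteq> (\<lambda>\<sigma>. restrict (j \<circ> \<sigma>) {..<m}) ` ?S"
  proof
    fix k assume "k \<in> {k \<in> offdiag_indices m N. k ` {..<m} = j ` {..<m}}"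
    then have k: "inj_on k {..<m}" "k \<in> extensional {..<m}" "k ` {..<m} = j ` {..<m}"
      by (auto simp: offdiag_indices_def PiE_iff)
    have jb: "bij_betw j {..<m} (j ` {..<m})"
      using j by (auto simp: offdiag_indices_def bij_betw_def)
    define \<sigma> where "\<sigma> i = (if i < m then inv_into {..<m} j (k i) else i)" for i
    have "bij_betw (inv_into {..<m} j \<circ> k) {..<m} {..<m}"
      using k jb by (intro bij_betw_trans[of k _ "j ` {..<m}"] bij_betw_inv_into) (auto simp: bij_betw_def)
    then have "bij_betw \<sigma> {..<m} {..<m}"
      by (rule bij_betw_cong[THEN iffD1, rotated]) (auto simp: \<sigma>_def)
    then have "\<sigma> permutes {..<m}" by (rule bij_imp_permutes) (auto simp: \<sigma>_def)
    moreover have "k = restrict (j \<circ> \<sigma>) {..<m}"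
    proof
      fix i show "k i = restrict (j \<circ> \<sigma>) {..<m} i"
      proof (cases "i < m")
        case True
        then have "k i \<in> j ` {..<m}" using k(3) by blast
        then show ?thesis using True by (simp add: \<sigma>_def f_inv_into_f)
      qed (use k(2) in \<open>auto simp: extensional_def\<close>)
    qed
    ultimately show "k \<in> (\<lambda>\<sigma>. restrict (j \<circ> \<sigma>) {..<m}) ` ?S" by blast
  qed
  moreover have "finite ?S" by (rule finite_permutations) simp
  ultimately have "card {k \<in> offdiag_indices m N. k ` {..<m} = j ` {..<m}} \<le> card ?S"
    by (meson card_image_le card_mono finite_imageI le_trans)
  then show ?thesis by (simp add: card_permutes_lessThan)
qed

lemma ennreal_fact: "ennreal (fact m) = fact m"
  by (metis ennreal_of_nat_eq_real_of_nat of_nat_fact)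

locale brownian_motion = prob_space M for M :: "'a measure" +
  fixes W :: "real \<Rightarrow> 'a \<Rightarrow> real"
  assumes two_sided: "two_sided_brownian_motion M W"
begin

lemma measurable_W [measurable]: "W x \<in> borel_measurable M"
  using two_sided by (simp add: two_sided_brownian_motion_def)

lemma distributed_increment:
  "x < y \<Longrightarrow> distributed M lborel (\<lambda>z. W y z - W x z) (normal_density 0 (sqrt (y - x)))"
  using two_sided by (simp add: two_sided_brownian_motion_def)

lemma indep_increments:
  "strict_mono_on {..N} u \<Longrightarrow> indep_vars (\<lambda>_. borel) (\<lambda>k z. W (u (Suc k)) z - W (u k) z) {..<N::nat}"
  using two_sided by (simp add: two_sided_brownian_motion_def)

lemma increment_moments:
  assumes "x < y"
  shows "integrable M (\<lambda>z. W y z - W x z)" "integrable M (\<lambda>z. (W y z - W x z)\<^sup>2)"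
    "expectation (\<lambda>z. W y z - W x z) = 0" "expectation (\<lambda>z. (W y z - W x z)\<^sup>2) = y - x"
proof -
  let ?s = "sqrt (y - x)"
  have s: "?s > 0" using assms by simp
  note D = distributed_increment[OF assms]
  show "integrable M (\<lambda>z. W y z - W x z)"
    using distributed_integrable[OF D, of "\<lambda>x. x"] integrable_normal_moment[OF s, of 0 1] by simp
  show "integrable M (\<lambda>z. (W y z - W x z)\<^sup>2)"
    using distributed_integrable[OF D, of "\<lambda>x. x\<^sup>2"] integrable_normal_moment[OF s, of 0 2] by simp
  show "expectation (\<lambda>z. W y z - W x z) = 0"
    using distributed_integral[OF D, of "\<lambda>x. x"] integral_normal_moment_odd[OF s, of 0 0] by simp
  show "expectation (\<lambda>z. (W y z - W x z)\<^sup>2) = y - x"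
    using distributed_integral[OF D, of "\<lambda>x. x\<^sup>2"] integral_normal_moment_even[OF s, of 0 1] assms by simp
qed

lemma measurable_elementary_int [measurable (raw)]:
  assumes "elementary m B F"
  shows "elementary_int W F \<in> borel_measurable M"
  using assms
proof (induction rule: elementary.induct)
  case elementary_zero
  then show ?case by (simp add: elementary_int_def[abs_def])
next
  case (elementary_add_monomial F lo hi c)
  have "(\<lambda>z. elementary_int W F z + c * (\<Prod>i<m. W (hi i) z - W (lo i) z)) \<in> borel_measurable M"
    by (intro borel_measurable_add borel_measurable_times elementary_add_monomial(5)) auto
  then show ?case by (simp add: elementary_int_def[abs_def] box_monomial_def)
qed

text \<open>By independence the expectation factors over the cells. A cell in exactly one of
  \<open>J\<close> and \<open>K\<close> contributes the mean of a centred increment, which makes the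
  product vanish; a cell in both contributes its length.\<close>

lemma expectation_increment_products:
  fixes u :: "nat \<Rightarrow> real"
  assumes u: "strict_mono_on {..N} u" and J: "J \<subseteq> {..<N}" "K \<subseteq> {..<N}"
  defines "D \<equiv> \<lambda>l z. W (u (Suc l)) z - W (u l) z"
  shows "integrable M (\<lambda>z. (\<Prod>l\<in>J. D l z) * (\<Prod>l\<in>K. D l z))"
    and "expectation (\<lambda>z. (\<Prod>l\<in>J. D l z) * (\<Prod>l\<in>K. D l z)) =
      (if J = K then \<Prod>l\<in>J. u (Suc l) - u l else 0)"
proof -
  \<comment> \<open>The contribution of each cell is written as one function of its increment, equal
    to 1, \<open>d\<close> or \<open>d * d\<close>. This merges the two products into one product of
    independent factors.\<close>
  define y where "y l d = (if l \<in> J then d else 1) * (if l \<in> K then d else 1)" for l and d :: real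
  have eq: "(\<Prod>l\<in>J. D l z) * (\<Prod>l\<in>K. D l z) = (\<Prod>l<N. y l (D l z))" for z
    using J by (simp add: y_def prod.distrib prod.If_cases Int_absorb1)
  have less: "u l < u (Suc l)" if "l < N" for l using u that by (auto simp: strict_mono_on_def)
  note mom = increment_moments[OF less, folded D_def]
  have ind: "indep_vars (\<lambda>_. borel) (\<lambda>l z. y l (D l z)) {..<N}"
    by (rule indep_vars_compose2[OF indep_increments[OF u, folded D_def]]) (auto simp: y_def)
  have int: "integrable M (\<lambda>z. y l (D l z))" if "l \<in> {..<N}" for l
    using mom(1,2)[of l] that by (cases "l \<in> J"; cases "l \<in> K") (simp_all add: y_def D_def power2_eq_square)
  show "integrable M (\<lambda>z. (\<Prod>l\<in>J. D l z) * (\<Prod>l\<in>K. D l z))"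
    unfolding eq using indep_vars_integrable[OF _ ind int] by simp
  have "expectation (\<lambda>z. (\<Prod>l\<in>J. D l z) * (\<Prod>l\<in>K. D l z)) = (\<Prod>l<N. expectation (\<lambda>z. y l (D l z)))"
    unfolding eq using indep_vars_lebesgue_integral[OF _ ind int] by simp
  also have "\<dots> = (\<Prod>l<N. if l \<in> J \<and> l \<in> K then u (Suc l) - u l else if l \<in> J \<or> l \<in> K then 0 else 1)"
    using mom(3,4) by (intro prod.cong refl) (auto simp: y_def D_def power2_eq_square prob_space)
  also have "\<dots> = (if J = K then \<Prod>l\<in>J. u (Suc l) - u l else 0)"
  proof (cases "J = K")
    case True
    have "(\<Prod>l<N. if l \<in> J \<and> l \<in> K then u (Suc l) - u l else if l \<in> J \<or> l \<in> K then 0 else 1) =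
        (\<Prod>l<N. if l \<in> J then u (Suc l) - u l else 1)"
      using True by (intro prod.cong) auto
    also have "\<dots> = (\<Prod>l\<in>J. u (Suc l) - u l)"
      using J by (simp add: prod.If_cases Int_absorb1)
    finally show ?thesis using True by simp
  next
    case False
    then obtain l where "(l \<in> J \<and> l \<notin> K) \<or> (l \<in> K \<and> l \<notin> J)" by blast
    with J have "l \<in> {..<N}" "\<not> (l \<in> J \<and> l \<in> K)" "l \<in> J \<or> l \<in> K" by auto
    then have "(\<Prod>l<N. if l \<in> J \<and> l \<in> K then u (Suc l) - u l else if l \<in> J \<or> l \<in> K then 0 else 1) = 0"
      by (intro prod_zero) (auto intro!: bexI[of _ l])
    then show ?thesis using False by simp
  qed
  finally show "expectation (\<lambda>z. (\<Prod>l\<in>J. D l z) * (\<Prod>l\<in>K. D l z)) =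
      (if J = K then \<Prod>l\<in>J. u (Suc l) - u l else 0)" .
qed

text \<open>Bounding by the norm of the integrand itself rather than of its symmetrization loses the
  equality in the isometry, but only this inequality is needed.\<close>

lemma nn_integral_elementary_int_square_le:
  assumes F: "elementary m B F"
  shows "(\<integral>\<^sup>+z. ennreal ((elementary_int W F z)\<^sup>2) \<partial>M) \<le>
    fact m * (\<integral>\<^sup>+x. ennreal ((elementary_fun F x)\<^sup>2) \<partial>leb_pow m)"
proof -
  obtain N :: nat and u a where u: "strict_mono_on {..N} u" and Feq: "F = grid_functional m N u a"
    using elementary_obtain_grid[OF F] by blast
  define D where "D l z = W (u (Suc l)) z - W (u l) z" for l z
  let ?I = "offdiag_indices m N"
  \<comment> \<open>The Gram matrix of the products of increments: two multi-indices interact only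
    if they use the same set of cells.\<close>
  define E where "E j k = (if j ` {..<m} = k ` {..<m} then \<Prod>l\<in>j ` {..<m}. u (Suc l) - u l else 0)"
    for j k :: "nat \<Rightarrow> nat"
  have inj: "inj_on j {..<m}" and sub: "j ` {..<m} \<subseteq> {..<N}" if "j \<in> ?I" for j
    using that by (auto simp: offdiag_indices_def)
  have reidx: "(\<Prod>l\<in>j ` {..<m}. f l) = (\<Prod>i<m. f (j i))" if "j \<in> ?I" for j and f :: "nat \<Rightarrow> real"
    using prod.reindex[OF inj[OF that], of f] by simp
  have int: "integrable M (\<lambda>z. (\<Prod>i<m. D (j i) z) * (\<Prod>i<m. D (k i) z))"
    and ex: "expectation (\<lambda>z. (\<Prod>i<m. D (j i) z) * (\<Prod>i<m. D (k i) z)) = E j k"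
    if "j \<in> ?I" "k \<in> ?I" for j k
    using expectation_increment_products[OF u sub[OF that(1)] sub[OF that(2)]] that
    by (simp_all add: D_def reidx E_def cong: if_cong)
  have sq: "(elementary_int W F z)\<^sup>2 =
      (\<Sum>j\<in>?I. \<Sum>k\<in>?I. (a j * a k) * ((\<Prod>i<m. D (j i) z) * (\<Prod>i<m. D (k i) z)))" for z
    unfolding elementary_int_def Feq grid_functional_def D_def power2_eq_square sum_product
    by (simp add: mult_ac)
  have intsq: "integrable M (\<lambda>z. (elementary_int W F z)\<^sup>2)"
    unfolding sq using int by auto
  have Enn: "0 \<le> E j k" if "j \<in> ?I" for j k
  proof -
    have "u l \<le> u (Suc l)" if "l \<in> j ` {..<m}" for l
      using sub[OF \<open>j \<in> ?I\<close>] that strict_mono_on_leD[OF u, of l "Suc l"] by auto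
    then show ?thesis unfolding E_def by (auto intro!: prod_nonneg simp del: image_iff)
  qed
  have Esym: "E j k = E k j" if "j \<in> ?I" "k \<in> ?I" for j k
    by (auto simp: E_def)
  have "expectation (\<lambda>z. (elementary_int W F z)\<^sup>2) = (\<Sum>j\<in>?I. \<Sum>k\<in>?I. (a j * a k) * E j k)"
    unfolding sq using int by (simp add: Bochner_Integration.integral_sum ex)
  \<comment> \<open>The mixed coefficients are removed by the inequality of geometric and arithmetic
    means. As \<open>E\<close> is symmetric and nonnegative, row sums remain, and a row has at most
    \<open>fact m\<close> nonzero entries.\<close>
  also have "\<dots> \<le> (\<Sum>j\<in>?I. \<Sum>k\<in>?I. ((a j)\<^sup>2 / 2 + (a k)\<^sup>2 / 2) * E j k)"
  proof (intro sum_mono mult_right_mono)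
    fix j k
    show "a j * a k \<le> (a j)\<^sup>2 / 2 + (a k)\<^sup>2 / 2"
      using sum_squares_bound[of "a j" "a k"] by simp
  qed (auto simp: Enn)
  also have "\<dots> = (\<Sum>j\<in>?I. \<Sum>k\<in>?I. (a j)\<^sup>2 / 2 * E j k) + (\<Sum>j\<in>?I. \<Sum>k\<in>?I. (a k)\<^sup>2 / 2 * E j k)"
    by (simp add: distrib_right sum.distrib)
  also have "(\<Sum>j\<in>?I. \<Sum>k\<in>?I. (a k)\<^sup>2 / 2 * E j k) = (\<Sum>j\<in>?I. \<Sum>k\<in>?I. (a j)\<^sup>2 / 2 * E j k)"
    by (subst sum.swap) (auto intro!: sum.cong simp: Esym)
  also have "(\<Sum>j\<in>?I. \<Sum>k\<in>?I. (a j)\<^sup>2 / 2 * E j k) + (\<Sum>j\<in>?I. \<Sum>k\<in>?I. (a j)\<^sup>2 / 2 * E j k) =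
      (\<Sum>j\<in>?I. \<Sum>k\<in>?I. (a j)\<^sup>2 * E j k)"
    by (simp flip: sum.distrib add: field_simps)
  also have "\<dots> = (\<Sum>j\<in>?I. (a j)\<^sup>2 * (card {k\<in>?I. k ` {..<m} = j ` {..<m}} * E j j))"
  proof (intro sum.cong refl)
    fix j assume j: "j \<in> ?I"
    have "(\<Sum>k\<in>?I. E j k) = (\<Sum>k\<in>{k\<in>?I. k ` {..<m} = j ` {..<m}}. E j j)"
      by (rule sum.mono_neutral_cong_right) (auto simp: E_def)
    then show "(\<Sum>k\<in>?I. (a j)\<^sup>2 * E j k) = (a j)\<^sup>2 * (card {k\<in>?I. k ` {..<m} = j ` {..<m}} * E j j)"
      by (simp flip: sum_distrib_left)
  qed
  also have "\<dots> \<le> (\<Sum>j\<in>?I. (a j)\<^sup>2 * (fact m * E j j))"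
  proof (intro sum_mono mult_left_mono mult_right_mono)
    fix j assume "j \<in> ?I"
    from card_offdiag_same_image[OF this]
    show "real (card {k\<in>?I. k ` {..<m} = j ` {..<m}}) \<le> fact m"
      by (metis of_nat_fact of_nat_le_iff)
  qed (auto simp: Enn)
  also have "\<dots> = fact m * (\<Sum>j\<in>?I. (a j)\<^sup>2 * (\<Prod>i<m. u (Suc (j i)) - u (j i)))"
    by (simp add: E_def reidx sum_distrib_left mult_ac)
  finally have le: "expectation (\<lambda>z. (elementary_int W F z)\<^sup>2) \<le>
      fact m * (\<Sum>j\<in>?I. (a j)\<^sup>2 * (\<Prod>i<m. u (Suc (j i)) - u (j i)))" .
  have "(\<integral>\<^sup>+z. ennreal ((elementary_int W F z)\<^sup>2) \<partial>M) = ennreal (expectation (\<lambda>z. (elementary_int W F z)\<^sup>2))"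
    using intsq by (intro nn_integral_eq_integral) auto
  also have "\<dots> \<le> ennreal (fact m * (\<Sum>j\<in>?I. (a j)\<^sup>2 * (\<Prod>i<m. u (Suc (j i)) - u (j i))))"
    using le by (rule ennreal_leI)
  also have "\<dots> = fact m * (\<integral>\<^sup>+x. ennreal ((elementary_fun F x)\<^sup>2) \<partial>leb_pow m)"
    unfolding Feq step_fun_eq_grid_functional[OF u, symmetric] nn_integral_step_fun_square[OF u]
    by (subst ennreal_mult') (simp_all add: ennreal_fact)
  finally show ?thesis .
qed

text \<open>The approximants \<open>G n\<close> supplied by the definition are inserted twice: on
  the probability space, and, after the second moment bound, on \<open>leb_pow m\<close>. Each
  insertion costs a factor 2, and the terms comparing \<open>G n\<close> with its limit vanish as
  \<open>n\<close> grows. The scalar \<open>\<rho>\<close> is carried along because kernels are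
  compared only after rescaling.\<close>

lemma wiener_ito_elementary_distance:
  assumes X: "has_wiener_ito M W m f X" and F: "elementary m B F"
  shows "(\<integral>\<^sup>+z. ennreal ((\<rho> * X z - elementary_int W F z)\<^sup>2) \<partial>M) \<le>
    4 * fact m * (\<integral>\<^sup>+x. ennreal ((\<rho> * symmetrization m f x - elementary_fun F x)\<^sup>2) \<partial>leb_pow m)"
proof -
  from X obtain N :: "nat \<Rightarrow> nat" and u a where f[measurable]: "f \<in> borel_measurable (leb_pow m)"
    and Xm[measurable]: "X \<in> borel_measurable M"
    and u: "\<And>n. strict_mono_on {..N n} (u n)"
    and l1: "(\<lambda>n. \<integral>\<^sup>+ x. ennreal ((step_fun m (N n) (u n) (a n) x - symmetrization m f x)\<^sup>2)
                \<partial>leb_pow m) \<longlonglongrightarrow> 0"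
    and l2: "(\<lambda>n. \<integral>\<^sup>+ z. ennreal ((step_integral W m (N n) (u n) (a n) z - X z)\<^sup>2) \<partial>M) \<longlonglongrightarrow> 0"
    unfolding has_wiener_ito_def by blast
  define G where "G n = grid_functional m (N n) (u n) (a n)" for n
  have G: "elementary m UNIV (G n)" for n
    using elementary_mono[OF elementary_grid_functional[OF u]] by (simp add: G_def)
  have F': "elementary m UNIV F" using elementary_mono[OF F] by simp
  note [measurable] = measurable_elementary_fun[OF G] measurable_elementary_fun[OF F]
    measurable_elementary_int[OF G] measurable_elementary_int[OF F]
  define d e where "d n = (\<integral>\<^sup>+ x. ennreal ((elementary_fun (G n) x - symmetrization m f x)\<^sup>2) \<partial>leb_pow m)"
    and "e n = (\<integral>\<^sup>+ z. ennreal ((elementary_int W (G n) z - X z)\<^sup>2) \<partial>M)" for n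
  let ?c = "\<integral>\<^sup>+x. ennreal ((\<rho> * symmetrization m f x - elementary_fun F x)\<^sup>2) \<partial>leb_pow m"
  have "(\<integral>\<^sup>+z. ennreal ((\<rho> * X z - elementary_int W F z)\<^sup>2) \<partial>M) \<le>
     2 * (ennreal (\<rho>\<^sup>2) * e n) + 2 * (fact m * (2 * (ennreal (\<rho>\<^sup>2) * d n) + 2 * ?c))" for n
  proof -
    have "(\<integral>\<^sup>+z. ennreal ((\<rho> * X z - elementary_int W F z)\<^sup>2) \<partial>M) \<le>
       2 * (\<integral>\<^sup>+z. ennreal ((\<rho> * X z - \<rho> * elementary_int W (G n) z)\<^sup>2) \<partial>M) +
       2 * (\<integral>\<^sup>+z. ennreal ((\<rho> * elementary_int W (G n) z - elementary_int W F z)\<^sup>2) \<partial>M)"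
      by (intro nn_integral_square_diff_triangle) auto
    also have "(\<integral>\<^sup>+z. ennreal ((\<rho> * X z - \<rho> * elementary_int W (G n) z)\<^sup>2) \<partial>M) = ennreal (\<rho>\<^sup>2) * e n"
    proof -
      have "(X z - elementary_int W (G n) z)\<^sup>2 = (elementary_int W (G n) z - X z)\<^sup>2" for z
        by (rule power2_commute)
      then show ?thesis unfolding e_def by (subst nn_integral_square_scaled_diff) auto
    qed
    also have "(\<integral>\<^sup>+z. ennreal ((\<rho> * elementary_int W (G n) z - elementary_int W F z)\<^sup>2) \<partial>M) \<le>
       fact m * (\<integral>\<^sup>+x. ennreal ((\<rho> * elementary_fun (G n) x - elementary_fun F x)\<^sup>2) \<partial>leb_pow m)"
      using nn_integral_elementary_int_square_le[OF elementary_diff[OF elementary_scale[OF G[of n], of \<rho>] F']]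
      by (simp add: elementary_int_def elementary_fun_def)
    also have "(\<integral>\<^sup>+x. ennreal ((\<rho> * elementary_fun (G n) x - elementary_fun F x)\<^sup>2) \<partial>leb_pow m) \<le>
      2 * (\<integral>\<^sup>+x. ennreal ((\<rho> * elementary_fun (G n) x - \<rho> * symmetrization m f x)\<^sup>2) \<partial>leb_pow m) + 2 * ?c"
      by (intro nn_integral_square_diff_triangle) auto
    also have "(\<integral>\<^sup>+x. ennreal ((\<rho> * elementary_fun (G n) x - \<rho> * symmetrization m f x)\<^sup>2) \<partial>leb_pow m) = ennreal (\<rho>\<^sup>2) * d n"
      unfolding d_def by (rule nn_integral_square_scaled_diff) auto
    finally show ?thesis by (simp add: mult_left_mono add_left_mono)
  qed
  moreover have "(\<lambda>n. 2 * (ennreal (\<rho>\<^sup>2) * e n) + 2 * (fact m * (2 * (ennreal (\<rho>\<^sup>2) * d n) + 2 * ?c)))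
      \<longlonglongrightarrow> 2 * (ennreal (\<rho>\<^sup>2) * 0) + 2 * (fact m * (2 * (ennreal (\<rho>\<^sup>2) * 0) + 2 * ?c))"
  proof -
    have "e \<longlonglongrightarrow> 0" "d \<longlonglongrightarrow> 0"
      using l1 l2 by (simp_all add: e_def[abs_def] d_def[abs_def] G_def step_fun_eq_grid_functional[OF u]
        step_integral_eq_grid_functional)
    moreover have "fact m \<noteq> (\<top> :: ennreal)"
      by (metis ennreal_of_nat_eq_real_of_nat ennreal_neq_top of_nat_fact infinity_ennreal_def)
    ultimately show ?thesis
      by (intro tendsto_add tendsto_const ennreal_tendsto_cmult) (auto simp: less_top[symmetric])
  qed
  ultimately have "(\<integral>\<^sup>+z. ennreal ((\<rho> * X z - elementary_int W F z)\<^sup>2) \<partial>M) \<le>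
    2 * (ennreal (\<rho>\<^sup>2) * 0) + 2 * (fact m * (2 * (ennreal (\<rho>\<^sup>2) * 0) + 2 * ?c))"
    by (intro LIMSEQ_le_const) auto
  then show ?thesis by (simp add: mult_ac)
qed

text \<open>Both integrals are functions of increments over grid cells, those of \<open>F\<close> to
  the right of \<open>r\<close> and those of \<open>G\<close> to the left. The grid contains
  \<open>r\<close>, so no cell straddles it and the two families of increments have no cell in
  common.\<close>

lemma indep_var_elementary_int:
  assumes F: "elementary m {r..} F" and G: "elementary k {..r} G"
  shows "indep_var borel (elementary_int W F) borel (elementary_int W G)"
proof -
  obtain P where P: "finite P" "P \<subseteq> {r..}" "elementary m P F" using elementary_finite_support[OF F] by auto
  obtain Q where Q: "finite Q" "Q \<subseteq> {..r}" "elementary k Q G" using elementary_finite_support[OF G] by auto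
  obtain L :: nat and w where w: "strict_mono_on {..L} w" and wi: "w ` {..L} = P \<union> Q \<union> {r}"
    using finite_grid[of "P \<union> Q \<union> {r}"] P Q by auto
  then obtain p where p: "p \<le> L" "w p = r" by (metis UnCI atMost_iff imageE insertI1)
  have le: "x \<le> y \<longleftrightarrow> w x \<le> w y" if "x \<le> L" "y \<le> L" for x y
    using that strict_mono_on_less_eq[OF w] by simp
  define D where "D l z = W (w (Suc l)) z - W (w l) z" for l z
  \<comment> \<open>A path rebuilt from the increments \<open>x\<close> over the cells in
    \<open>A\<close>. It need not agree with \<open>W\<close>, but elementary functionals see only
    differences between two endpoints, and these agree once all cells in between belong to
    \<open>A\<close>.\<close>
  define V where "V A x y = (\<Sum>l\<in>A. if w l < y then x l else (0::real))" for A :: "nat set" and x :: "nat \<Rightarrow> real" and y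
  have Vdiff: "V A (\<lambda>l\<in>A. D l z) hi - V A (\<lambda>l\<in>A. D l z) lo = W hi z - W lo z"
    if "lo < hi" "lo = w x" "hi = w y" "x \<le> L" "y \<le> L" "{x..<y} \<subseteq> A" "A \<subseteq> {..<L}" for A lo hi x y z
  proof -
    have fin: "finite A" using that(7) finite_subset by blast
    have "x < y" using that le[of y x] by auto
    have "V A (\<lambda>l\<in>A. D l z) hi - V A (\<lambda>l\<in>A. D l z) lo = (\<Sum>l\<in>A. if l \<in> {x..<y} then D l z else 0)"
      unfolding V_def sum_subtractf[symmetric]
    proof (intro sum.cong refl)
      fix l assume l: "l \<in> A"
      then have "l \<le> L" using that by auto
      then have "w l < hi \<longleftrightarrow> l < y" "w l < lo \<longleftrightarrow> l < x"
        using le[of y l] le[of x l] that by auto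
      then show "(if w l < hi then (\<lambda>l\<in>A. D l z) l else 0) - (if w l < lo then (\<lambda>l\<in>A. D l z) l else 0) =
         (if l \<in> {x..<y} then D l z else 0)"
        using l \<open>x < y\<close> by auto
    qed
    also have "\<dots> = (\<Sum>l\<in>{x..<y}. D l z)"
      using that(6) by (simp only: sum.inter_restrict[OF fin, symmetric] Int_absorb1)
    also have "\<dots> = W hi z - W lo z"
      using sum_Suc_diff'[of x y "\<lambda>l. W (w l) z"] \<open>x < y\<close> that by (simp add: D_def)
    finally show ?thesis .
  qed
  have meas: "(\<lambda>x. H (\<lambda>i y. V A x y)) \<in> borel_measurable (\<Pi>\<^sub>M l\<in>A. borel)"
    if "elementary n B H" "finite A" for n B H A
    using that(1)
  proof (induction rule: elementary.induct)
    case elementary_zero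
    then show ?case by simp
  next
    case (elementary_add_monomial F lo hi c)
    have [measurable]: "(\<lambda>x. V A x y) \<in> borel_measurable (\<Pi>\<^sub>M l\<in>A. borel)" for y
      unfolding V_def by (intro borel_measurable_sum) auto
    show ?case
      unfolding box_monomial_def
      by (intro borel_measurable_add borel_measurable_times elementary_add_monomial(5)) auto
  qed
  have rep: "elementary_int W H z = H (\<lambda>i y. V A (\<lambda>l\<in>A. D l z) y)"
    if "elementary n B H" and B: "B \<subseteq> w ` {..L}"
      and A: "A \<subseteq> {..<L}" "\<And>x y. x \<le> L \<Longrightarrow> y \<le> L \<Longrightarrow> w x \<in> B \<Longrightarrow> w y \<in> B \<Longrightarrow> {x..<y} \<subseteq> A" for n B H A z
    using that(1)
  proof (induction rule: elementary.induct)
    case elementary_zero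
    then show ?case by (simp add: elementary_int_def)
  next
    case (elementary_add_monomial F lo hi c)
    have "W (hi i) z - W (lo i) z = V A (\<lambda>l\<in>A. D l z) (hi i) - V A (\<lambda>l\<in>A. D l z) (lo i)" if i: "i < n" for i
    proof -
      have "lo i \<in> B" "hi i \<in> B" "lo i < hi i"
        using elementary_add_monomial i by (auto simp: disjoint_sides_def)
      moreover from this have "lo i \<in> w ` {..L}" "hi i \<in> w ` {..L}" using B by blast+
      then obtain x y where "x \<le> L" "y \<le> L" "lo i = w x" "hi i = w y" by auto
      ultimately show ?thesis using Vdiff[of "lo i" "hi i" x y A z] A by simp
    qed
    then have "box_monomial n lo hi (\<lambda>i y. W y z) = box_monomial n lo hi (\<lambda>i y. V A (\<lambda>l\<in>A. D l z) y)"
      unfolding box_monomial_def by (intro prod.cong) auto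
    then show ?case using elementary_add_monomial(5) by (simp only: elementary_int_def)
  qed
  let ?A = "{p..<L}" and ?B = "{..<p}"
  have "elementary_int W F = (\<lambda>x. F (\<lambda>i y. V ?A x y)) \<circ> (\<lambda>z. \<lambda>l\<in>?A. D l z)"
  proof
    fix z
    have "elementary_int W F z = F (\<lambda>i y. V ?A (\<lambda>l\<in>?A. D l z) y)"
    proof (rule rep[OF P(3)])
      fix x y assume "x \<le> L" "y \<le> L" "w x \<in> P" "w y \<in> P"
      moreover have "p \<le> x" using le[of p x] calculation p P(2) by auto
      ultimately show "{x..<y} \<subseteq> ?A" by auto
    qed (use wi in auto)
    then show "elementary_int W F z = ((\<lambda>x. F (\<lambda>i y. V ?A x y)) \<circ> (\<lambda>z. \<lambda>l\<in>?A. D l z)) z" by simp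
  qed
  moreover have "elementary_int W G = (\<lambda>x. G (\<lambda>i y. V ?B x y)) \<circ> (\<lambda>z. \<lambda>l\<in>?B. D l z)"
  proof
    fix z
    have "elementary_int W G z = G (\<lambda>i y. V ?B (\<lambda>l\<in>?B. D l z) y)"
    proof (rule rep[OF Q(3)])
      fix x y assume "x \<le> L" "y \<le> L" "w x \<in> Q" "w y \<in> Q"
      moreover have "y \<le> p" using le[of y p] calculation p Q(2) by auto
      ultimately show "{x..<y} \<subseteq> ?B" by auto
    qed (use wi p in auto)
    then show "elementary_int W G z = ((\<lambda>x. G (\<lambda>i y. V ?B x y)) \<circ> (\<lambda>z. \<lambda>l\<in>?B. D l z)) z" by simp
  qed
  moreover have "indep_var borel ((\<lambda>x. F (\<lambda>i y. V ?A x y)) \<circ> (\<lambda>z. \<lambda>l\<in>?A. D l z))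
      borel ((\<lambda>x. G (\<lambda>i y. V ?B x y)) \<circ> (\<lambda>z. \<lambda>l\<in>?B. D l z))"
  proof (rule indep_var_compose[OF indep_var_restrict[where I="{..<L}"]])
    show "indep_vars (\<lambda>_. borel) D {..<L}"
      using indep_increments[OF w] by (simp add: D_def[abs_def])
  qed (use p meas[OF P(3), of ?A] meas[OF Q(3), of ?B] in auto)
  ultimately show ?thesis by simp
qed

text \<open>Independent normal variables add up to a normal one. \<open>sum_indep_normal\<close>
  asks for a nonempty sum and positive standard deviations, which is the reason for
  \<open>P > 0\<close> and for nonzero weights here and in the kernel approximation.\<close>

lemma distributed_weighted_increments:
  fixes w :: "nat \<Rightarrow> real"
  assumes w: "strict_mono_on {..P} w" and "P > 0" and \<alpha>: "\<And>l. l < P \<Longrightarrow> \<alpha> l \<noteq> 0"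
  shows "distributed M lborel (\<lambda>z. \<Sum>l<P. \<alpha> l * (W (w (Suc l)) z - W (w l) z))
     (normal_density 0 (sqrt (\<Sum>l<P. (\<alpha> l)\<^sup>2 * (w (Suc l) - w l))))"
proof -
  have less: "w l < w (Suc l)" if "l < P" for l using w that by (auto simp: strict_mono_on_def)
  have "distributed M lborel (\<lambda>z. \<Sum>l<P. \<alpha> l * (W (w (Suc l)) z - W (w l) z))
     (normal_density (\<Sum>l<P. 0) (sqrt (\<Sum>l<P. (\<bar>\<alpha> l\<bar> * sqrt (w (Suc l) - w l))\<^sup>2)))"
  proof (rule sum_indep_normal)
    show "indep_vars (\<lambda>i. borel) (\<lambda>l z. \<alpha> l * (W (w (Suc l)) z - W (w l) z)) {..<P}"
      by (rule indep_vars_compose2[OF indep_increments[OF w]]) auto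
    fix l assume "l \<in> {..<P}"
    then have l: "l < P" by simp
    show "0 < \<bar>\<alpha> l\<bar> * sqrt (w (Suc l) - w l)" using less[OF l] \<alpha>[OF l] by simp
    show "distributed M lborel (\<lambda>z. \<alpha> l * (W (w (Suc l)) z - W (w l) z))
        (normal_density 0 (\<bar>\<alpha> l\<bar> * sqrt (w (Suc l) - w l)))"
      using normal_density_affine[OF distributed_increment[OF less[OF l]], of "\<alpha> l" 0] less[OF l] \<alpha>[OF l] by simp
  qed (use \<open>P > 0\<close> in auto)
  moreover have "(\<Sum>l<P. (\<bar>\<alpha> l\<bar> * sqrt (w (Suc l) - w l))\<^sup>2) = (\<Sum>l<P. (\<alpha> l)\<^sup>2 * (w (Suc l) - w l))"
    using less by (intro sum.cong refl) (simp add: power_mult_distrib less_imp_le)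
  ultimately show ?thesis by simp
qed

end

section \<open>The kernel as the first exponent tends to \<open>-1/2\<close>\<close>

lemma pos_powr_nonneg [simp]: "0 \<le> pos_powr u c"
  by (simp add: pos_powr_def)

lemma measurable_pos_powr [measurable]: "(\<lambda>s. pos_powr (s - a) c) \<in> borel_measurable borel"
  unfolding pos_powr_def by measurable

lemma set_integrable_pos_powr:
  assumes "c > -1"
  shows "set_integrable lborel {0..t} (\<lambda>s. pos_powr (s - a) c)"
proof -
  define T where "T = max 0 (t - a)"
  have "(\<lambda>u. u powr c) integrable_on {0..T}"
    by (rule integrable_on_powr_from_0) (use assms in \<open>auto simp: T_def\<close>)
  then have "(\<lambda>u. u powr c) absolutely_integrable_on {0..T}"
    by (intro nonnegative_absolutely_integrable_1) auto
  then have "integrable lborel (\<lambda>u. indicator {0..T} u *\<^sub>R u powr c)"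
    unfolding set_integrable_def by (subst (asm) integrable_completion) auto
  then have "integrable lborel (\<lambda>s. indicator {0..T} (- a + 1 * s) *\<^sub>R (- a + 1 * s) powr c)"
    by (intro lborel_integrable_real_affine) auto
  then have "integrable lborel (\<lambda>s. indicator {0..T} (s - a) *\<^sub>R (s - a) powr c)"
    by (simp add: add.commute)
  then show ?thesis unfolding set_integrable_def
    by (rule Bochner_Integration.integrable_bound)
      (auto simp: T_def pos_powr_def indicator_def)
qed

text \<open>Near the largest coordinate only one factor is singular, so the kernel is finite off the
  diagonals.\<close>

lemma set_integrable_pos_powr_prod:
  fixes x :: "nat \<Rightarrow> real"
  assumes c: "\<And>c. c \<in> set \<gamma> \<Longrightarrow> -1 < c \<and> c < 0" and "\<gamma> \<noteq> []" and x: "inj_on x {..<length \<gamma>}"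
  shows "set_integrable lborel {0..t} (\<lambda>s. \<Prod>i<length \<gamma>. pos_powr (s - x i) (\<gamma> ! i))"
proof -
  let ?m = "length \<gamma>"
  have "Max (x ` {..<?m}) \<in> x ` {..<?m}" using \<open>\<gamma> \<noteq> []\<close> by (intro Max_in) auto
  then obtain p where p: "p < ?m" "x p = Max (x ` {..<?m})" by auto
  then have pmax: "x i < x p" if "i < ?m" "i \<noteq> p" for i
  proof -
    have "x i \<le> x p" using p(2) that(1) by simp
    moreover have "x i \<noteq> x p" using inj_onD[OF x, of i p] that p(1) by auto
    ultimately show ?thesis by simp
  qed
  \<comment> \<open>Where the product is nonzero, \<open>s\<close> exceeds \<open>x p\<close>. As
    the exponents are negative, every other factor is then at most its value at
    \<open>s = x p\<close>.\<close>
  define C where "C = (\<Prod>i\<in>{..<?m}-{p}. (x p - x i) powr (\<gamma> ! i))"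
  have "(\<Prod>i<?m. pos_powr (s - x i) (\<gamma> ! i)) \<le> C * pos_powr (s - x p) (\<gamma> ! p)" for s
  proof (cases "s > x p")
    case True
    have "(\<Prod>i\<in>{..<?m}-{p}. pos_powr (s - x i) (\<gamma> ! i)) \<le> C"
      unfolding C_def
    proof (intro prod_mono conjI)
      fix i assume "i \<in> {..<?m}-{p}"
      then have i: "i < ?m" "i \<noteq> p" by auto
      have "(s - x i) powr (\<gamma> ! i) \<le> (x p - x i) powr (\<gamma> ! i)"
        using pmax[OF i] True c[of "\<gamma> ! i"] i by (intro powr_mono2') auto
      then show "pos_powr (s - x i) (\<gamma> ! i) \<le> (x p - x i) powr (\<gamma> ! i)"
        using pmax[OF i] True by (simp add: pos_powr_def)
    qed simp
    from mult_right_mono[OF this, of "pos_powr (s - x p) (\<gamma> ! p)"] show ?thesis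
      using p(1) by (subst prod.remove[of _ p]) (auto simp: mult.commute)
  next
    case False
    have "(\<Prod>i<?m. pos_powr (s - x i) (\<gamma> ! i)) = 0"
      using p(1) False by (intro prod_zero) (auto simp: pos_powr_def)
    also have "0 \<le> C * pos_powr (s - x p) (\<gamma> ! p)" by (simp add: C_def prod_nonneg)
    finally show ?thesis .
  qed
  moreover have "set_integrable lborel {0..t} (\<lambda>s. C * pos_powr (s - x p) (\<gamma> ! p))"
    using c[of "\<gamma> ! p"] p(1) by (intro set_integrable_mult_right set_integrable_pos_powr) auto
  moreover have "0 \<le> (\<Prod>i<?m. pos_powr (s - x i) (\<gamma> ! i))" for s by (intro prod_nonneg) auto
  ultimately show ?thesis
    by (elim set_integrable_bound) (auto simp: set_borel_measurable_def intro!: AE_I2 order_trans[OF _ abs_ge_self])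
qed

lemma rosenblatt_kernel_scale: "rosenblatt_kernel A \<gamma> t x = A * rosenblatt_kernel 1 \<gamma> t x"
  by (simp add: rosenblatt_kernel_def)

lemma rosenblatt_kernel_nonneg: "0 \<le> rosenblatt_kernel 1 \<gamma> t x"
  unfolding rosenblatt_kernel_def set_lebesgue_integral_def
  by (simp add: Bochner_Integration.integral_nonneg prod_nonneg)

lemma rosenblatt_kernel_Cons:
  "rosenblatt_kernel 1 (g # \<gamma>) t x =
    (LBINT s:{0..t}. pos_powr (s - x 0) g * (\<Prod>i<length \<gamma>. pos_powr (s - x (Suc i)) (\<gamma> ! i)))"
  by (simp add: rosenblatt_kernel_def prod.lessThan_Suc_shift del: prod.lessThan_Suc)

text \<open>For \<open>s\<close> in \<open>{0..t}\<close> the distance \<open>s - x 0\<close> lies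
  between \<open>j\<close> and \<open>j + 1 + t\<close>. As \<open>g > -1\<close>, the ratio
  \<open>(1 + (1 + t) / j) powr g\<close> of the extreme values is at least
  \<open>1 / (1 + (1 + t) / j)\<close>, hence at least \<open>1 - (1 + t) / R\<close>. This relative
  error is uniform in the exponent and in all cells beyond \<open>R\<close>, so \<open>R\<close> can
  be fixed before the exponent.\<close>

lemma rosenblatt_kernel_far_bounds:
  assumes c: "\<And>c. c \<in> set \<gamma> \<Longrightarrow> -1 < c \<and> c < 0" and "\<gamma> \<noteq> []" and g: "-1 < g" "g < 0"
    and x: "inj_on x {..<Suc (length \<gamma>)}"
    and t: "0 \<le> t" and R: "1 \<le> R" "R \<le> j" and x0: "- x 0 \<ge> j" "- x 0 < j + 1"
  shows "rosenblatt_kernel 1 (g # \<gamma>) t x \<le> j powr g * rosenblatt_kernel 1 \<gamma> t (x \<circ> Suc)"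
    and "(1 - (1 + t) / R) * (j powr g * rosenblatt_kernel 1 \<gamma> t (x \<circ> Suc)) \<le> rosenblatt_kernel 1 (g # \<gamma>) t x"
proof -
  let ?P = "\<lambda>s. \<Prod>i<length \<gamma>. pos_powr (s - x (Suc i)) (\<gamma> ! i)"
  have "inj_on (x \<circ> Suc) {..<length \<gamma>}"
    using x by (auto simp: inj_on_def)
  from set_integrable_pos_powr_prod[OF c \<open>\<gamma> \<noteq> []\<close> this, where t=t]
  have int1: "set_integrable lborel {0..t} ?P" by simp
  have int2: "set_integrable lborel {0..t} (\<lambda>s. pos_powr (s - x 0) g * ?P s)"
    using set_integrable_pos_powr_prod[of "g # \<gamma>" x t] c g x
    by (auto simp: prod.lessThan_Suc_shift simp del: prod.lessThan_Suc)
  have Pnn: "0 \<le> ?P s" for s by (intro prod_nonneg) auto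
  have up: "pos_powr (s - x 0) g \<le> j powr g" if "s \<in> {0..t}" for s
    using that x0 R g by (auto simp: pos_powr_def intro!: powr_mono2')
  have lo: "(1 - (1 + t) / R) * j powr g \<le> pos_powr (s - x 0) g" if s: "s \<in> {0..t}" for s
  proof -
    have j: "j \<ge> 1" using R by simp
    have "1 - (1 + t) / R \<le> 1 - (1 + t) / j"
      using R t by (simp add: frac_le)
    also have "\<dots> \<le> 1 / (1 + (1 + t) / j)"
      using t j by (simp add: field_simps)
    also have "\<dots> = (1 + (1 + t) / j) powr (-1)"
      using t j by (simp add: powr_minus field_simps)
    also have "\<dots> \<le> (1 + (1 + t) / j) powr g"
      using t j g by (intro powr_mono) auto
    finally have "(1 - (1 + t) / R) * j powr g \<le> (1 + (1 + t) / j) powr g * j powr g"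
      by (intro mult_right_mono) auto
    also have "\<dots> = (j + (1 + t)) powr g"
    proof -
      have "(1 + (1 + t) / j) * j = j + (1 + t)" using j by (simp add: field_simps)
      then show ?thesis using t j powr_mult[of "1 + (1 + t) / j" j g] by simp
    qed
    also have "\<dots> \<le> (s - x 0) powr g"
      using s x0 j g by (intro powr_mono2') auto
    finally show ?thesis using s x0 j by (simp add: pos_powr_def)
  qed
  have K': "rosenblatt_kernel 1 \<gamma> t (x \<circ> Suc) = (LBINT s:{0..t}. ?P s)"
    by (simp add: rosenblatt_kernel_def)
  show "rosenblatt_kernel 1 (g # \<gamma>) t x \<le> j powr g * rosenblatt_kernel 1 \<gamma> t (x \<circ> Suc)"
    unfolding rosenblatt_kernel_Cons K' set_integral_mult_right[symmetric]
    using int1 int2 up Pnn by (intro set_integral_mono) (auto intro!: mult_right_mono)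
  have "(1 - (1 + t) / R) * (j powr g * rosenblatt_kernel 1 \<gamma> t (x \<circ> Suc)) =
     (LBINT s:{0..t}. ((1 - (1 + t) / R) * j powr g) * ?P s)"
    unfolding K' by (simp add: mult.assoc)
  also have "\<dots> \<le> rosenblatt_kernel 1 (g # \<gamma>) t x"
    unfolding rosenblatt_kernel_Cons
    using int1 int2 lo Pnn by (intro set_integral_mono) (auto intro!: mult_right_mono)
  finally show "(1 - (1 + t) / R) * (j powr g * rosenblatt_kernel 1 \<gamma> t (x \<circ> Suc)) \<le> rosenblatt_kernel 1 (g # \<gamma>) t x" .
qed

text \<open>On a half-line bounded below, the kernels with exponents in \<open>[g0, 0)\<close> are dominated by the one
  with exponent \<open>g0\<close>, so no explicit estimate of their norms is needed.\<close>

lemma rosenblatt_kernel_near_bound: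
  assumes c: "\<And>c. c \<in> set \<gamma> \<Longrightarrow> -1 < c \<and> c < 0" and g: "-1 < g0" "g0 \<le> g" "g < 0"
    and x: "inj_on x {..<Suc (length \<gamma>)}"
    and t: "0 \<le> t" and R: "1 \<le> R" and x0: "- x 0 < R"
  shows "rosenblatt_kernel 1 (g # \<gamma>) t x \<le> (t + R) * rosenblatt_kernel 1 (g0 # \<gamma>) t x"
proof -
  let ?P = "\<lambda>s. \<Prod>i<length \<gamma>. pos_powr (s - x (Suc i)) (\<gamma> ! i)"
  have int: "set_integrable lborel {0..t} (\<lambda>s. pos_powr (s - x 0) h * ?P s)" if "-1 < h" "h < 0" for h
    using set_integrable_pos_powr_prod[of "h # \<gamma>" x t] c that x
    by (auto simp: prod.lessThan_Suc_shift simp del: prod.lessThan_Suc)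
  have Pnn: "0 \<le> ?P s" for s by (intro prod_nonneg) auto
  have "pos_powr (s - x 0) g \<le> (t + R) * pos_powr (s - x 0) g0" if s: "s \<in> {0..t}" for s
  proof (cases "s > x 0")
    case True
    \<comment> \<open>Since \<open>0 \<le> g - g0 \<le> 1\<close> and \<open>1 \<le> t + R\<close>,
      the surplus power of a number below \<open>t + R\<close> is at most \<open>t + R\<close>
      itself.\<close>
    have "(s - x 0) powr g = (s - x 0) powr (g - g0) * (s - x 0) powr g0"
      by (simp add: powr_add[symmetric])
    also have "\<dots> \<le> (t + R) * (s - x 0) powr g0"
    proof (intro mult_right_mono)
      have "(s - x 0) powr (g - g0) \<le> (t + R) powr (g - g0)"
        using s x0 True g by (intro powr_mono2) auto
      also have "\<dots> \<le> (t + R) powr 1"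
        using t R g by (intro powr_mono) auto
      finally show "(s - x 0) powr (g - g0) \<le> t + R" using t R by simp
    qed auto
    finally show ?thesis using True by (simp add: pos_powr_def)
  qed (auto simp: pos_powr_def)
  then have "rosenblatt_kernel 1 (g # \<gamma>) t x \<le>
      (LBINT s:{0..t}. (t + R) * (pos_powr (s - x 0) g0 * ?P s))"
    unfolding rosenblatt_kernel_Cons
    using g mult_right_mono[OF _ Pnn]
    by (intro set_integral_mono set_integrable_mult_right int) (auto simp: mult.assoc[symmetric])
  then show ?thesis by (simp add: rosenblatt_kernel_Cons)
qed

section \<open>Approximation of the kernel on unit cells\<close>

definition unit_step :: "nat \<Rightarrow> nat \<Rightarrow> (nat \<Rightarrow> real) \<Rightarrow> real \<Rightarrow> real" where
  "unit_step R P \<alpha> y = (\<Sum>l<P. \<alpha> l * indicator {real l - real (R + P)<..real (Suc l) - real (R + P)} y)"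

lemma unit_step_cell:
  assumes "real l - real (R + P) < y" "y \<le> real (Suc l) - real (R + P)" "l < P"
  shows "unit_step R P \<alpha> y = \<alpha> l"
proof -
  have "unit_step R P \<alpha> y = (\<Sum>k<P. if k = l then \<alpha> k else 0)"
    unfolding unit_step_def
  proof (intro sum.cong refl)
    fix k
    have "k = l" if "real k - real (R + P) < y" "y \<le> real (Suc k) - real (R + P)"
      using that assms by auto
    then show "\<alpha> k * indicator {real k - real (R + P)<..real (Suc k) - real (R + P)} y = (if k = l then \<alpha> k else 0)"
      using assms by (auto simp: indicator_def)
  qed
  then show ?thesis using assms(3) by (simp add: sum.delta)
qed

lemma unit_step_outside:
  assumes "y \<le> - real (R + P) \<or> y > - real R"
  shows "unit_step R P \<alpha> y = 0"
  unfolding unit_step_def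
proof (intro sum.neutral ballI)
  fix l assume "l \<in> {..<P}"
  then have "real (Suc l) \<le> real P" by auto
  then have "real (Suc l) - real (R + P) \<le> - real R" by simp
  then show "\<alpha> l * indicator {real l - real (R + P)<..real (Suc l) - real (R + P)} y = 0"
    using assms by (auto simp: indicator_def)
qed

lemma measurable_unit_step [measurable]: "unit_step R P \<alpha> \<in> borel_measurable borel"
  unfolding unit_step_def[abs_def] by measurable

lemma unit_step_cases:
  obtains "y \<le> - real (R + P)" | "y > - real R"
    | l where "l < P" "real l - real (R + P) < y" "y \<le> real (Suc l) - real (R + P)"
proof -
  \<comment> \<open>The cells are closed on the right, so \<open>y\<close> belongs to the unit cell
    that ends at its ceiling, and cell \<open>l\<close> ends at
    \<open>real (Suc l) - real (R + P)\<close>.\<close>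
  define l where "l = nat (\<lceil>y\<rceil> + int (R + P) - 1)"
  show ?thesis
  proof (cases "y \<le> - real (R + P) \<or> y > - real R")
    case True
    then show ?thesis using that by blast
  next
    case False
    then have y: "y > - real (R + P)" "y \<le> - real R" by auto
    then have "\<lceil>y\<rceil> > - int (R + P)" by (simp add: less_ceiling_iff)
    then have l: "real l = real_of_int \<lceil>y\<rceil> + real (R + P) - 1" unfolding l_def by simp
    have "\<lceil>y\<rceil> \<le> - int R" using y by (simp add: ceiling_le_iff)
    then have "real l < real P" using l by linarith
    then have "l < P" by simp
    moreover have "real l - real (R + P) < y" "y \<le> real (Suc l) - real (R + P)"
      using l ceiling_correct[of y] by simp_all
    ultimately show ?thesis using that(3) by blast
  qed
qed

lemma nn_integral_unit_step_square:
  "(\<integral>\<^sup>+y. ennreal ((unit_step R P \<alpha> y)\<^sup>2) \<partial>lborel) = ennreal (\<Sum>l<P. (\<alpha> l)\<^sup>2)"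
proof -
  have cell: "(\<integral>\<^sup>+y. indicator {real l - real (R + P)<..real (Suc l) - real (R + P)} y \<partial>lborel) = 1" for l
    by (subst nn_integral_indicator) (auto simp: ennreal_1[symmetric] simp del: ennreal_1)
  have "(unit_step R P \<alpha> y)\<^sup>2 = (\<Sum>l<P. (\<alpha> l)\<^sup>2 * indicator {real l - real (R + P)<..real (Suc l) - real (R + P)} y)" for y
  proof (cases rule: unit_step_cases[of y R P])
    case (3 l)
    have "(\<Sum>l<P. (\<alpha> l)\<^sup>2 * indicator {real l - real (R + P)<..real (Suc l) - real (R + P)} y) = (\<alpha> l)\<^sup>2"
      using unit_step_cell[OF 3(2,3,1), of "\<lambda>l. (\<alpha> l)\<^sup>2"] by (simp add: unit_step_def)
    then show ?thesis using unit_step_cell[OF 3(2,3,1), of \<alpha>] by simp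
  next
    case 1
    then show ?thesis
      using unit_step_outside[of y R P \<alpha>] unit_step_outside[of y R P "\<lambda>l. (\<alpha> l)\<^sup>2"] by (simp add: unit_step_def)
  next
    case 2
    then show ?thesis
      using unit_step_outside[of y R P \<alpha>] unit_step_outside[of y R P "\<lambda>l. (\<alpha> l)\<^sup>2"] by (simp add: unit_step_def)
  qed
  then have "(\<integral>\<^sup>+y. ennreal ((unit_step R P \<alpha> y)\<^sup>2) \<partial>lborel) =
     (\<integral>\<^sup>+y. (\<Sum>l<P. ennreal ((\<alpha> l)\<^sup>2) * indicator {real l - real (R + P)<..real (Suc l) - real (R + P)} y) \<partial>lborel)"
    by (simp add: sum_ennreal[symmetric] ennreal_mult'' ennreal_indicator del: sum_ennreal)
  also have "\<dots> = (\<Sum>l<P. ennreal ((\<alpha> l)\<^sup>2) * (\<integral>\<^sup>+y. indicator {real l - real (R + P)<..real (Suc l) - real (R + P)} y \<partial>lborel))"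
    by (subst nn_integral_sum) (auto simp: nn_integral_cmult)
  also have "\<dots> = ennreal (\<Sum>l<P. (\<alpha> l)\<^sup>2)"
    unfolding cell by (simp add: sum_ennreal)
  finally show ?thesis .
qed

text \<open>At the exponent -1/2 the squared weights \<open>real (R + l) powr (2 * g)\<close> become
  harmonic terms. The divergence of their sum is what lets the far cells outweigh the rest of the
  kernel.\<close>

lemma harmonic_tail_unbounded:
  assumes "R \<ge> (1::nat)"
  obtains P where "P > 0" "(\<Sum>l<P. 1 / real (R + l)) > B"
proof -
  have "\<not> summable (\<lambda>n. inverse (real (n + R)))"
    using not_summable_harmonic[where 'a=real] summable_iff_shift[of "\<lambda>n. inverse (real n)" R] by blast
  then have "\<exists>P. (\<Sum>l<P. inverse (real (l + R))) > max 0 B"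
    using summableI_nonneg_bounded[of "\<lambda>n. inverse (real (n + R))" "max 0 B"]
    by (meson inverse_nonnegative_iff_nonnegative linorder_not_less of_nat_0_le_iff)
  then obtain P where "(\<Sum>l<P. inverse (real (l + R))) > max 0 B" by blast
  moreover from this have "P > 0" by (cases P) auto
  ultimately show ?thesis using that[of P] by (simp add: add.commute inverse_eq_divide)
qed

text \<open>For each \<open>x\<close> the indicator vanishes once \<open>R + P\<close> exceeds
  \<open>- x 0\<close>, and \<open>f\<close> squared is an integrable majorant. A finite norm thus
  replaces any estimate of the decay of the kernel.\<close>

lemma kernel_tail_tendsto_0:
  assumes [measurable]: "f \<in> borel_measurable (leb_pow (Suc m))"
    and fin: "(\<integral>\<^sup>+x. ennreal ((f x)\<^sup>2) \<partial>leb_pow (Suc m)) < \<infinity>"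
  shows "(\<lambda>P. \<integral>\<^sup>+x. ennreal ((f x)\<^sup>2) * indicator {..- real (R + P)} (x 0) \<partial>leb_pow (Suc m)) \<longlonglongrightarrow> 0"
proof -
  have "(\<lambda>P. \<integral>\<^sup>+x. ennreal ((f x)\<^sup>2) * indicator {..- real (R + P)} (x 0) \<partial>leb_pow (Suc m)) \<longlonglongrightarrow>
      (\<integral>\<^sup>+x. 0 \<partial>leb_pow (Suc m))"
  proof (rule nn_integral_dominated_convergence[where w="\<lambda>x. ennreal ((f x)\<^sup>2)"])
    show "AE x in leb_pow (Suc m). (\<lambda>P. ennreal ((f x)\<^sup>2) * indicator {..- real (R + P)} (x 0)) \<longlonglongrightarrow> 0"
    proof (rule AE_I2)
      fix x :: "nat \<Rightarrow> real"
      obtain N where N: "real N > - x 0" using reals_Archimedean2 by blast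
      have "eventually (\<lambda>P. ennreal ((f x)\<^sup>2) * indicator {..- real (R + P)} (x 0) = 0) sequentially"
        using eventually_ge_at_top[of N] by eventually_elim (use N in \<open>auto simp: indicator_def\<close>)
      then show "(\<lambda>P. ennreal ((f x)\<^sup>2) * indicator {..- real (R + P)} (x 0)) \<longlonglongrightarrow> 0"
        by (rule tendsto_eventually)
    qed
  qed (use fin in \<open>auto intro!: AE_I2 simp: indicator_def\<close>)
  then show ?thesis by simp
qed

text \<open>The error splits by the position of \<open>x 0\<close> into three regions, each allowed
  a third of \<open>\<epsilon>\<close>: to the right of \<open>- real R\<close>, where the step
  function is 0 and the scaling \<open>b\<close> makes the kernel small; the cells, where the
  relative error is small; and the tail beyond them. Accordingly \<open>R\<close> is fixed by the
  relative error, then a weight \<open>B\<close> that beats the near region, then an index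
  \<open>n\<close> whose exponent reaches this weight, and last \<open>P\<close> by the tail of this
  single kernel.\<close>

lemma kernel_approximation:
  fixes g :: "nat \<Rightarrow> real" and t :: real
  assumes c: "\<And>c. c \<in> set \<gamma> \<Longrightarrow> -1 < c \<and> c < 0" and \<gamma>: "\<gamma> \<noteq> []"
    and g: "\<And>n. -1 < g n" "\<And>n. g n < - 1/2" "g \<longlonglongrightarrow> - 1/2" and t: "0 \<le> t"
    and mk: "\<And>n. rosenblatt_kernel 1 (g n # \<gamma>) t \<in> borel_measurable (leb_pow (Suc (length \<gamma>)))"
    and fk: "\<And>n. (\<integral>\<^sup>+x. ennreal ((rosenblatt_kernel 1 (g n # \<gamma>) t x)\<^sup>2) \<partial>leb_pow (Suc (length \<gamma>))) < \<infinity>"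
    and mk': "rosenblatt_kernel 1 \<gamma> t \<in> borel_measurable (leb_pow (length \<gamma>))"
    and fk': "(\<integral>\<^sup>+x. ennreal ((rosenblatt_kernel 1 \<gamma> t x)\<^sup>2) \<partial>leb_pow (length \<gamma>)) < \<infinity>"
    and \<epsilon>: "\<epsilon> > 0"
  obtains n R P b \<alpha> where "n \<ge> n1" "R \<ge> R1" "P > 0" "b > 0" "\<forall>l. \<alpha> l \<noteq> 0" "(\<Sum>l<P. (\<alpha> l)\<^sup>2) = (1::real)"
    "(\<integral>\<^sup>+x. ennreal ((b * rosenblatt_kernel 1 (g n # \<gamma>) t x -
        unit_step R P \<alpha> (x 0) * rosenblatt_kernel 1 \<gamma> t (x \<circ> Suc))\<^sup>2) \<partial>leb_pow (Suc (length \<gamma>))) \<le> ennreal \<epsilon>"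
proof -
  define m where "m = length \<gamma>"
  define K where "K n = rosenblatt_kernel 1 (g n # \<gamma>) t" for n
  define K' where "K' = rosenblatt_kernel 1 \<gamma> t"
  note [measurable] = mk[folded K_def m_def] mk'[folded K'_def m_def]
  have Knn: "0 \<le> K n x" "0 \<le> K' y" for n x y by (auto simp: K_def K'_def rosenblatt_kernel_nonneg)
  obtain C0 where C0: "C0 \<ge> 0" "(\<integral>\<^sup>+x. ennreal ((K 0 x)\<^sup>2) \<partial>leb_pow (Suc m)) = ennreal C0"
    using fk[of 0, folded K_def m_def] by (cases rule: ennreal_cases) (auto simp: infinity_ennreal_def)
  obtain C1 where C1: "C1 \<ge> 0" "(\<integral>\<^sup>+x. ennreal ((K' x)\<^sup>2) \<partial>leb_pow m) = ennreal C1"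
    using fk'[folded K'_def m_def] by (cases rule: ennreal_cases) (auto simp: infinity_ennreal_def)
  have "((\<lambda>R. ((1 + t) / real R)\<^sup>2 * C1) \<longlonglongrightarrow> ((0::real))\<^sup>2 * C1)"
    by (intro tendsto_intros lim_const_over_n)
  then have "eventually (\<lambda>R. ((1 + t) / real R)\<^sup>2 * C1 < \<epsilon> / 3) sequentially"
    using \<epsilon> by (intro order_tendstoD) auto
  from eventually_conj[OF this eventually_ge_at_top[of "max 1 R1"]]
  obtain R where R: "((1 + t) / real R)\<^sup>2 * C1 < \<epsilon> / 3" "R \<ge> 1" "R \<ge> R1"
    by (auto dest: eventually_happens'[rotated])
  \<comment> \<open>The squared norm of the near part is at most
    \<open>(t + real R)\<^sup>2 * C0\<close> before scaling, and dividing by \<open>B\<close> brings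
    it below a third of \<open>\<epsilon>\<close>. The maximum with 1 ensures
    \<open>b\<^sup>2 \<le> 1\<close>, so that scaling does not enlarge the tail.\<close>
  define B where "B = max 1 (3 * (t + real R)\<^sup>2 * C0 / \<epsilon>)"
  have B: "B \<ge> 1" "(t + real R)\<^sup>2 * C0 \<le> \<epsilon> / 3 * B"
    using \<epsilon> by (auto simp: B_def field_simps max_def)
  obtain P0 where P0: "P0 > 0" "(\<Sum>l<P0. 1 / real (R + l)) > B"
    using harmonic_tail_unbounded[OF R(2)] by blast
  \<comment> \<open>A sum of fixed length is continuous in the exponent, so it still exceeds
    \<open>B\<close> for exponents close enough to -1/2.\<close>
  have "(\<lambda>n. \<Sum>l<P0. real (R + l) powr (2 * g n)) \<longlonglongrightarrow> (\<Sum>l<P0. real (R + l) powr (2 * (- 1/2)))"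
    using R(2) g(3) by (intro tendsto_intros) auto
  also have "(\<Sum>l<P0. real (R + l) powr (2 * (- 1/2))) = (\<Sum>l<P0. 1 / real (R + l))"
    using R(2) by (intro sum.cong) (auto simp: powr_minus_divide)
  finally have "eventually (\<lambda>n. (\<Sum>l<P0. real (R + l) powr (2 * g n)) > B) sequentially"
    using P0(2) by (rule order_tendstoD)
  \<comment> \<open>With this the kernel with exponent \<open>g 0\<close> serves as the fixed
    dominating kernel in the near region.\<close>
  moreover have "eventually (\<lambda>n. g n > g 0) sequentially"
    using g(2)[of 0] g(3) by (intro order_tendstoD) auto
  ultimately obtain n where n: "n \<ge> n1" "(\<Sum>l<P0. real (R + l) powr (2 * g n)) > B" "g n > g 0"
    using eventually_happens'[OF sequentially_bot eventually_conj[OF eventually_conj eventually_ge_at_top[of n1]]]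
    by (metis (no_types, lifting))
  have "(\<lambda>P. \<integral>\<^sup>+x. ennreal ((K n x)\<^sup>2) * indicator {..- real (R + P)} (x 0) \<partial>leb_pow (Suc m)) \<longlonglongrightarrow> 0"
    using fk[of n, folded K_def m_def] by (intro kernel_tail_tendsto_0) auto
  then have "eventually (\<lambda>P. (\<integral>\<^sup>+x. ennreal ((K n x)\<^sup>2) * indicator {..- real (R + P)} (x 0) \<partial>leb_pow (Suc m)) < ennreal (\<epsilon> / 3)) sequentially"
    using \<epsilon> by (intro order_tendstoD(2)) auto
  from eventually_conj[OF this eventually_ge_at_top[of P0]]
  obtain P where P: "(\<integral>\<^sup>+x. ennreal ((K n x)\<^sup>2) * indicator {..- real (R + P)} (x 0) \<partial>leb_pow (Suc m)) < ennreal (\<epsilon> / 3)"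
    "P \<ge> P0" by (auto dest: eventually_happens'[rotated])
  define T where "T = (\<Sum>l<P. real (R + l) powr (2 * g n))"
  have "(\<Sum>l<P0. real (R + l) powr (2 * g n)) \<le> T"
    unfolding T_def using P(2) by (intro sum_mono2) auto
  then have T: "T \<ge> B" "T > 0" using n(2) B(1) by auto
  define b where "b = 1 / sqrt T"
  have b: "b > 0" "b\<^sup>2 = 1 / T" "b\<^sup>2 * B \<le> 1" "b\<^sup>2 \<le> 1"
    using T B(1) by (auto simp: b_def power_divide)
  \<comment> \<open>Cells are counted from the left, towards the origin, hence the reversed index:
    \<open>real (R + (P - Suc l))\<close> is the distance from 0 to the right end of cell
    \<open>l\<close>.\<close>
  define \<alpha> where "\<alpha> l = b * real (R + (P - Suc l)) powr g n" for l
  have \<alpha>0: "\<alpha> l \<noteq> 0" for l using b(1) R(2) by (simp add: \<alpha>_def)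
  have "(\<Sum>l<P. (\<alpha> l)\<^sup>2) = b\<^sup>2 * (\<Sum>l<P. real (R + (P - Suc l)) powr (2 * g n))"
  proof -
    have "(y powr g n)\<^sup>2 = y powr (2 * g n)" for y :: real
      by (simp add: power2_eq_square powr_add[symmetric])
    then show ?thesis by (simp add: \<alpha>_def sum_distrib_left power_mult_distrib)
  qed
  also have "(\<Sum>l<P. real (R + (P - Suc l)) powr (2 * g n)) = T"
    unfolding T_def by (rule sum.nat_diff_reindex[of "\<lambda>l. real (R + l) powr (2 * g n)"])
  finally have \<alpha>1: "(\<Sum>l<P. (\<alpha> l)\<^sup>2) = 1" using b(2) T by simp
  define h where "h = unit_step R P \<alpha>"
  have [measurable]: "h \<in> borel_measurable borel" by (simp add: h_def)
  define \<delta> where "\<delta> = (1 + t) / real R"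
  have \<delta>: "\<delta> \<ge> 0" "\<delta>\<^sup>2 * C1 < \<epsilon> / 3" using t R by (auto simp: \<delta>_def)
  have bound: "(b * K n x - h (x 0) * K' (x \<circ> Suc))\<^sup>2 \<le>
      (b * (t + R))\<^sup>2 * (K 0 x)\<^sup>2 + (\<delta>\<^sup>2 * (h (x 0))\<^sup>2 * (K' (x \<circ> Suc))\<^sup>2 +
      b\<^sup>2 * ((K n x)\<^sup>2 * indicator {..- real (R + P)} (x 0)))" (is "_ \<le> ?r1 + (?r2 + ?r3)")
    if x: "inj_on x {..<Suc m}" for x
  proof -
    have nn: "?r1 \<ge> 0" "?r2 \<ge> 0" "?r3 \<ge> 0" by auto
    show ?thesis
    proof (cases rule: unit_step_cases[of "x 0" R P])
      case 1
      then have "h (x 0) = 0" unfolding h_def by (intro unit_step_outside) auto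
      then have "(b * K n x - h (x 0) * K' (x \<circ> Suc))\<^sup>2 = ?r3"
        using 1 by (simp add: power_mult_distrib)
      then show ?thesis using nn by linarith
    next
      case 2
      then have "h (x 0) = 0" unfolding h_def by (intro unit_step_outside) auto
      moreover have "K n x \<le> (t + R) * K 0 x"
        unfolding K_def using c g(1)[of 0] g(2)[of n] n(3) x t R(2) 2
        by (intro rosenblatt_kernel_near_bound) (auto simp: m_def)
      then have "(b * K n x)\<^sup>2 \<le> (b * ((t + R) * K 0 x))\<^sup>2"
        using b(1) Knn by (intro power_mono mult_left_mono) auto
      ultimately have "(b * K n x - h (x 0) * K' (x \<circ> Suc))\<^sup>2 \<le> ?r1"
        by (simp add: power_mult_distrib mult.assoc)
      then show ?thesis using nn by linarith
    next
      case (3 l)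
      define j where "j = real (R + (P - Suc l))"
      have j: "j = real R + real P - real l - 1" using 3(1) by (simp add: j_def of_nat_diff)
      have hx: "h (x 0) = b * j powr g n"
        unfolding h_def using unit_step_cell[OF 3(2,3,1), of \<alpha>] by (simp add: \<alpha>_def j_def)
      have bds: "K n x \<le> j powr g n * K' (x \<circ> Suc)" "(1 - \<delta>) * (j powr g n * K' (x \<circ> Suc)) \<le> K n x"
        unfolding K_def K'_def \<delta>_def using c \<gamma> g(1)[of n] g(2)[of n] x t R(2) 3 j
        by (intro rosenblatt_kernel_far_bounds; auto simp: m_def)+
      have "\<bar>K n x - j powr g n * K' (x \<circ> Suc)\<bar> \<le> \<delta> * (j powr g n * K' (x \<circ> Suc))"
        using bds by (simp add: algebra_simps abs_le_iff) (use \<delta>(1) Knn in \<open>auto intro!: mult_nonneg_nonneg\<close>)?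
      then have "b * \<bar>K n x - j powr g n * K' (x \<circ> Suc)\<bar> \<le> b * (\<delta> * (j powr g n * K' (x \<circ> Suc)))"
        using b(1) by (intro mult_left_mono) auto
      then have "(b * \<bar>K n x - j powr g n * K' (x \<circ> Suc)\<bar>)\<^sup>2 \<le> (b * (\<delta> * (j powr g n * K' (x \<circ> Suc))))\<^sup>2"
        using b(1) by (intro power_mono) auto
      then have "(b * K n x - h (x 0) * K' (x \<circ> Suc))\<^sup>2 \<le> ?r2"
        unfolding hx by (simp add: power_mult_distrib mult_ac flip: right_diff_distrib)
      then show ?thesis using nn by linarith
    qed
  qed
  have "(\<integral>\<^sup>+x. ennreal ((b * K n x - h (x 0) * K' (x \<circ> Suc))\<^sup>2) \<partial>leb_pow (Suc m)) \<le>
     (\<integral>\<^sup>+x. ennreal ((b * (t + R))\<^sup>2) * ennreal ((K 0 x)\<^sup>2) +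
        (ennreal (\<delta>\<^sup>2) * (ennreal ((h (x 0))\<^sup>2) * ennreal ((K' (x \<circ> Suc))\<^sup>2)) +
         ennreal (b\<^sup>2) * (ennreal ((K n x)\<^sup>2) * indicator {..- real (R + P)} (x 0))) \<partial>leb_pow (Suc m))"
  proof (rule nn_integral_mono_AE)
    show "AE x in leb_pow (Suc m). ennreal ((b * K n x - h (x 0) * K' (x \<circ> Suc))\<^sup>2) \<le>
      ennreal ((b * (t + R))\<^sup>2) * ennreal ((K 0 x)\<^sup>2) +
        (ennreal (\<delta>\<^sup>2) * (ennreal ((h (x 0))\<^sup>2) * ennreal ((K' (x \<circ> Suc))\<^sup>2)) +
         ennreal (b\<^sup>2) * (ennreal ((K n x)\<^sup>2) * indicator {..- real (R + P)} (x 0)))"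
      using AE_inj_on_coordinates[of "Suc m"]
    proof eventually_elim
      case (elim x)
      from ennreal_leI[OF bound[OF elim]] show ?case
        by (simp add: ennreal_mult' ennreal_indicator mult.assoc)
    qed
  qed
  also have "\<dots> = ennreal ((b * (t + R))\<^sup>2) * (\<integral>\<^sup>+x. ennreal ((K 0 x)\<^sup>2) \<partial>leb_pow (Suc m)) +
      (ennreal (\<delta>\<^sup>2) * ((\<integral>\<^sup>+y. ennreal ((h y)\<^sup>2) \<partial>lborel) * (\<integral>\<^sup>+x. ennreal ((K' x)\<^sup>2) \<partial>leb_pow m)) +
       ennreal (b\<^sup>2) * (\<integral>\<^sup>+x. ennreal ((K n x)\<^sup>2) * indicator {..- real (R + P)} (x 0) \<partial>leb_pow (Suc m)))"
  proof -
    have eq: "(\<integral>\<^sup>+x. ennreal ((h (x 0))\<^sup>2) * ennreal ((K' (x \<circ> Suc))\<^sup>2) \<partial>leb_pow (Suc m)) =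
      (\<integral>\<^sup>+y. ennreal ((h y)\<^sup>2) \<partial>lborel) * (\<integral>\<^sup>+x. ennreal ((K' x)\<^sup>2) \<partial>leb_pow m)"
      by (rule nn_integral_head_tail) auto
    have [measurable]: "(\<lambda>x. K' (x \<circ> Suc)) \<in> borel_measurable (leb_pow (Suc m))"
      by (rule measurable_compose[OF measurable_tail_coordinates]) auto
    show ?thesis
      unfolding eq[symmetric] by (simp add: nn_integral_add nn_integral_cmult)
  qed
  also have "\<dots> \<le> ennreal (\<epsilon> / 3) + (ennreal (\<epsilon> / 3) + ennreal (\<epsilon> / 3))"
  proof (intro add_mono)
    have "(b * (t + R))\<^sup>2 * C0 = b\<^sup>2 * ((t + R)\<^sup>2 * C0)" by (simp add: power_mult_distrib)
    also have "\<dots> \<le> b\<^sup>2 * (\<epsilon> / 3 * B)" using B(2) by (intro mult_left_mono) auto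
    also have "\<dots> = (b\<^sup>2 * B) * (\<epsilon> / 3)" by simp
    also have "\<dots> \<le> 1 * (\<epsilon> / 3)" using b(3) \<epsilon> by (intro mult_right_mono) auto
    finally show "ennreal ((b * (t + R))\<^sup>2) * (\<integral>\<^sup>+x. ennreal ((K 0 x)\<^sup>2) \<partial>leb_pow (Suc m)) \<le> ennreal (\<epsilon> / 3)"
      unfolding C0(2) using C0(1) by (simp add: ennreal_mult'[symmetric] ennreal_leI)
    show "ennreal (\<delta>\<^sup>2) * ((\<integral>\<^sup>+y. ennreal ((h y)\<^sup>2) \<partial>lborel) * (\<integral>\<^sup>+x. ennreal ((K' x)\<^sup>2) \<partial>leb_pow m)) \<le> ennreal (\<epsilon> / 3)"
      unfolding C1(2) h_def nn_integral_unit_step_square \<alpha>1 using \<delta>(2) C1(1)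
      by (simp add: ennreal_mult'[symmetric] ennreal_leI)
    have "ennreal (b\<^sup>2) * (\<integral>\<^sup>+x. ennreal ((K n x)\<^sup>2) * indicator {..- real (R + P)} (x 0) \<partial>leb_pow (Suc m)) \<le> 1 * ennreal (\<epsilon> / 3)"
      using b(4) P(1) by (intro mult_mono) auto
    then show "ennreal (b\<^sup>2) * (\<integral>\<^sup>+x. ennreal ((K n x)\<^sup>2) * indicator {..- real (R + P)} (x 0) \<partial>leb_pow (Suc m)) \<le> ennreal (\<epsilon> / 3)"
      by simp
  qed
  also have "\<dots> = ennreal \<epsilon>" using \<epsilon> by (simp flip: ennreal_plus)
  finally have "(\<integral>\<^sup>+x. ennreal ((b * K n x - h (x 0) * K' (x \<circ> Suc))\<^sup>2) \<partial>leb_pow (Suc m)) \<le> ennreal \<epsilon>" .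
  moreover have "P > 0" using P0 P by simp
  ultimately show ?thesis
    using that[of n R P b \<alpha>] n(1) R(3) b(1) \<alpha>0 \<alpha>1 unfolding K_def K'_def h_def m_def by blast
qed

section \<open>Mixing and stable convergence\<close>

lemma norm_iexp_diff_le: "cmod (iexp x - iexp y) \<le> \<bar>x - y\<bar>"
proof -
  have "iexp x - iexp y = iexp y * (iexp (x - y) - 1)"
    by (simp add: right_diff_distrib mult_exp_exp algebra_simps)
  then show ?thesis using iexp_approx1[of "x - y" 0] by (simp add: norm_mult)
qed

lemma integral_std_normal_iexp:
  "(LINT x|std_normal_distribution. iexp (l * x)) = of_real (exp (- (l\<^sup>2) / 2))"
  using fun_cong[OF char_std_normal_distribution, of l] by (simp add: char_def)

lemma (in prob_space) integrable_bounded: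
  fixes f :: "'a \<Rightarrow> 'b::{banach, second_countable_topology}"
  assumes "f \<in> borel_measurable M" "\<And>z. z \<in> space M \<Longrightarrow> norm (f z) \<le> C"
  shows "integrable M f"
  using assms by (intro integrable_const_bound[of f C]) (auto intro!: AE_I2)

lemma integral_Cauchy_Schwarz:
  fixes f g :: "'a \<Rightarrow> real"
  assumes [measurable]: "f \<in> borel_measurable M" "g \<in> borel_measurable M"
    and f2: "integrable M (\<lambda>x. (f x)\<^sup>2)" and g2: "integrable M (\<lambda>x. (g x)\<^sup>2)"
  shows "integrable M (\<lambda>x. f x * g x)"
    and "(LINT x|M. \<bar>f x * g x\<bar>)\<^sup>2 \<le> (LINT x|M. (f x)\<^sup>2) * (LINT x|M. (g x)\<^sup>2)"
proof -
  have "\<bar>f x * g x\<bar> \<le> (f x)\<^sup>2 + (g x)\<^sup>2" for x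
  proof -
    have "2 * (\<bar>f x\<bar> * \<bar>g x\<bar>) \<le> (f x)\<^sup>2 + (g x)\<^sup>2"
      using sum_squares_bound[of "\<bar>f x\<bar>" "\<bar>g x\<bar>"] by (simp add: mult.assoc)
    moreover have "0 \<le> \<bar>f x\<bar> * \<bar>g x\<bar>" by simp
    ultimately show ?thesis unfolding abs_mult by linarith
  qed
  then show int: "integrable M (\<lambda>x. f x * g x)"
    using f2 g2 by (intro Bochner_Integration.integrable_bound[OF Bochner_Integration.integrable_add[OF f2 g2]])
      (auto intro!: AE_I2 order_trans[OF _ abs_ge_self])
  have "(\<integral>\<^sup>+x. ennreal \<bar>f x\<bar> * ennreal \<bar>g x\<bar> \<partial>M)\<^sup>2 \<le> (\<integral>\<^sup>+x. (ennreal \<bar>f x\<bar>)\<^sup>2 \<partial>M) * (\<integral>\<^sup>+x. (ennreal \<bar>g x\<bar>)\<^sup>2 \<partial>M)"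
    by (intro Cauchy_Schwarz_nn_integral) auto
  moreover have "(\<integral>\<^sup>+x. ennreal \<bar>f x\<bar> * ennreal \<bar>g x\<bar> \<partial>M) = ennreal (LINT x|M. \<bar>f x * g x\<bar>)"
    using integrable_abs[OF int]
    by (subst nn_integral_eq_integral[symmetric]) (auto simp: abs_mult ennreal_mult)
  moreover have "(\<integral>\<^sup>+x. (ennreal \<bar>f x\<bar>)\<^sup>2 \<partial>M) = ennreal (LINT x|M. (f x)\<^sup>2)"
    using f2 by (subst nn_integral_eq_integral[symmetric]) (auto simp: ennreal_power)
  moreover have "(\<integral>\<^sup>+x. (ennreal \<bar>g x\<bar>)\<^sup>2 \<partial>M) = ennreal (LINT x|M. (g x)\<^sup>2)"
    using g2 by (subst nn_integral_eq_integral[symmetric]) (auto simp: ennreal_power)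
  ultimately show "(LINT x|M. \<bar>f x * g x\<bar>)\<^sup>2 \<le> (LINT x|M. (f x)\<^sup>2) * (LINT x|M. (g x)\<^sup>2)"
    by (simp add: ennreal_power ennreal_mult[symmetric])
qed

context prob_space
begin

text \<open>By Bessel's inequality the coefficients of \<open>U\<close> are square summable.\<close>

lemma bounded_orthogonal_tendsto_0:
  fixes \<xi> :: "nat \<Rightarrow> 'a \<Rightarrow> real"
  assumes [measurable]: "\<And>k. \<xi> k \<in> borel_measurable M" "U \<in> borel_measurable M"
    and C: "\<And>k z. z \<in> space M \<Longrightarrow> \<bar>\<xi> k z\<bar> \<le> C" and D: "\<And>z. z \<in> space M \<Longrightarrow> \<bar>U z\<bar> \<le> D"
    and orth: "\<And>i j. i < j \<Longrightarrow> expectation (\<lambda>z. \<xi> i z * \<xi> j z) = 0"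
  shows "(\<lambda>k. expectation (\<lambda>z. U z * \<xi> k z)) \<longlonglongrightarrow> 0"
proof -
  define e where "e k = expectation (\<lambda>z. U z * \<xi> k z)" for k
  \<comment> \<open>A common bound for the second moments of the \<open>\<xi> k\<close>; adding 1
    keeps it positive for the division below.\<close>
  define B where "B = C\<^sup>2 + 1"
  have B: "B > 0" by (simp add: B_def add_nonneg_pos)
  have int: "integrable M (\<lambda>z. U z * \<xi> k z)" "integrable M (\<lambda>z. \<xi> k z * \<xi> j z)" "integrable M (\<lambda>z. (U z)\<^sup>2)" for k j
  proof -
    obtain z0 where "z0 \<in> space M" using not_empty by blast
    then have nn: "0 \<le> C" "0 \<le> D"
      using order_trans[OF abs_ge_zero C] order_trans[OF abs_ge_zero D] by blast+
    have "norm (U z * \<xi> k z) \<le> D * C" "norm (\<xi> k z * \<xi> j z) \<le> C * C" "norm ((U z)\<^sup>2) \<le> D * D"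
      if "z \<in> space M" for z
      unfolding power2_eq_square real_norm_def abs_mult using nn that by (intro mult_mono C D; simp)+
    then show "integrable M (\<lambda>z. U z * \<xi> k z)" "integrable M (\<lambda>z. \<xi> k z * \<xi> j z)" "integrable M (\<lambda>z. (U z)\<^sup>2)"
      by (auto intro!: integrable_bounded)
  qed
  have sq: "expectation (\<lambda>z. (\<xi> k z)\<^sup>2) \<le> B" for k
  proof -
    have "expectation (\<lambda>z. \<xi> k z * \<xi> k z) \<le> expectation (\<lambda>z. B)"
    proof (intro integral_mono)
      fix z assume "z \<in> space M"
      then have "\<bar>\<xi> k z\<bar>\<^sup>2 \<le> C\<^sup>2" by (intro power_mono C) auto
      then show "\<xi> k z * \<xi> k z \<le> B" by (simp add: B_def power2_eq_square)
    qed (auto intro: int)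
    then show ?thesis by (simp add: power2_eq_square prob_space)
  qed
  have "(\<Sum>k<n. (e k)\<^sup>2) \<le> B * expectation (\<lambda>z. (U z)\<^sup>2)" for n
  proof -
    \<comment> \<open>The norms of the \<open>\<xi> k\<close> are only known to be bounded, so the
      projection coefficients are replaced by \<open>e k / B\<close>. Expanding the nonnegative
      square of the residual of \<open>U\<close> then still bounds the sum of the squares of the
      \<open>e k\<close>.\<close>
    define b where "b k = e k / B" for k
    have orth': "expectation (\<lambda>z. \<xi> i z * \<xi> j z) = (if i = j then expectation (\<lambda>z. (\<xi> i z)\<^sup>2) else 0)" for i j
      using orth[of i j] orth[of j i] by (cases i j rule: linorder_cases) (auto simp: mult.commute power2_eq_square)
    define Q where "Q z = (\<Sum>k<n. b k * (U z * \<xi> k z))" for z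
    define R where "R z = (\<Sum>i<n. \<Sum>j<n. (b i * b j) * (\<xi> i z * \<xi> j z))" for z
    have intQR: "integrable M Q" "integrable M R"
      unfolding Q_def R_def
      by (intro Bochner_Integration.integrable_sum integrable_mult_right int)+
    have Q: "expectation Q = (\<Sum>k<n. b k * e k)"
      unfolding Q_def e_def by (subst Bochner_Integration.integral_sum) (auto intro: int)
    have "expectation R = (\<Sum>i<n. \<Sum>j<n. (b i * b j) * expectation (\<lambda>z. \<xi> i z * \<xi> j z))"
      unfolding R_def
      using int by (simp add: Bochner_Integration.integral_sum)
    also have "\<dots> = (\<Sum>i<n. \<Sum>j<n. if i = j then (b i)\<^sup>2 * expectation (\<lambda>z. (\<xi> i z)\<^sup>2) else 0)"
      by (intro sum.cong refl, subst orth') (simp add: power2_eq_square[of "b _"])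
    also have "\<dots> = (\<Sum>i<n. (b i)\<^sup>2 * expectation (\<lambda>z. (\<xi> i z)\<^sup>2))"
      by (simp add: sum.delta)
    also have "\<dots> \<le> (\<Sum>i<n. (b i)\<^sup>2 * B)"
      by (intro sum_mono mult_left_mono sq) auto
    also have "\<dots> = (\<Sum>k<n. b k * e k)"
      using B by (intro sum.cong) (auto simp: b_def power2_eq_square)
    finally have R: "expectation R \<le> (\<Sum>k<n. b k * e k)" .
    have "(U z - (\<Sum>k<n. b k * \<xi> k z))\<^sup>2 = (U z)\<^sup>2 - 2 * Q z + R z" for z
    proof -
      have "U z * (\<Sum>k<n. b k * \<xi> k z) = Q z" unfolding Q_def sum_distrib_left by (simp add: mult_ac)
      moreover have "(\<Sum>k<n. b k * \<xi> k z) * (\<Sum>k<n. b k * \<xi> k z) = R z"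
        unfolding R_def sum_product by (simp add: mult_ac)
      moreover have "(U z - s)\<^sup>2 = (U z)\<^sup>2 - 2 * (U z * s) + s * s" for s
        by (simp add: power2_eq_square algebra_simps)
      ultimately show ?thesis by simp
    qed
    then have "0 \<le> (U z)\<^sup>2 - 2 * Q z + R z" for z
      by (metis zero_le_power2)
    then have "0 \<le> expectation (\<lambda>z. (U z)\<^sup>2 - 2 * Q z + R z)"
      by (intro Bochner_Integration.integral_nonneg) auto
    also have "\<dots> = expectation (\<lambda>z. (U z)\<^sup>2) - 2 * expectation Q + expectation R"
      using intQR int(3) by simp
    finally have "(\<Sum>k<n. b k * e k) \<le> expectation (\<lambda>z. (U z)\<^sup>2)" using Q R by simp
    also have "(\<Sum>k<n. b k * e k) = (\<Sum>k<n. (e k)\<^sup>2) / B"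
      by (simp add: b_def sum_divide_distrib power2_eq_square)
    finally show ?thesis using B by (simp add: field_simps)
  qed
  then have "summable (\<lambda>k. (e k)\<^sup>2)" by (intro summableI_nonneg_bounded) auto
  then have "(\<lambda>k. (e k)\<^sup>2) \<longlonglongrightarrow> 0" by (rule summable_LIMSEQ_zero)
  then have "(\<lambda>k. sqrt ((e k)\<^sup>2)) \<longlonglongrightarrow> sqrt 0" by (rule tendsto_real_sqrt)
  then have "(\<lambda>k. \<bar>e k\<bar>) \<longlonglongrightarrow> 0" by simp
  then show ?thesis unfolding e_def by (rule tendsto_rabs_zero_cancel)
qed

text \<open>Centring makes the bounded variables \<open>f (\<eta> k z) - \<mu>\<close> orthogonal,
  and pairwise independence is all that this takes. Nothing is assumed about the joint law of
  \<open>U\<close> and the \<open>\<eta> k\<close>.\<close>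

lemma independent_copies_mixing:
  fixes \<eta> :: "nat \<Rightarrow> 'a \<Rightarrow> real" and f :: "real \<Rightarrow> real"
  assumes \<eta>: "\<And>k. distributed M lborel (\<eta> k) std_normal_density"
    and ind: "\<And>i j. i < j \<Longrightarrow> indep_var borel (\<eta> i) borel (\<eta> j)"
    and [measurable]: "U \<in> borel_measurable M" "f \<in> borel_measurable borel"
    and D: "\<And>z. z \<in> space M \<Longrightarrow> \<bar>U z\<bar> \<le> D" and f: "\<And>x. \<bar>f x\<bar> \<le> 1"
  shows "(\<lambda>k. expectation (\<lambda>z. U z * f (\<eta> k z))) \<longlonglongrightarrow> expectation U * (LINT x|std_normal_distribution. f x)"
proof -
  define \<mu> where "\<mu> = (LINT x|std_normal_distribution. f x)"
  have [measurable]: "\<eta> k \<in> borel_measurable M" for k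
    using distributed_measurable[OF \<eta>] by simp
  have fint: "integrable M (\<lambda>z. f (\<eta> k z))" for k using f by (intro integrable_bounded[where C=1]) auto
  have Uint: "integrable M U" using D by (intro integrable_bounded[where C=D]) auto
  have Dnn: "0 \<le> D"
    using not_empty D by (meson abs_ge_zero all_not_in_conv order_trans)
  have Ufint: "integrable M (\<lambda>z. U z * f (\<eta> k z))" for k
    using mult_mono[OF D f Dnn] by (intro integrable_bounded[where C=D]) (auto simp: abs_mult)
  have \<mu>: "expectation (\<lambda>z. f (\<eta> k z)) = \<mu>" for k
  proof -
    have "(LBINT x. std_normal_density x * f x) = expectation (\<lambda>z. f (\<eta> k z))"
      by (rule distributed_integral[OF \<eta>]) auto
    then show ?thesis unfolding \<mu>_def by (subst integral_density) auto
  qed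
  have "(\<lambda>k. expectation (\<lambda>z. U z * (f (\<eta> k z) - \<mu>))) \<longlonglongrightarrow> 0"
  proof (rule bounded_orthogonal_tendsto_0[where C="1 + \<bar>\<mu>\<bar>" and D=D])
    fix i j :: nat assume "i < j"
    from indep_var_compose[OF ind[OF this], of "\<lambda>x. f x - \<mu>" borel "\<lambda>x. f x - \<mu>" borel]
    have "indep_var borel (\<lambda>z. f (\<eta> i z) - \<mu>) borel (\<lambda>z. f (\<eta> j z) - \<mu>)" by (simp add: o_def)
    from indep_var_lebesgue_integral[OF this]
    show "expectation (\<lambda>z. (f (\<eta> i z) - \<mu>) * (f (\<eta> j z) - \<mu>)) = 0"
      using fint \<mu> by (simp add: prob_space)
  next
    fix k z
    show "\<bar>f (\<eta> k z) - \<mu>\<bar> \<le> 1 + \<bar>\<mu>\<bar>" using f[of "\<eta> k z"] by linarith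
  qed (use D in auto)
  then have "(\<lambda>k. expectation (\<lambda>z. U z * (f (\<eta> k z) - \<mu>)) + expectation U * \<mu>) \<longlonglongrightarrow> 0 + expectation U * \<mu>"
    by (intro tendsto_intros)
  moreover have "expectation (\<lambda>z. U z * (f (\<eta> k z) - \<mu>)) + expectation U * \<mu> = expectation (\<lambda>z. U z * f (\<eta> k z))" for k
    using Uint Ufint by (simp add: right_diff_distrib)
  ultimately show ?thesis by (simp add: \<mu>_def)
qed

lemma independent_copies_mixing_iexp:
  fixes \<eta> :: "nat \<Rightarrow> 'a \<Rightarrow> real"
  assumes \<eta>: "\<And>k. distributed M lborel (\<eta> k) std_normal_density"
    and ind: "\<And>i j. i < j \<Longrightarrow> indep_var borel (\<eta> i) borel (\<eta> j)"
    and U[measurable]: "U \<in> borel_measurable M" and D: "\<And>z. z \<in> space M \<Longrightarrow> \<bar>U z\<bar> \<le> D"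
  shows "(\<lambda>k. LINT z|M. complex_of_real (U z) * iexp (l * \<eta> k z)) \<longlonglongrightarrow>
    of_real (expectation U * exp (- (l\<^sup>2) / 2))"
proof -
  have [measurable]: "\<eta> k \<in> borel_measurable M" for k
    using distributed_measurable[OF \<eta>] by simp
  interpret N: prob_space std_normal_distribution by (rule prob_space_normal_density) simp
  \<comment> \<open>The orthogonality argument is about real functions, so cosine and sine are
    treated separately and recombined through the characteristic function of the normal law.\<close>
  have split: "iexp x = of_real (cos x) + \<i> * of_real (sin x)" for x
    by (simp add: exp_Euler cos_of_real sin_of_real)
  have Dnn: "0 \<le> D"
    using not_empty D by (meson abs_ge_zero all_not_in_conv order_trans)
  have int: "integrable M (\<lambda>z. U z * cos (l * \<eta> k z))" "integrable M (\<lambda>z. U z * sin (l * \<eta> k z))" for k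
    using mult_mono[OF D abs_cos_le_one Dnn] mult_mono[OF D abs_sin_le_one Dnn]
    by (auto intro!: integrable_bounded[where C=D] simp: abs_mult)
  have intN: "integrable std_normal_distribution (\<lambda>x. cos (l * x))" "integrable std_normal_distribution (\<lambda>x. sin (l * x))"
    by (auto intro!: N.integrable_bounded[where C=1])
  have eq: "(LINT z|M. complex_of_real (U z) * iexp (l * \<eta> k z)) =
      of_real (expectation (\<lambda>z. U z * cos (l * \<eta> k z))) + \<i> * of_real (expectation (\<lambda>z. U z * sin (l * \<eta> k z)))" for k
  proof -
    have "(\<lambda>z. complex_of_real (U z) * iexp (l * \<eta> k z)) =
        (\<lambda>z. of_real (U z * cos (l * \<eta> k z)) + \<i> * of_real (U z * sin (l * \<eta> k z)))"
      unfolding split by (simp add: fun_eq_iff algebra_simps)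
    moreover have "(LINT z|M. of_real (U z * cos (l * \<eta> k z)) + \<i> * of_real (U z * sin (l * \<eta> k z))) =
      complex_of_real (expectation (\<lambda>z. U z * cos (l * \<eta> k z))) + \<i> * of_real (expectation (\<lambda>z. U z * sin (l * \<eta> k z)))"
      using int[of k]
      by (subst Bochner_Integration.integral_add) (auto simp del: of_real_mult)
    ultimately show ?thesis by simp
  qed
  have "(LINT x|std_normal_distribution. iexp (l * x)) =
     of_real (LINT x|std_normal_distribution. cos (l * x)) + \<i> * of_real (LINT x|std_normal_distribution. sin (l * x))"
    unfolding split using intN by simp
  from this[symmetric] integral_std_normal_iexp[of l] have mean: "of_real (LINT x|std_normal_distribution. cos (l * x)) + \<i> * of_real (LINT x|std_normal_distribution. sin (l * x)) =
     complex_of_real (exp (- (l\<^sup>2) / 2))"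
    by (rule trans)
  have "(\<lambda>k. LINT z|M. complex_of_real (U z) * iexp (l * \<eta> k z)) \<longlonglongrightarrow>
     of_real (expectation U * (LINT x|std_normal_distribution. cos (l * x))) +
     \<i> * of_real (expectation U * (LINT x|std_normal_distribution. sin (l * x)))"
    unfolding eq
    by (intro tendsto_intros independent_copies_mixing[OF \<eta> ind]) (auto intro: D)
  also have "of_real (expectation U * (LINT x|std_normal_distribution. cos (l * x))) +
     \<i> * of_real (expectation U * (LINT x|std_normal_distribution. sin (l * x))) =
     complex_of_real (expectation U) * (of_real (LINT x|std_normal_distribution. cos (l * x)) + \<i> * of_real (LINT x|std_normal_distribution. sin (l * x)))"
    by (simp add: algebra_simps)
  finally show ?thesis unfolding mean by simp
qed

text \<open>On the set where \<open>S\<close> has the value \<open>v\<close>, the random factor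
  becomes a constant: the indicator of the set is absorbed into the test variable and
  \<open>v\<close> into the frequency \<open>l * v\<close>. Finitely many values reduce the claim to
  mixing with a deterministic factor.\<close>

lemma stable_mixing_simple:
  fixes \<eta> :: "nat \<Rightarrow> 'a \<Rightarrow> real"
  assumes \<eta>: "\<And>k. distributed M lborel (\<eta> k) std_normal_density"
    and ind: "\<And>i j. i < j \<Longrightarrow> indep_var borel (\<eta> i) borel (\<eta> j)"
    and Y[measurable]: "Y \<in> borel_measurable M" and D: "\<And>z. z \<in> space M \<Longrightarrow> \<bar>Y z\<bar> \<le> D"
    and S: "simple_function M S"
  shows "(\<lambda>k. LINT z|M. complex_of_real (Y z) * iexp (l * (S z * \<eta> k z))) \<longlonglongrightarrow>
    of_real (expectation (\<lambda>z. Y z * exp (- ((l * S z)\<^sup>2) / 2)))"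
proof -
  have [measurable]: "\<eta> k \<in> borel_measurable M" for k
    using distributed_measurable[OF \<eta>] by simp
  have fin: "finite (S ` space M)" using simple_functionD(1)[OF S] .
  define A where "A v = S -` {v} \<inter> space M" for v
  have [measurable]: "A v \<in> sets M" for v using simple_functionD(2)[OF S] by (simp add: A_def)
  have Dnn: "0 \<le> D"
    using not_empty D by (meson abs_ge_zero all_not_in_conv order_trans)
  have bd: "\<bar>Y z * indicator (A v) z\<bar> \<le> D" if "z \<in> space M" for v z
    using D[OF that] Dnn by (auto simp: indicator_def)
  have pick: "h (S z) = (\<Sum>v\<in>S ` space M. indicator (A v) z * h v)" if "z \<in> space M"
    for z and h :: "real \<Rightarrow> 'c::real_normed_field"
  proof -
    have "(\<Sum>v\<in>S ` space M. indicator (A v) z * h v) = (\<Sum>v\<in>S ` space M. if v = S z then h v else 0)"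
      using that by (intro sum.cong) (auto simp: A_def indicator_def)
    then show ?thesis using fin that by (simp add: sum.delta)
  qed
  have "(LINT z|M. complex_of_real (Y z) * iexp (l * (S z * \<eta> k z))) =
     (\<Sum>v\<in>S ` space M. LINT z|M. complex_of_real (Y z * indicator (A v) z) * iexp ((l * v) * \<eta> k z))" for k
  proof -
    have "(LINT z|M. complex_of_real (Y z) * iexp (l * (S z * \<eta> k z))) =
      (LINT z|M. (\<Sum>v\<in>S ` space M. complex_of_real (Y z * indicator (A v) z) * iexp ((l * v) * \<eta> k z)))"
    proof (intro Bochner_Integration.integral_cong refl)
      fix z assume z: "z \<in> space M"
      show "complex_of_real (Y z) * iexp (l * (S z * \<eta> k z)) =
        (\<Sum>v\<in>S ` space M. complex_of_real (Y z * indicator (A v) z) * iexp ((l * v) * \<eta> k z))"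
        using pick[OF z, of "\<lambda>v. complex_of_real (Y z) * iexp (l * (v * \<eta> k z))"]
        by (simp add: mult_ac of_real_indicator)
    qed
    also have "\<dots> = (\<Sum>v\<in>S ` space M. LINT z|M. complex_of_real (Y z * indicator (A v) z) * iexp ((l * v) * \<eta> k z))"
      using bd by (intro Bochner_Integration.integral_sum integrable_bounded[where C=D]) (auto simp: norm_mult abs_mult)
    finally show ?thesis .
  qed
  moreover have "(\<lambda>k. \<Sum>v\<in>S ` space M. LINT z|M. complex_of_real (Y z * indicator (A v) z) * iexp ((l * v) * \<eta> k z)) \<longlonglongrightarrow>
     (\<Sum>v\<in>S ` space M. of_real (expectation (\<lambda>z. Y z * indicator (A v) z) * exp (- ((l * v)\<^sup>2) / 2)))"
    by (intro tendsto_sum independent_copies_mixing_iexp[OF \<eta> ind _ bd]) auto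
  moreover have "(\<Sum>v\<in>S ` space M. expectation (\<lambda>z. Y z * indicator (A v) z) * exp (- ((l * v)\<^sup>2) / 2)) =
     expectation (\<lambda>z. Y z * exp (- ((l * S z)\<^sup>2) / 2))"
  proof -
    have int: "integrable M (\<lambda>z. Y z * indicator (A v) z)" for v
      using bd by (intro integrable_bounded[where C=D]) auto
    have "expectation (\<lambda>z. Y z * exp (- ((l * S z)\<^sup>2) / 2)) =
      expectation (\<lambda>z. \<Sum>v\<in>S ` space M. (Y z * indicator (A v) z) * exp (- ((l * v)\<^sup>2) / 2))"
    proof (intro Bochner_Integration.integral_cong refl)
      fix z assume z: "z \<in> space M"
      show "Y z * exp (- ((l * S z)\<^sup>2) / 2) = (\<Sum>v\<in>S ` space M. (Y z * indicator (A v) z) * exp (- ((l * v)\<^sup>2) / 2))"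
        using pick[OF z, of "\<lambda>v. Y z * exp (- ((l * v)\<^sup>2) / 2)"] by (simp add: mult_ac)
    qed
    also have "\<dots> = (\<Sum>v\<in>S ` space M. expectation (\<lambda>z. Y z * indicator (A v) z) * exp (- ((l * v)\<^sup>2) / 2))"
      using int by (subst Bochner_Integration.integral_sum) auto
    finally show ?thesis by simp
  qed
  ultimately show ?thesis by (simp only: of_real_sum[symmetric])
qed

lemma std_normal_second_moment:
  assumes "distributed M lborel X std_normal_density"
  shows "integrable M (\<lambda>z. (X z)\<^sup>2)" "expectation (\<lambda>z. (X z)\<^sup>2) = 1"
  using distributed_integrable[OF assms, of "\<lambda>x. x\<^sup>2"] integrable_std_normal_moment[of 2]
    distributed_integral[OF assms, of "\<lambda>x. x\<^sup>2"] integral_std_normal_moment_even[of 1]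
  by simp_all

text \<open>The function \<open>iexp\<close> is Lipschitz with constant 1, so closeness in mean of
  \<open>F\<close> and \<open>G\<close> is enough. For this reason the approximation by products is
  later measured in mean.\<close>

lemma norm_integral_iexp_diff_le:
  assumes [measurable]: "Y \<in> borel_measurable M" "F \<in> borel_measurable M" "G \<in> borel_measurable M"
    and D: "\<And>z. z \<in> space M \<Longrightarrow> \<bar>Y z\<bar> \<le> D"
    and d: "(\<integral>\<^sup>+z. ennreal \<bar>F z - G z\<bar> \<partial>M) \<le> ennreal d" "0 \<le> d"
  shows "cmod ((LINT z|M. complex_of_real (Y z) * iexp (l * F z)) -
     (LINT z|M. complex_of_real (Y z) * iexp (l * G z))) \<le> D * \<bar>l\<bar> * d"
proof -
  have Dnn: "0 \<le> D"
    using not_empty D by (meson abs_ge_zero all_not_in_conv order_trans)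
  have int: "integrable M (\<lambda>z. complex_of_real (Y z) * iexp (l * H z))" if "H \<in> borel_measurable M" for H
    using that D by (intro integrable_bounded[where C=D]) (auto simp: norm_mult)
  have "ennreal (cmod ((LINT z|M. complex_of_real (Y z) * iexp (l * F z)) -
     (LINT z|M. complex_of_real (Y z) * iexp (l * G z)))) =
    ennreal (cmod (LINT z|M. complex_of_real (Y z) * iexp (l * F z) - complex_of_real (Y z) * iexp (l * G z)))"
    by (subst Bochner_Integration.integral_diff[OF int[OF assms(2)] int[OF assms(3)]]) simp
  also have "\<dots> \<le> (\<integral>\<^sup>+z. norm (complex_of_real (Y z) * iexp (l * F z) - complex_of_real (Y z) * iexp (l * G z)) \<partial>M)"
    by (intro integral_norm_bound_ennreal Bochner_Integration.integrable_diff int assms(2,3))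
  also have "\<dots> \<le> (\<integral>\<^sup>+z. ennreal (D * \<bar>l\<bar>) * ennreal \<bar>F z - G z\<bar> \<partial>M)"
  proof (intro nn_integral_mono)
    fix z assume z: "z \<in> space M"
    have "norm (complex_of_real (Y z) * iexp (l * F z) - complex_of_real (Y z) * iexp (l * G z)) =
      \<bar>Y z\<bar> * cmod (iexp (l * F z) - iexp (l * G z))"
      by (simp flip: right_diff_distrib add: norm_mult)
    also have "\<dots> \<le> D * \<bar>l * F z - l * G z\<bar>"
      using D[OF z] norm_iexp_diff_le[of "l * F z" "l * G z"] Dnn by (intro mult_mono) auto
    also have "\<dots> = D * \<bar>l\<bar> * \<bar>F z - G z\<bar>"
      by (simp add: abs_mult flip: right_diff_distrib)
    finally show "ennreal (norm (complex_of_real (Y z) * iexp (l * F z) - complex_of_real (Y z) * iexp (l * G z))) \<le>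
        ennreal (D * \<bar>l\<bar>) * ennreal \<bar>F z - G z\<bar>"
      using Dnn by (simp add: ennreal_mult[symmetric] ennreal_leI)
  qed
  also have "\<dots> = ennreal (D * \<bar>l\<bar>) * (\<integral>\<^sup>+z. ennreal \<bar>F z - G z\<bar> \<partial>M)"
    by (simp add: nn_integral_cmult)
  also have "\<dots> \<le> ennreal (D * \<bar>l\<bar>) * ennreal d" using d(1) by (intro mult_left_mono) auto
  also have "\<dots> = ennreal (D * \<bar>l\<bar> * d)" using Dnn d(2) by (simp add: ennreal_mult)
  finally show ?thesis using Dnn d(2) by simp
qed

text \<open>A three-epsilon argument in which the comparison sequence and its own limit may depend
  on the tolerance, as they do when \<open>S\<close> is approximated by simple functions.\<close>

lemma LIMSEQ_from_approximation:
  fixes a :: "nat \<Rightarrow> complex"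
  assumes "\<And>e. e > 0 \<Longrightarrow> \<exists>c b. c \<longlonglongrightarrow> b \<and> (\<forall>\<^sub>F k in sequentially. cmod (a k - c k) < e) \<and> cmod (b - L) < e"
  shows "a \<longlonglongrightarrow> L"
proof (rule LIMSEQ_I)
  fix r :: real assume "0 < r"
  then obtain c b where c: "c \<longlonglongrightarrow> b" "\<forall>\<^sub>F k in sequentially. cmod (a k - c k) < r / 3" "cmod (b - L) < r / 3"
    using assms[of "r / 3"] by auto
  have "\<forall>\<^sub>F k in sequentially. cmod (c k - b) < r / 3"
    using tendstoD[OF c(1), of "r / 3"] \<open>0 < r\<close> by (simp add: dist_norm)
  with c(2) have "\<forall>\<^sub>F k in sequentially. cmod (a k - L) < r"
  proof eventually_elim
    case (elim k)
    have "a k - L = (a k - c k) + (c k - b) + (b - L)" by simp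
    then have "cmod (a k - L) \<le> cmod (a k - c k) + cmod (c k - b) + cmod (b - L)"
      by (metis norm_triangle_ineq norm_triangle_le order_refl add_right_mono)
    then show ?case using elim c(3) by linarith
  qed
  then show "\<exists>no. \<forall>n\<ge>no. cmod (a n - L) < r" by (simp add: eventually_sequentially)
qed

text \<open>\<open>S\<close> is replaced by a simple function. By Cauchy-Schwarz, and because every
  \<open>\<eta> k\<close> has second moment 1, the mean error is at most the L^2 distance of the
  two. This is uniform in \<open>k\<close>, so the simple function can be fixed before
  \<open>k\<close> tends to infinity.\<close>

lemma stable_mixing:
  fixes \<eta> :: "nat \<Rightarrow> 'a \<Rightarrow> real"
  assumes \<eta>: "\<And>k. distributed M lborel (\<eta> k) std_normal_density"
    and ind: "\<And>i j. i < j \<Longrightarrow> indep_var borel (\<eta> i) borel (\<eta> j)"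
    and Y[measurable]: "Y \<in> borel_measurable M" and D: "\<And>z. z \<in> space M \<Longrightarrow> \<bar>Y z\<bar> \<le> D"
    and S[measurable]: "S \<in> borel_measurable M" and S2: "integrable M (\<lambda>z. (S z)\<^sup>2)"
    and F[measurable]: "\<And>k. F k \<in> borel_measurable M"
    and conv: "(\<lambda>k. \<integral>\<^sup>+z. ennreal \<bar>F k z - S z * \<eta> k z\<bar> \<partial>M) \<longlonglongrightarrow> 0"
  shows "(\<lambda>k. LINT z|M. complex_of_real (Y z) * iexp (l * F k z)) \<longlonglongrightarrow>
    of_real (expectation (\<lambda>z. Y z * exp (- ((l * S z)\<^sup>2) / 2)))"
proof (rule LIMSEQ_from_approximation)
  fix e :: real assume e: "e > 0"
  have [measurable]: "\<eta> k \<in> borel_measurable M" for k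
    using distributed_measurable[OF \<eta>] by simp
  have Dnn: "0 \<le> D"
    using not_empty D by (meson abs_ge_zero all_not_in_conv order_trans)
  \<comment> \<open>The approximants are dominated by \<open>2 * \<bar>S z\<bar>\<close>, which
    makes \<open>9 * (S z)\<^sup>2\<close> an integrable majorant of the squared error.\<close>
  obtain s where s: "\<And>i. simple_function M (s i)" "\<And>z. z \<in> space M \<Longrightarrow> (\<lambda>i. s i z) \<longlonglongrightarrow> S z"
      "\<And>i z. z \<in> space M \<Longrightarrow> dist (s i z) 0 \<le> 2 * dist (S z) 0"
    using borel_measurable_implies_sequence_metric[OF S, of 0] by blast
  have [measurable]: "s i \<in> borel_measurable M" for i using borel_measurable_simple_function[OF s(1)] .
  have sb: "\<bar>s i z - S z\<bar> \<le> 3 * \<bar>S z\<bar>" if "z \<in> space M" for i z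
    using s(3)[OF that, of i] by (simp add: dist_real_def)
  have sq: "(s i z - S z)\<^sup>2 \<le> 9 * (S z)\<^sup>2" if "z \<in> space M" for i z
    using power_mono[OF sb[OF that, of i], of 2] by (simp add: power_mult_distrib)
  have int2: "integrable M (\<lambda>z. (s i z - S z)\<^sup>2)" for i
  proof (rule Bochner_Integration.integrable_bound)
    show "integrable M (\<lambda>z. 9 * (S z)\<^sup>2)" using S2 by simp
    show "AE z in M. norm ((s i z - S z)\<^sup>2) \<le> norm (9 * (S z)\<^sup>2)"
      by (rule AE_I2) (simp add: sq)
  qed measurable
  have lim2: "(\<lambda>i. expectation (\<lambda>z. (s i z - S z)\<^sup>2)) \<longlonglongrightarrow> expectation (\<lambda>z. 0)"
  proof (rule integral_dominated_convergence[where w="\<lambda>z. 9 * (S z)\<^sup>2"])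
    show "AE z in M. (\<lambda>i. (s i z - S z)\<^sup>2) \<longlonglongrightarrow> 0"
      using s(2) by (intro AE_I2) (auto intro!: tendsto_eq_intros)
    show "integrable M (\<lambda>z. 9 * (S z)\<^sup>2)" using S2 by simp
    show "AE z in M. norm ((s i z - S z)\<^sup>2) \<le> 9 * (S z)\<^sup>2" for i
      by (rule AE_I2) (simp add: sq)
  qed measurable
  define d where "d i = sqrt (expectation (\<lambda>z. (s i z - S z)\<^sup>2))" for i
  have "d \<longlonglongrightarrow> sqrt 0" unfolding d_def using tendsto_real_sqrt[OF lim2] by simp
  then have "(\<lambda>i. D * \<bar>l\<bar> * (d i + d i)) \<longlonglongrightarrow> D * \<bar>l\<bar> * (0 + 0)" by (intro tendsto_intros) auto
  then have ev1: "\<forall>\<^sub>F i in sequentially. D * \<bar>l\<bar> * (d i + d i) < e / 2" using e by (intro order_tendstoD) auto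
  define L where "L T = expectation (\<lambda>z. Y z * exp (- ((l * T z)\<^sup>2) / 2))" for T
  have "(\<lambda>i. L (s i)) \<longlonglongrightarrow> L S"
    unfolding L_def
  proof (rule integral_dominated_convergence[where w="\<lambda>z. D"])
    show "AE z in M. (\<lambda>i. Y z * exp (- ((l * s i z)\<^sup>2) / 2)) \<longlonglongrightarrow> Y z * exp (- ((l * S z)\<^sup>2) / 2)"
      using s(2) by (intro AE_I2) (auto intro!: tendsto_intros)
    show "AE z in M. norm (Y z * exp (- ((l * s i z)\<^sup>2) / 2)) \<le> D" for i
    proof (rule AE_I2)
      fix z assume "z \<in> space M"
      then have "\<bar>Y z\<bar> * exp (- ((l * s i z)\<^sup>2) / 2) \<le> D * 1" using D Dnn by (intro mult_mono) auto
      then show "norm (Y z * exp (- ((l * s i z)\<^sup>2) / 2)) \<le> D" by (simp add: abs_mult)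
    qed
  qed auto
  then have ev2: "\<forall>\<^sub>F i in sequentially. \<bar>L (s i) - L S\<bar> < e"
    using tendstoD[of "\<lambda>i. L (s i)" "L S" sequentially e] e by (simp add: dist_real_def)
  from eventually_conj[OF ev1 ev2] obtain i where i: "D * \<bar>l\<bar> * (d i + d i) < e / 2" "\<bar>L (s i) - L S\<bar> < e"
    by (auto dest: eventually_happens'[rotated])
  have dnn: "d i \<ge> 0" by (simp add: d_def)
  \<comment> \<open>The denominator contains \<open>q + 1\<close> rather than \<open>q\<close>
    because \<open>D * \<bar>l\<bar>\<close> may be 0.\<close>
  have "\<exists>\<delta>>0. D * \<bar>l\<bar> * \<delta> < e / 2"
  proof -
    define q where "q = D * \<bar>l\<bar>"
    have "q + 1 > 0" using Dnn by (simp add: q_def add_nonneg_pos)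
    then have "e / (2 * (q + 1)) > 0" "q * (e / (2 * (q + 1))) < e / 2"
      using e by (simp_all add: field_simps)
    then show ?thesis unfolding q_def by blast
  qed
  then obtain \<delta> where \<delta>: "\<delta> > 0" "D * \<bar>l\<bar> * \<delta> < e / 2" by blast
  have "\<forall>\<^sub>F k in sequentially. (\<integral>\<^sup>+z. ennreal \<bar>F k z - S z * \<eta> k z\<bar> \<partial>M) < ennreal \<delta>"
    using conv \<delta> by (intro order_tendstoD(2)) auto
  then have ev: "\<forall>\<^sub>F k in sequentially. cmod ((LINT z|M. complex_of_real (Y z) * iexp (l * F k z)) -
       (LINT z|M. complex_of_real (Y z) * iexp (l * (s i z * \<eta> k z)))) < e"
  proof eventually_elim
    case (elim k)
    note mom = std_normal_second_moment[OF \<eta>[of k]]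
    have CS: "integrable M (\<lambda>z. (S z - s i z) * \<eta> k z)"
       "(expectation (\<lambda>z. \<bar>(S z - s i z) * \<eta> k z\<bar>))\<^sup>2 \<le> (d i)\<^sup>2"
      using integral_Cauchy_Schwarz[of "\<lambda>z. S z - s i z" M "\<eta> k"] int2[of i] mom
      by (auto simp: d_def power2_commute[of "S _"])
    have "expectation (\<lambda>z. \<bar>(S z - s i z) * \<eta> k z\<bar>) \<le> d i"
      using CS(2) dnn by (rule power2_le_imp_le)
    have "(\<integral>\<^sup>+z. ennreal \<bar>S z * \<eta> k z - s i z * \<eta> k z\<bar> \<partial>M) = ennreal (expectation (\<lambda>z. \<bar>(S z - s i z) * \<eta> k z\<bar>))"
      using CS(1) by (subst nn_integral_eq_integral[symmetric]) (auto simp: left_diff_distrib)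
    also have "\<dots> \<le> ennreal (d i)" by (rule ennreal_leI) fact
    finally have n1: "cmod ((LINT z|M. complex_of_real (Y z) * iexp (l * (S z * \<eta> k z))) -
       (LINT z|M. complex_of_real (Y z) * iexp (l * (s i z * \<eta> k z)))) \<le> D * \<bar>l\<bar> * d i"
      using dnn D by (intro norm_integral_iexp_diff_le) auto
    have n2: "cmod ((LINT z|M. complex_of_real (Y z) * iexp (l * F k z)) -
       (LINT z|M. complex_of_real (Y z) * iexp (l * (S z * \<eta> k z)))) \<le> D * \<bar>l\<bar> * \<delta>"
      using elim \<delta> D by (intro norm_integral_iexp_diff_le) auto
    have "0 \<le> D * \<bar>l\<bar> * d i" "D * \<bar>l\<bar> * d i + D * \<bar>l\<bar> * d i < e / 2"
      using Dnn dnn i(1) by (simp_all add: distrib_left)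
    then show ?case using norm_diff_triangle_le[OF n2 n1] \<delta>(2) by linarith
  qed
  have close: "cmod (of_real (L (s i)) - of_real (L S)) < e"
    using i(2) by (simp flip: of_real_diff)
  show "\<exists>c b. c \<longlonglongrightarrow> b \<and> (\<forall>\<^sub>F k in sequentially. cmod ((LINT z|M. complex_of_real (Y z) * iexp (l * F k z)) - c k) < e) \<and>
      cmod (b - of_real (expectation (\<lambda>z. Y z * exp (- ((l * S z)\<^sup>2) / 2)))) < e"
  proof (intro exI conjI)
    show "(\<lambda>k. LINT z|M. complex_of_real (Y z) * iexp (l * (s i z * \<eta> k z))) \<longlonglongrightarrow> of_real (L (s i))"
      unfolding L_def by (rule stable_mixing_simple[OF \<eta> ind Y D s(1)])
  qed (use close ev in \<open>simp_all only: L_def\<close>)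
qed

text \<open>The extension is the product of \<open>M\<close> with the standard normal law, with
  \<open>fst\<close> as the projection and \<open>snd\<close> as the normal variable. Fubini
  integrates out the normal variable first, which produces the Gaussian factor of the assumption
  \<open>lim\<close>.\<close>

lemma stable_conv_mixed_normalI:
  assumes S[measurable]: "S \<in> borel_measurable M" and F: "\<And>n. F n \<in> borel_measurable M"
    and lim: "\<And>l Y C. Y \<in> borel_measurable M \<Longrightarrow> (\<And>z. z \<in> space M \<Longrightarrow> \<bar>Y z\<bar> \<le> C) \<Longrightarrow>
      (\<lambda>n. LINT z|M. complex_of_real (Y z) * iexp (l * F n z)) \<longlonglongrightarrow>
        of_real (expectation (\<lambda>z. Y z * exp (- ((l * S z)\<^sup>2) / 2)))"
  shows "stable_conv_mixed_normal M F S"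
proof -
  let ?N = "std_normal_distribution"
  interpret N: prob_space ?N by (rule prob_space_normal_density) simp
  interpret P: pair_prob_space M ?N ..
  let ?M' = "M \<Otimes>\<^sub>M ?N"
  have snd: "distr ?M' lborel snd = density lborel (\<lambda>x. ennreal (std_normal_density x))"
  proof -
    have "distr ?M' ?N snd = ?N"
    proof (rule measure_eqI)
      fix B assume B: "B \<in> sets (distr ?M' ?N snd)"
      then have "snd -` B \<inter> space ?M' = space M \<times> B"
        by (auto simp: space_pair_measure)
      then show "emeasure (distr ?M' ?N snd) B = emeasure ?N B"
        using B N.emeasure_pair_measure_Times[of "space M" M B]
        by (subst emeasure_distr) (auto simp: emeasure_space_1)
    qed simp
    moreover have "distr ?M' lborel snd = distr ?M' ?N snd" by (intro distr_cong) auto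
    ultimately show ?thesis by simp
  qed
  have dist: "distributed ?M' lborel snd std_normal_density"
    unfolding distributed_def using snd by auto
  have ext: "prob_extension M ?M' fst"
    unfolding prob_extension_def using prob_space_axioms P.prob_space_axioms N.distr_pair_fst by auto
  have indep: "P.indep_set (sets (vimage_algebra (space ?M') fst M)) (sets (vimage_algebra (space ?M') snd borel))"
    unfolding P.indep_sets2_eq
  proof (intro conjI ballI)
    show 1: "sets (vimage_algebra (space ?M') fst M) \<subseteq> P.events"
      by (subst sets_vimage_algebra2) (auto simp: space_pair_measure)
    show 2: "sets (vimage_algebra (space ?M') snd borel) \<subseteq> P.events"
      by (subst sets_vimage_algebra2) (auto simp: space_pair_measure)
    have fst: "fst \<in> space ?M' \<rightarrow> space M" by (auto simp: space_pair_measure)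
    fix a b assume "a \<in> sets (vimage_algebra (space ?M') fst M)" "b \<in> sets (vimage_algebra (space ?M') snd borel)"
    then obtain A B where A: "A \<in> sets M" "a = fst -` A \<inter> space ?M'" and B: "B \<in> sets borel" "b = snd -` B \<inter> space ?M'"
      using sets_vimage_algebra2[of fst "space ?M'" M, OF fst] sets_vimage_algebra2[of snd "space ?M'" "borel :: real measure"]
      by (auto simp: space_pair_measure)
    have eq: "a = A \<times> space ?N" "b = space M \<times> B" "a \<inter> b = A \<times> B"
      using A B sets.sets_into_space[OF A(1)] by (auto simp: space_pair_measure)
    have "measure ?M' (A \<times> B) = measure M A * measure ?N B"
      "measure ?M' (A \<times> space ?N) = measure M A * measure ?N (space ?N)"
      "measure ?M' (space M \<times> B) = measure M (space M) * measure ?N B"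
      using A B by (auto simp: measure_def N.emeasure_pair_measure_Times enn2real_mult)
    then show "P.prob (a \<inter> b) = P.prob a * P.prob b"
      unfolding eq(3) unfolding eq(1,2) using prob_space N.prob_space by simp
  qed
  have "stable_conv M F ?M' fst (\<lambda>z'. S (fst z') * snd z')"
    unfolding stable_conv_def
  proof (intro conjI allI impI)
    fix l :: real and Y :: "'a \<Rightarrow> real"
    assume "Y \<in> borel_measurable M \<and> (\<exists>C. \<forall>z\<in>space M. \<bar>Y z\<bar> \<le> C)"
    then obtain C where Y[measurable]: "Y \<in> borel_measurable M" and C: "\<And>z. z \<in> space M \<Longrightarrow> \<bar>Y z\<bar> \<le> C" by auto
    let ?f = "\<lambda>z' :: 'a \<times> real. complex_of_real (Y (fst z')) * iexp (l * (S (fst z') * snd z'))"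
    have "integrable ?M' ?f"
      using C by (intro P.integrable_bounded[where C=C]) (auto simp: norm_mult space_pair_measure)
    from P.integral_fst'[OF this]
    have "(LINT z'|?M'. ?f z') = (LINT z|M. LINT x|?N. complex_of_real (Y z) * iexp ((l * S z) * x))"
      by (simp add: mult.assoc)
    also have "\<dots> = (LINT z|M. complex_of_real (Y z * exp (- ((l * S z)\<^sup>2) / 2)))"
      using integral_std_normal_iexp[of "l * S _"] by (simp only: Bochner_Integration.integral_mult_right_zero of_real_mult)
    also have "\<dots> = of_real (expectation (\<lambda>z. Y z * exp (- ((l * S z)\<^sup>2) / 2)))"
      by (rule integral_complex_of_real)
    finally show "(\<lambda>n. LINT z|M. complex_of_real (Y z) * iexp (l * F n z)) \<longlonglongrightarrow>
        (LINT z'|?M'. complex_of_real (Y (fst z')) * iexp (l * (S (fst z') * snd z')))"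
      using lim[OF Y C, of l] by simp
  qed (use ext F in auto)
  then show ?thesis
    unfolding stable_conv_mixed_normal_def using S dist indep
    by (intro conjI exI[of _ ?M'] exI[of _ fst] exI[of _ snd]) auto
qed

end

section \<open>Approximation by independent products\<close>

definition unit_step_functional :: "nat \<Rightarrow> nat \<Rightarrow> (nat \<Rightarrow> real) \<Rightarrow> (nat \<Rightarrow> real \<Rightarrow> real) \<Rightarrow> real" where
  "unit_step_functional R P \<alpha> V =
     (\<Sum>l<P. \<alpha> l * (V 0 (real (Suc l) - real (R + P)) - V 0 (real l - real (R + P))))"

lemma elementary_unit_step_functional:
  "elementary 1 {- real (R + P)..- real R} (unit_step_functional R P \<alpha>)"
proof -
  have "elementary 1 {- real (R + P)..- real R}
     (\<lambda>V. \<alpha> l * box_monomial 1 (\<lambda>_. real l - real (R + P)) (\<lambda>_. real (Suc l) - real (R + P)) V)" if "l < P" for l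
    using that by (intro elementary_monomial) (auto simp: disjoint_sides_def)
  then have "elementary 1 {- real (R + P)..- real R}
     (\<lambda>V. \<Sum>l<P. \<alpha> l * box_monomial 1 (\<lambda>_. real l - real (R + P)) (\<lambda>_. real (Suc l) - real (R + P)) V)"
    by (intro elementary_sum) auto
  then show ?thesis unfolding unit_step_functional_def[abs_def] by (simp add: box_monomial_def)
qed

lemma elementary_fun_unit_step_functional:
  "elementary_fun (unit_step_functional R P \<alpha>) x = unit_step R P \<alpha> (x 0)"
  unfolding elementary_fun_def unit_step_functional_def unit_step_def
  by (intro sum.cong) (auto simp: indicator_def)

text \<open>Measurability and finite norm are part of \<open>has_wiener_ito\<close>, so they are
  read off from the given integrals instead of being derived from the exponents.\<close>

lemma rosenblatt_kernel_measurable_finite: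
  assumes "has_wiener_ito M W m (rosenblatt_kernel A \<gamma> t) X" "A > 0"
  shows "rosenblatt_kernel 1 \<gamma> t \<in> borel_measurable (leb_pow m)"
    and "(\<integral>\<^sup>+x. ennreal ((rosenblatt_kernel 1 \<gamma> t x)\<^sup>2) \<partial>leb_pow m) < \<infinity>"
proof -
  have eq: "rosenblatt_kernel 1 \<gamma> t = (\<lambda>x. (1 / A) * rosenblatt_kernel A \<gamma> t x)"
    using assms(2) by (simp add: fun_eq_iff rosenblatt_kernel_scale[of A])
  have m[measurable]: "rosenblatt_kernel A \<gamma> t \<in> borel_measurable (leb_pow m)"
    and fin: "(\<integral>\<^sup>+x. ennreal ((rosenblatt_kernel A \<gamma> t x)\<^sup>2) \<partial>leb_pow m) < \<infinity>"
    using assms(1) by (auto simp: has_wiener_ito_def)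
  show "rosenblatt_kernel 1 \<gamma> t \<in> borel_measurable (leb_pow m)"
    unfolding eq by measurable
  have "(\<integral>\<^sup>+x. ennreal ((rosenblatt_kernel 1 \<gamma> t x)\<^sup>2) \<partial>leb_pow m) =
      ennreal ((1 / A)\<^sup>2) * (\<integral>\<^sup>+x. ennreal ((rosenblatt_kernel A \<gamma> t x)\<^sup>2) \<partial>leb_pow m)"
    using nn_integral_square_scaled_diff[OF m, of "\<lambda>_. 0" "1 / A"] unfolding eq by simp
  then show "(\<integral>\<^sup>+x. ennreal ((rosenblatt_kernel 1 \<gamma> t x)\<^sup>2) \<partial>leb_pow m) < \<infinity>"
    using fin by (simp add: ennreal_mult_less_top)
qed

context brownian_motion
begin

text \<open>In an integral all slots of \<open>V\<close> carry the same path \<open>W\<close>, so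
  every permutation gives the same value.\<close>

lemma elementary_int_symmetrization:
  "elementary_int W (\<lambda>V. (\<Sum>\<sigma> | \<sigma> permutes {..<m}. F (\<lambda>i. V (\<sigma> i))) / fact m) = elementary_int W F"
  by (simp add: elementary_int_def fun_eq_iff card_permutes_lessThan)

lemma wiener_ito_square_integrable:
  assumes "has_wiener_ito M W m f X"
  shows "integrable M (\<lambda>z. (X z)\<^sup>2)"
proof -
  have f: "f \<in> borel_measurable (leb_pow m)" and fin: "(\<integral>\<^sup>+x. ennreal ((f x)\<^sup>2) \<partial>leb_pow m) < \<infinity>"
    and [measurable]: "X \<in> borel_measurable M"
    using assms by (auto simp: has_wiener_ito_def)
  have "(\<integral>\<^sup>+z. ennreal ((X z)\<^sup>2) \<partial>M) \<le> 4 * fact m * (\<integral>\<^sup>+x. ennreal ((symmetrization m f x)\<^sup>2) \<partial>leb_pow m)"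
    using wiener_ito_elementary_distance[OF assms elementary_zero, of 1]
    by (simp add: elementary_int_def elementary_fun_def)
  also have "\<dots> \<le> ennreal (4 * fact m) * (\<integral>\<^sup>+x. ennreal ((f x)\<^sup>2) \<partial>leb_pow m)"
    using nn_integral_symmetrization_square_le[OF f]
    by (simp add: ennreal_mult' ennreal_fact mult_left_mono)
  also have "\<dots> < \<infinity>" using fin by (simp add: ennreal_mult_less_top)
  finally show ?thesis by (intro integrableI_bounded) auto
qed

text \<open>The unit step function lives to the left of \<open>- real R\<close> and \<open>G\<close>
  to the right, so their tensor product \<open>F\<close> is elementary and its integral is exactly
  the product of two integrals. The error has two sources: the kernel against the tensor product
  with \<open>k\<close>, and \<open>k\<close> against \<open>G\<close>. The triangle inequality
  turns the factor 4 of the distance bound into 8.\<close>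

lemma wiener_ito_tensor_distance:
  assumes X: "has_wiener_ito M W (Suc m) f X" and k: "k \<in> borel_measurable (leb_pow m)"
    and G: "elementary m {- real R..} G" and \<alpha>: "(\<Sum>l<P. (\<alpha> l)\<^sup>2) = 1"
  shows "(\<integral>\<^sup>+z. ennreal ((\<rho> * X z - elementary_int W G z * elementary_int W (unit_step_functional R P \<alpha>) z)\<^sup>2) \<partial>M) \<le>
    8 * fact (Suc m) * ((\<integral>\<^sup>+x. ennreal ((\<rho> * f x - unit_step R P \<alpha> (x 0) * k (x \<circ> Suc))\<^sup>2) \<partial>leb_pow (Suc m)) +
      (\<integral>\<^sup>+x. ennreal ((elementary_fun G x - symmetrization m k x)\<^sup>2) \<partial>leb_pow m))"
proof -
  let ?H = "unit_step_functional R P \<alpha>" and ?h = "unit_step R P \<alpha>"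
  define F where "F = (\<lambda>V. ?H V * G (\<lambda>i. V (Suc i)))"
  have F: "elementary (Suc m) UNIV F"
    unfolding F_def by (rule elementary_tensor[OF elementary_unit_step_functional G]) auto
  define Fs where "Fs = (\<lambda>V. (\<Sum>\<sigma> | \<sigma> permutes {..<Suc m}. F (\<lambda>i. V (\<sigma> i))) / fact (Suc m))"
  have Fs: "elementary (Suc m) UNIV Fs" "elementary_fun Fs = symmetrization (Suc m) (elementary_fun F)"
    unfolding Fs_def using elementary_symmetrization[OF F] by blast+
  have JF: "elementary_fun F = (\<lambda>x. ?h (x 0) * elementary_fun G (x \<circ> Suc))"
    using elementary_fun_unit_step_functional by (simp add: fun_eq_iff F_def elementary_fun_def o_def)
  have IF: "elementary_int W Fs z = elementary_int W G z * elementary_int W ?H z" for z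
    unfolding Fs_def elementary_int_symmetrization[where m="Suc m" and F=F] by (simp add: F_def elementary_int_def)
  have f[measurable]: "f \<in> borel_measurable (leb_pow (Suc m))" using X by (auto simp: has_wiener_ito_def)
  note [measurable] = measurable_elementary_fun[OF G] k
  have tail: "(\<lambda>x. p (x \<circ> Suc)) \<in> borel_measurable (leb_pow (Suc m))" if "p \<in> borel_measurable (leb_pow m)" for p :: "_ \<Rightarrow> real"
    by (rule measurable_compose[OF measurable_tail_coordinates that])
  have hk[measurable]: "(\<lambda>x. ?h (x 0) * k (x \<circ> Suc)) \<in> borel_measurable (leb_pow (Suc m))"
    "(\<lambda>x. ?h (x 0) * elementary_fun G (x \<circ> Suc)) \<in> borel_measurable (leb_pow (Suc m))"
    "(\<lambda>x. ?h (x 0) * (symmetrization m k (x \<circ> Suc) - elementary_fun G (x \<circ> Suc))) \<in> borel_measurable (leb_pow (Suc m))"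
    "(\<lambda>x. ?h (x 0) * symmetrization m k (x \<circ> Suc)) \<in> borel_measurable (leb_pow (Suc m))"
    using tail[OF k] tail[OF measurable_elementary_fun[OF G]] tail[OF measurable_symmetrization[OF k]] by measurable
  let ?e1 = "\<integral>\<^sup>+x. ennreal ((\<rho> * f x - ?h (x 0) * k (x \<circ> Suc))\<^sup>2) \<partial>leb_pow (Suc m)"
  let ?e2 = "\<integral>\<^sup>+x. ennreal ((elementary_fun G x - symmetrization m k x)\<^sup>2) \<partial>leb_pow m"
  have 1: "(\<integral>\<^sup>+x. ennreal ((\<rho> * symmetrization (Suc m) f x - symmetrization (Suc m) (\<lambda>x. ?h (x 0) * k (x \<circ> Suc)) x)\<^sup>2)
      \<partial>leb_pow (Suc m)) \<le> ?e1"
    using nn_integral_symmetrization_square_le[of "\<lambda>x. \<rho> * f x - ?h (x 0) * k (x \<circ> Suc)" "Suc m"]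
    by (simp add: symmetrization_diff symmetrization_scale)
  \<comment> \<open>\<open>G\<close> approximates the symmetrization of \<open>k\<close>, not
    \<open>k\<close> itself. Under the symmetrization over all \<open>Suc m\<close> coordinates this
    makes no difference, and the unit norm of the step function passes the error of \<open>G\<close>
    on without a further factor.\<close>
  have 2: "(\<integral>\<^sup>+x. ennreal ((symmetrization (Suc m) (\<lambda>x. ?h (x 0) * k (x \<circ> Suc)) x -
        symmetrization (Suc m) (elementary_fun F) x)\<^sup>2) \<partial>leb_pow (Suc m)) \<le> ?e2"
  proof -
    have "symmetrization (Suc m) (\<lambda>x. ?h (x 0) * k (x \<circ> Suc)) x - symmetrization (Suc m) (elementary_fun F) x =
      symmetrization (Suc m) (\<lambda>x. ?h (x 0) * (symmetrization m k (x \<circ> Suc) - elementary_fun G (x \<circ> Suc))) x" for x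
      unfolding JF symmetrization_tensor_symmetrization[of m ?h k] right_diff_distrib symmetrization_diff ..
    then have "(\<integral>\<^sup>+x. ennreal ((symmetrization (Suc m) (\<lambda>x. ?h (x 0) * k (x \<circ> Suc)) x -
        symmetrization (Suc m) (elementary_fun F) x)\<^sup>2) \<partial>leb_pow (Suc m)) \<le>
      (\<integral>\<^sup>+x. ennreal ((?h (x 0) * (symmetrization m k (x \<circ> Suc) - elementary_fun G (x \<circ> Suc)))\<^sup>2) \<partial>leb_pow (Suc m))"
      using nn_integral_symmetrization_square_le[OF hk(3)] by simp
    also have "\<dots> = (\<integral>\<^sup>+x. ennreal ((?h (x 0))\<^sup>2) * ennreal ((symmetrization m k (x \<circ> Suc) - elementary_fun G (x \<circ> Suc))\<^sup>2) \<partial>leb_pow (Suc m))"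
      by (simp add: power_mult_distrib ennreal_mult)
    also have "\<dots> = (\<integral>\<^sup>+y. ennreal ((?h y)\<^sup>2) \<partial>lborel) * (\<integral>\<^sup>+x. ennreal ((symmetrization m k x - elementary_fun G x)\<^sup>2) \<partial>leb_pow m)"
      by (rule nn_integral_head_tail[where g="\<lambda>x. ennreal ((symmetrization m k x - elementary_fun G x)\<^sup>2)"]) auto
    also have "\<dots> = ?e2"
      by (simp add: nn_integral_unit_step_square \<alpha> power2_commute[of "symmetrization m k _"])
    finally show ?thesis .
  qed
  have "(\<integral>\<^sup>+z. ennreal ((\<rho> * X z - elementary_int W G z * elementary_int W ?H z)\<^sup>2) \<partial>M) \<le>
      4 * fact (Suc m) * (\<integral>\<^sup>+x. ennreal ((\<rho> * symmetrization (Suc m) f x - symmetrization (Suc m) (elementary_fun F) x)\<^sup>2) \<partial>leb_pow (Suc m))"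
    using wiener_ito_elementary_distance[OF X Fs(1), of \<rho>] unfolding IF Fs(2) .
  also have "(\<integral>\<^sup>+x. ennreal ((\<rho> * symmetrization (Suc m) f x - symmetrization (Suc m) (elementary_fun F) x)\<^sup>2) \<partial>leb_pow (Suc m)) \<le>
     2 * (\<integral>\<^sup>+x. ennreal ((\<rho> * symmetrization (Suc m) f x - symmetrization (Suc m) (\<lambda>x. ?h (x 0) * k (x \<circ> Suc)) x)\<^sup>2) \<partial>leb_pow (Suc m)) +
     2 * (\<integral>\<^sup>+x. ennreal ((symmetrization (Suc m) (\<lambda>x. ?h (x 0) * k (x \<circ> Suc)) x - symmetrization (Suc m) (elementary_fun F) x)\<^sup>2) \<partial>leb_pow (Suc m))"
    unfolding JF by (intro nn_integral_square_diff_triangle) measurable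
  also have "\<dots> \<le> 2 * ?e1 + 2 * ?e2"
    using 1 2 by (intro add_mono mult_left_mono) auto
  finally have "(\<integral>\<^sup>+z. ennreal ((\<rho> * X z - elementary_int W G z * elementary_int W ?H z)\<^sup>2) \<partial>M) \<le>
      4 * fact (Suc m) * (2 * ?e1 + 2 * ?e2)"
    by (simp add: mult_left_mono)
  also have "\<dots> = 4 * fact (Suc m) * (2 * (?e1 + ?e2))"
    by (simp only: distrib_left)
  also have "\<dots> = (4 * 2) * fact (Suc m) * (?e1 + ?e2)"
    by (simp only: mult_ac)
  finally show ?thesis by simp
qed

text \<open>One step of the construction. The bounds \<open>n1\<close> and \<open>R1\<close> are
  left free so that the next block can be placed later in the sequence and further to the left. The
  step function \<open>G\<close> for \<open>Z'\<close> is fixed first, and \<open>R\<close> is then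
  taken beyond its leftmost grid point.\<close>

lemma rosenblatt_block:
  fixes g :: "nat \<Rightarrow> real" and Z :: "nat \<Rightarrow> 'a \<Rightarrow> real"
  assumes \<gamma>: "\<gamma>s \<in> Delta m" "m \<ge> 1" and g: "\<And>n. g n # \<gamma>s \<in> Delta (Suc m)" "g \<longlonglongrightarrow> - 1/2" and t: "t \<ge> 0"
    and A: "\<And>n. A n > 0" and Z: "\<And>n. has_wiener_ito M W (Suc m) (rosenblatt_kernel (A n) (g n # \<gamma>s) t) (Z n)"
    and A': "A' > 0" and Z': "has_wiener_ito M W m (rosenblatt_kernel A' \<gamma>s t) Z'"
    and \<epsilon>: "\<epsilon> > 0"
  shows "\<exists>n R2 H S \<rho>. n \<ge> n1 \<and> R1 \<le> R2 \<and> elementary 1 {- real R2..- real R1} H \<and>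
     distributed M lborel (elementary_int W H) std_normal_density \<and>
     S \<in> borel_measurable M \<and> indep_var borel S borel (elementary_int W H) \<and>
     (\<integral>\<^sup>+z. ennreal ((S z - Z' z)\<^sup>2) \<partial>M) \<le> ennreal \<epsilon> \<and> \<rho> > 0 \<and>
     (\<integral>\<^sup>+z. ennreal ((\<rho> * Z n z - S z * elementary_int W H z)\<^sup>2) \<partial>M) \<le> ennreal \<epsilon>"
proof -
  define f' where "f' = rosenblatt_kernel A' \<gamma>s t"
  \<comment> \<open>Collects the factor of the tensor bound and its two errors,
    \<open>A'\<^sup>2 * \<epsilon>'\<close> from the kernel and \<open>\<epsilon>'\<close> from
    \<open>G\<close>.\<close>
  define C where "C = 8 * fact (Suc m) * (A'\<^sup>2 + 1)"
  have C: "C > 0" unfolding C_def by (intro mult_pos_pos add_nonneg_pos) auto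
  define \<epsilon>' where "\<epsilon>' = min \<epsilon> (\<epsilon> / C)"
  have \<epsilon>': "\<epsilon>' > 0" "\<epsilon>' \<le> \<epsilon>" "C * \<epsilon>' \<le> \<epsilon>" using \<epsilon> C by (auto simp: \<epsilon>'_def min_def field_simps)
  from Z' obtain N :: "nat \<Rightarrow> nat" and u a where f'[measurable]: "f' \<in> borel_measurable (leb_pow m)"
    and u: "\<And>n. strict_mono_on {..N n} (u n)"
    and l1: "(\<lambda>n. \<integral>\<^sup>+ x. ennreal ((step_fun m (N n) (u n) (a n) x - symmetrization m f' x)\<^sup>2) \<partial>leb_pow m) \<longlonglongrightarrow> 0"
    and l2: "(\<lambda>n. \<integral>\<^sup>+ z. ennreal ((step_integral W m (N n) (u n) (a n) z - Z' z)\<^sup>2) \<partial>M) \<longlonglongrightarrow> 0"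
    unfolding has_wiener_ito_def f'_def by blast
  have "\<forall>\<^sub>F n in sequentially. (\<integral>\<^sup>+ x. ennreal ((step_fun m (N n) (u n) (a n) x - symmetrization m f' x)\<^sup>2) \<partial>leb_pow m) < ennreal \<epsilon>'"
    "\<forall>\<^sub>F n in sequentially. (\<integral>\<^sup>+ z. ennreal ((step_integral W m (N n) (u n) (a n) z - Z' z)\<^sup>2) \<partial>M) < ennreal \<epsilon>'"
    using l1 l2 \<epsilon>' by (auto intro!: order_tendstoD(2))
  from eventually_conj[OF this] obtain n0 where
    n0: "(\<integral>\<^sup>+ x. ennreal ((step_fun m (N n0) (u n0) (a n0) x - symmetrization m f' x)\<^sup>2) \<partial>leb_pow m) < ennreal \<epsilon>'"
      "(\<integral>\<^sup>+ z. ennreal ((step_integral W m (N n0) (u n0) (a n0) z - Z' z)\<^sup>2) \<partial>M) < ennreal \<epsilon>'"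
    by (auto dest: eventually_happens'[rotated])
  define G where "G = grid_functional m (N n0) (u n0) (a n0)"
  obtain R0 where R0: "real R0 \<ge> - u n0 0" using real_arch_simple by blast
  have G0: "elementary m {- real R0..} G"
  proof (rule elementary_mono)
    show "elementary m (u n0 ` {..N n0}) G" unfolding G_def by (rule elementary_grid_functional[OF u])
    show "u n0 ` {..N n0} \<subseteq> {- real R0..}"
    proof
      fix y assume "y \<in> u n0 ` {..N n0}"
      then obtain i where "i \<le> N n0" "y = u n0 i" by auto
      then have "u n0 0 \<le> y" using strict_mono_on_leD[OF u[of n0], of 0 i] by auto
      then show "y \<in> {- real R0..}" using R0 by auto
    qed
  qed
  have len: "length \<gamma>s = m" and c: "\<And>c. c \<in> set \<gamma>s \<Longrightarrow> -1 < c \<and> c < 0"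
    using \<gamma>(1) by (auto simp: Delta_def)
  have gb: "-1 < g n" "g n < - 1/2" for n using g(1)[of n] by (auto simp: Delta_def)
  have ne: "\<gamma>s \<noteq> []" using \<gamma>(2) len by auto
  have fin: "rosenblatt_kernel 1 (g n # \<gamma>s) t \<in> borel_measurable (leb_pow (Suc (length \<gamma>s)))"
    "(\<integral>\<^sup>+x. ennreal ((rosenblatt_kernel 1 (g n # \<gamma>s) t x)\<^sup>2) \<partial>leb_pow (Suc (length \<gamma>s))) < \<infinity>"
    "rosenblatt_kernel 1 \<gamma>s t \<in> borel_measurable (leb_pow (length \<gamma>s))"
    "(\<integral>\<^sup>+x. ennreal ((rosenblatt_kernel 1 \<gamma>s t x)\<^sup>2) \<partial>leb_pow (length \<gamma>s)) < \<infinity>" for n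
    using rosenblatt_kernel_measurable_finite[OF Z A] rosenblatt_kernel_measurable_finite[OF Z' A']
    unfolding len by blast+
  obtain n R P b \<alpha> where k: "n \<ge> n1" "R \<ge> max R0 R1" "P > 0" "b > 0" "\<forall>l. \<alpha> l \<noteq> 0" "(\<Sum>l<P. (\<alpha> l)\<^sup>2) = (1::real)"
    "(\<integral>\<^sup>+x. ennreal ((b * rosenblatt_kernel 1 (g n # \<gamma>s) t x -
        unit_step R P \<alpha> (x 0) * rosenblatt_kernel 1 \<gamma>s t (x \<circ> Suc))\<^sup>2) \<partial>leb_pow (Suc (length \<gamma>s))) \<le> ennreal \<epsilon>'"
    by (rule kernel_approximation[where ?n1.0=n1 and ?R1.0="max R0 R1", OF c ne gb g(2) t fin(1,2,3,4) \<epsilon>'(1)])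
  define H where "H = unit_step_functional R P \<alpha>"
  \<comment> \<open>The kernels have been compared with constant 1; this factor replaces
    \<open>A n\<close> by \<open>b\<close> and attaches the constant \<open>A'\<close> to the kernel
    of order \<open>m\<close>.\<close>
  define \<rho> where "\<rho> = A' * b / A n"
  have \<rho>: "\<rho> > 0" using A[of n] A' k(4) by (simp add: \<rho>_def)
  have G: "elementary m {- real R..} G" by (rule elementary_mono[OF G0]) (use k(2) in auto)
  have H: "elementary 1 {- real (R + P)..- real R} H" unfolding H_def by (rule elementary_unit_step_functional)
  let ?S = "elementary_int W G"
  have "elementary 1 {- real (R + P)..- real R1} H"
    by (rule elementary_mono[OF H]) (use k(2) in auto)
  moreover have "distributed M lborel (elementary_int W H) std_normal_density"
  proof -
    have "strict_mono_on {..P} (\<lambda>l. real l - real (R + P))" by (auto simp: strict_mono_on_def)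
    from distributed_weighted_increments[OF this k(3), of \<alpha>] k(5,6) show ?thesis
      by (simp add: H_def elementary_int_def[abs_def] unit_step_functional_def)
  qed
  moreover have "indep_var borel ?S borel (elementary_int W H)"
    by (rule indep_var_elementary_int[OF G elementary_mono[OF H]]) auto
  moreover have "(\<integral>\<^sup>+z. ennreal ((?S z - Z' z)\<^sup>2) \<partial>M) \<le> ennreal \<epsilon>"
    using n0(2) ennreal_leI[OF \<epsilon>'(2)] unfolding G_def step_integral_eq_grid_functional
    by (meson less_imp_le order_trans)
  moreover have "(\<integral>\<^sup>+z. ennreal ((\<rho> * Z n z - ?S z * elementary_int W H z)\<^sup>2) \<partial>M) \<le> ennreal \<epsilon>"
  proof -
    have eq: "\<rho> * rosenblatt_kernel (A n) (g n # \<gamma>s) t x - unit_step R P \<alpha> (x 0) * f' (x \<circ> Suc) =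
      A' * (b * rosenblatt_kernel 1 (g n # \<gamma>s) t x) - A' * (unit_step R P \<alpha> (x 0) * rosenblatt_kernel 1 \<gamma>s t (x \<circ> Suc))" for x
      using A[of n] by (simp add: \<rho>_def f'_def rosenblatt_kernel_scale[of "A n"] rosenblatt_kernel_scale[of A'])
    have m1: "(\<lambda>x. b * rosenblatt_kernel 1 (g n # \<gamma>s) t x) \<in> borel_measurable (leb_pow (Suc m))"
      using rosenblatt_kernel_measurable_finite(1)[OF Z A, of n] by measurable
    have m2: "(\<lambda>x. unit_step R P \<alpha> (x 0) * rosenblatt_kernel 1 \<gamma>s t (x \<circ> Suc)) \<in> borel_measurable (leb_pow (Suc m))"
      using measurable_compose[OF measurable_tail_coordinates rosenblatt_kernel_measurable_finite(1)[OF Z' A']] by measurable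
    have "(\<integral>\<^sup>+z. ennreal ((\<rho> * Z n z - ?S z * elementary_int W H z)\<^sup>2) \<partial>M) \<le>
      8 * fact (Suc m) * ((\<integral>\<^sup>+x. ennreal ((\<rho> * rosenblatt_kernel (A n) (g n # \<gamma>s) t x - unit_step R P \<alpha> (x 0) * f' (x \<circ> Suc))\<^sup>2) \<partial>leb_pow (Suc m)) +
      (\<integral>\<^sup>+x. ennreal ((elementary_fun G x - symmetrization m f' x)\<^sup>2) \<partial>leb_pow m))"
      unfolding H_def by (rule wiener_ito_tensor_distance[OF Z f' G k(6)])
    also have "\<dots> \<le> 8 * fact (Suc m) * (ennreal (A'\<^sup>2) * ennreal \<epsilon>' + ennreal \<epsilon>')"
    proof (intro mult_left_mono add_mono)
      show "(\<integral>\<^sup>+x. ennreal ((\<rho> * rosenblatt_kernel (A n) (g n # \<gamma>s) t x - unit_step R P \<alpha> (x 0) * f' (x \<circ> Suc))\<^sup>2) \<partial>leb_pow (Suc m))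
        \<le> ennreal (A'\<^sup>2) * ennreal \<epsilon>'"
        unfolding eq nn_integral_square_scaled_diff[OF m1 m2]
        using k(7) unfolding len by (intro mult_left_mono) auto
      show "(\<integral>\<^sup>+x. ennreal ((elementary_fun G x - symmetrization m f' x)\<^sup>2) \<partial>leb_pow m) \<le> ennreal \<epsilon>'"
        using n0(1) unfolding step_fun_eq_grid_functional[OF u] G_def by simp
    qed auto
    also have "\<dots> = ennreal (C * \<epsilon>')"
    proof -
      have "ennreal (A'\<^sup>2) * ennreal \<epsilon>' + ennreal \<epsilon>' = ennreal ((A'\<^sup>2 + 1) * \<epsilon>')"
        using \<epsilon>' by (simp add: distrib_right ennreal_mult')
      moreover have "8 * fact (Suc m) = ennreal (8 * fact (Suc m))"
        by (simp add: ennreal_mult' ennreal_fact del: fact_Suc)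
      ultimately show ?thesis
        using \<epsilon>' by (simp only: C_def mult.assoc) (simp add: ennreal_mult'[symmetric] del: fact_Suc)
    qed
    also have "\<dots> \<le> ennreal \<epsilon>" using \<epsilon>'(3) by (rule ennreal_leI)
    finally show ?thesis .
  qed
  moreover have "?S \<in> borel_measurable M" by (rule measurable_elementary_int[OF G])
  moreover have "R1 \<le> R + P" using k(2) by simp
  ultimately show ?thesis using k(1) \<rho> by blast
qed

end

section \<open>Normalizing factors and the choice of subsequences\<close>

lemma infinite_violation_subsequence:
  fixes a :: "nat \<Rightarrow> 'b::metric_space"
  assumes "\<not> a \<longlonglongrightarrow> L"
  obtains e r where "e > 0" "strict_mono (r :: nat \<Rightarrow> nat)" "\<forall>k. dist (a (r k)) L \<ge> e"
proof -
  obtain e where e: "e > 0" "\<not> (\<forall>\<^sub>F n in sequentially. dist (a n) L < e)"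
    using assms by (auto simp: tendsto_iff)
  then have "infinite {n. dist (a n) L \<ge> e}"
    unfolding eventually_sequentially infinite_nat_iff_unbounded_le by (auto simp: not_less)
  from infinite_enumerate[OF this] that e(1) show ?thesis by blast
qed

context prob_space
begin

lemma square_integrableI:
  assumes [measurable]: "f \<in> borel_measurable M" "g \<in> borel_measurable M"
    and g: "integrable M (\<lambda>z. (g z)\<^sup>2)" and "(\<integral>\<^sup>+z. ennreal ((f z - g z)\<^sup>2) \<partial>M) \<le> ennreal e"
  shows "integrable M (\<lambda>z. (f z)\<^sup>2)" "integrable M (\<lambda>z. (f z - g z)\<^sup>2)"
    "e \<ge> 0 \<Longrightarrow> expectation (\<lambda>z. (f z - g z)\<^sup>2) \<le> e"
proof -
  show int: "integrable M (\<lambda>z. (f z - g z)\<^sup>2)"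
    using le_less_trans[OF assms(4) ennreal_less_top] by (intro integrableI_bounded) simp_all
  then show "e \<ge> 0 \<Longrightarrow> expectation (\<lambda>z. (f z - g z)\<^sup>2) \<le> e"
    using assms(4) nn_integral_eq_integral[OF int] by simp
  have "(f z)\<^sup>2 \<le> 2 * (f z - g z)\<^sup>2 + 2 * (g z)\<^sup>2" for z
    using zero_le_power2[of "f z - 2 * g z"] by (simp add: power2_eq_square algebra_simps)
  then have bd: "norm ((f z)\<^sup>2) \<le> norm (2 * (f z - g z)\<^sup>2 + 2 * (g z)\<^sup>2)" for z
    by (metis abs_ge_self order_trans real_norm_def abs_power2)
  show "integrable M (\<lambda>z. (f z)\<^sup>2)"
  proof (rule Bochner_Integration.integrable_bound)
    show "integrable M (\<lambda>z. 2 * (f z - g z)\<^sup>2 + 2 * (g z)\<^sup>2)"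
      using int g by (intro Bochner_Integration.integrable_add integrable_mult_right)
    show "AE z in M. norm ((f z)\<^sup>2) \<le> norm (2 * (f z - g z)\<^sup>2 + 2 * (g z)\<^sup>2)"
      using bd by (intro AE_I2)
  qed measurable
qed

lemma expectation_abs_le_sqrt:
  assumes [measurable]: "f \<in> borel_measurable M" and "integrable M (\<lambda>z. (f z)\<^sup>2)"
  shows "integrable M f" "expectation (\<lambda>z. \<bar>f z\<bar>) \<le> sqrt (expectation (\<lambda>z. (f z)\<^sup>2))"
proof -
  note CS = integral_Cauchy_Schwarz[OF assms(1), of "\<lambda>_. 1", OF _ assms(2)]
  show "integrable M f" using CS(1) by simp
  have "(expectation (\<lambda>z. \<bar>f z\<bar>))\<^sup>2 \<le> expectation (\<lambda>z. (f z)\<^sup>2)" using CS(2) by (simp add: prob_space)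
  then show "expectation (\<lambda>z. \<bar>f z\<bar>) \<le> sqrt (expectation (\<lambda>z. (f z)\<^sup>2))" by (rule real_le_rsqrt)
qed

text \<open>After expanding the square around \<open>g k\<close>, the cross term is controlled by
  Cauchy-Schwarz, since the second moments of \<open>g k\<close> converge.\<close>

lemma second_moment_tendsto:
  fixes f g :: "nat \<Rightarrow> 'a \<Rightarrow> real"
  assumes [measurable]: "\<And>k. f k \<in> borel_measurable M" "\<And>k. g k \<in> borel_measurable M"
    and g2: "\<And>k. integrable M (\<lambda>z. (g k z)\<^sup>2)" and d2: "\<And>k. integrable M (\<lambda>z. (f k z - g k z)\<^sup>2)"
    and lim: "(\<lambda>k. expectation (\<lambda>z. (g k z)\<^sup>2)) \<longlonglongrightarrow> c"
    and d: "(\<lambda>k. expectation (\<lambda>z. (f k z - g k z)\<^sup>2)) \<longlonglongrightarrow> 0"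
  shows "(\<lambda>k. expectation (\<lambda>z. (f k z)\<^sup>2)) \<longlonglongrightarrow> c"
proof -
  define x where "x k = expectation (\<lambda>z. g k z * (f k z - g k z))" for k
  have CS: "integrable M (\<lambda>z. g k z * (f k z - g k z))"
    "(expectation (\<lambda>z. \<bar>g k z * (f k z - g k z)\<bar>))\<^sup>2 \<le> expectation (\<lambda>z. (g k z)\<^sup>2) * expectation (\<lambda>z. (f k z - g k z)\<^sup>2)" for k
    using integral_Cauchy_Schwarz[of "g k" M "\<lambda>z. f k z - g k z"] g2 d2 by auto
  have "\<bar>x k\<bar> \<le> sqrt (expectation (\<lambda>z. (g k z)\<^sup>2) * expectation (\<lambda>z. (f k z - g k z)\<^sup>2))" for k
    unfolding x_def using integral_abs_bound[of M "\<lambda>z. g k z * (f k z - g k z)"] real_le_rsqrt[OF CS(2)[of k]] by linarith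
  moreover have "(\<lambda>k. sqrt (expectation (\<lambda>z. (g k z)\<^sup>2) * expectation (\<lambda>z. (f k z - g k z)\<^sup>2))) \<longlonglongrightarrow> sqrt (c * 0)"
    by (intro tendsto_intros lim d)
  ultimately have x: "x \<longlonglongrightarrow> 0"
    by (intro Lim_null_comparison[of x]) (auto intro: always_eventually)
  have "expectation (\<lambda>z. (f k z)\<^sup>2) = expectation (\<lambda>z. (g k z)\<^sup>2) + 2 * x k + expectation (\<lambda>z. (f k z - g k z)\<^sup>2)" for k
  proof -
    have "(\<lambda>z. (f k z)\<^sup>2) = (\<lambda>z. (g k z)\<^sup>2 + 2 * (g k z * (f k z - g k z)) + (f k z - g k z)\<^sup>2)"
      by (simp add: fun_eq_iff power2_eq_square algebra_simps)
    then show ?thesis using g2[of k] d2[of k] CS(1)[of k] by (simp add: x_def)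
  qed
  moreover have "(\<lambda>k. expectation (\<lambda>z. (g k z)\<^sup>2) + 2 * x k + expectation (\<lambda>z. (f k z - g k z)\<^sup>2)) \<longlonglongrightarrow> c + 2 * 0 + 0"
    by (intro tendsto_intros lim d x)
  ultimately show ?thesis by simp
qed

lemma indep_second_moment_product:
  assumes ind: "indep_var borel S borel \<eta>" and S: "integrable M (\<lambda>z. (S z)\<^sup>2)"
    and \<eta>: "distributed M lborel \<eta> std_normal_density"
  shows "integrable M (\<lambda>z. (S z * \<eta> z)\<^sup>2)"
    "expectation (\<lambda>z. (S z * \<eta> z)\<^sup>2) = expectation (\<lambda>z. (S z)\<^sup>2)"
proof -
  from indep_var_compose[OF ind, of "\<lambda>x. x\<^sup>2" borel "\<lambda>x. x\<^sup>2" borel]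
  have ind2: "indep_var borel (\<lambda>z. (S z)\<^sup>2) borel (\<lambda>z. (\<eta> z)\<^sup>2)" by (simp add: o_def)
  note mom = std_normal_second_moment[OF \<eta>]
  show "integrable M (\<lambda>z. (S z * \<eta> z)\<^sup>2)"
    using indep_var_integrable[OF ind2 S mom(1)] by (simp add: power_mult_distrib)
  show "expectation (\<lambda>z. (S z * \<eta> z)\<^sup>2) = expectation (\<lambda>z. (S z)\<^sup>2)"
    using indep_var_lebesgue_integral[OF ind2 S mom(1)] mom(2) by (simp add: power_mult_distrib)
qed

text \<open>The normalizing constants are not computed: since \<^term>\<open>S k * \<eta> k\<close> has the second moment of
  \<^term>\<open>S k\<close>, the prescribed second moments force the factors \<^term>\<open>\<rho> k\<close> to converge to 1.\<close>

lemma scaled_product_approximation: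
  fixes X S \<eta> :: "nat \<Rightarrow> 'a \<Rightarrow> real" and \<rho> p :: "nat \<Rightarrow> real"
  assumes [measurable]: "\<And>k. X k \<in> borel_measurable M" "\<And>k. S k \<in> borel_measurable M" "Z \<in> borel_measurable M"
    and X2: "\<And>k. integrable M (\<lambda>z. (X k z)\<^sup>2)" and Z2: "integrable M (\<lambda>z. (Z z)\<^sup>2)"
    and \<eta>: "\<And>k. distributed M lborel (\<eta> k) std_normal_density"
    and ind: "\<And>k. indep_var borel (S k) borel (\<eta> k)"
    and \<rho>: "\<And>k. \<rho> k > 0"
    and SZ: "\<And>k. (\<integral>\<^sup>+z. ennreal ((S k z - Z z)\<^sup>2) \<partial>M) \<le> ennreal (1 / real (Suc k))"
    and XS: "\<And>k. (\<integral>\<^sup>+z. ennreal ((\<rho> k * X k z - S k z * \<eta> k z)\<^sup>2) \<partial>M) \<le> ennreal (1 / real (Suc k))"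
    and lim: "(\<lambda>k. expectation (\<lambda>z. (X k z)\<^sup>2)) \<longlonglongrightarrow> expectation (\<lambda>z. (Z z)\<^sup>2)"
    and pos: "expectation (\<lambda>z. (Z z)\<^sup>2) > 0"
  shows "(\<lambda>k. \<integral>\<^sup>+z. ennreal \<bar>X k z - Z z * \<eta> k z\<bar> \<partial>M) \<longlonglongrightarrow> 0"
proof -
  have [measurable]: "\<eta> k \<in> borel_measurable M" for k
    using distributed_measurable[OF \<eta>] by simp
  define c where "c = expectation (\<lambda>z. (Z z)\<^sup>2)"
  have null: "(\<lambda>k. 1 / real (Suc k)) \<longlonglongrightarrow> 0" by (rule LIMSEQ_Suc[OF lim_const_over_n])
  note S2 = square_integrableI[OF _ _ Z2 SZ]
  note prod2 = indep_second_moment_product[OF ind S2(1) \<eta>]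
  note X2' = square_integrableI[OF _ _ prod2(1) XS]
  have dS: "(\<lambda>k. expectation (\<lambda>z. (S k z - Z z)\<^sup>2)) \<longlonglongrightarrow> 0"
    by (rule tendsto_sandwich[OF _ _ tendsto_const null]) (use S2(3) in auto)
  have dX: "(\<lambda>k. expectation (\<lambda>z. (\<rho> k * X k z - S k z * \<eta> k z)\<^sup>2)) \<longlonglongrightarrow> 0"
    by (rule tendsto_sandwich[OF _ _ tendsto_const null]) (use X2'(3) in auto)
  \<comment> \<open>The value \<open>c\<close> is carried from \<open>Z\<close> to
    \<open>S k\<close>, then to \<open>S k * \<eta> k\<close>, then to
    \<open>\<rho> k * X k\<close>. As the second moments of \<open>X k\<close> also tend to
    \<open>c\<close>, the limit of \<open>(\<rho> k)\<^sup>2\<close> is determined.\<close>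
  have "(\<lambda>k. expectation (\<lambda>z. (S k z)\<^sup>2)) \<longlonglongrightarrow> c"
    by (rule second_moment_tendsto[where g="\<lambda>_. Z"]) (use Z2 S2(2) dS c_def in auto)
  then have "(\<lambda>k. expectation (\<lambda>z. (S k z * \<eta> k z)\<^sup>2)) \<longlonglongrightarrow> c" by (simp add: prod2(2))
  then have "(\<lambda>k. expectation (\<lambda>z. (\<rho> k * X k z)\<^sup>2)) \<longlonglongrightarrow> c"
    by (rule second_moment_tendsto[rotated 4]) (use prod2(1) X2'(2) dX in auto)
  then have "(\<lambda>k. (\<rho> k)\<^sup>2 * expectation (\<lambda>z. (X k z)\<^sup>2)) \<longlonglongrightarrow> c"
    by (simp add: power_mult_distrib)
  then have "(\<lambda>k. (\<rho> k)\<^sup>2 * expectation (\<lambda>z. (X k z)\<^sup>2) / expectation (\<lambda>z. (X k z)\<^sup>2)) \<longlonglongrightarrow> c / c"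
    using lim pos by (intro tendsto_divide) (auto simp: c_def)
  moreover have "\<forall>\<^sub>F k in sequentially. expectation (\<lambda>z. (X k z)\<^sup>2) > 0"
    using order_tendstoD(1)[OF lim pos] .
  then have "\<forall>\<^sub>F k in sequentially. (\<rho> k)\<^sup>2 * expectation (\<lambda>z. (X k z)\<^sup>2) / expectation (\<lambda>z. (X k z)\<^sup>2) = (\<rho> k)\<^sup>2"
    by eventually_elim simp
  ultimately have "(\<lambda>k. (\<rho> k)\<^sup>2) \<longlonglongrightarrow> c / c" by (rule Lim_transform_eventually)
  then have "(\<lambda>k. sqrt ((\<rho> k)\<^sup>2)) \<longlonglongrightarrow> sqrt 1" using pos by (intro tendsto_real_sqrt) (simp add: c_def)
  then have \<rho>1: "\<rho> \<longlonglongrightarrow> 1" using \<rho> by (simp add: less_imp_le)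
  have bound: "(\<integral>\<^sup>+z. ennreal \<bar>X k z - Z z * \<eta> k z\<bar> \<partial>M) \<le>
     ennreal (\<bar>1 - \<rho> k\<bar> * sqrt (expectation (\<lambda>z. (X k z)\<^sup>2)) + sqrt (expectation (\<lambda>z. (\<rho> k * X k z - S k z * \<eta> k z)\<^sup>2)) +
       sqrt (expectation (\<lambda>z. (S k z - Z z)\<^sup>2)))" for k
  proof -
    have i1: "integrable M (X k)" "expectation (\<lambda>z. \<bar>X k z\<bar>) \<le> sqrt (expectation (\<lambda>z. (X k z)\<^sup>2))"
      using expectation_abs_le_sqrt[of "X k"] X2 by auto
    have i2: "integrable M (\<lambda>z. \<rho> k * X k z - S k z * \<eta> k z)"
      "expectation (\<lambda>z. \<bar>\<rho> k * X k z - S k z * \<eta> k z\<bar>) \<le> sqrt (expectation (\<lambda>z. (\<rho> k * X k z - S k z * \<eta> k z)\<^sup>2))"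
      using expectation_abs_le_sqrt[of "\<lambda>z. \<rho> k * X k z - S k z * \<eta> k z"] X2'(2)[of k] by auto
    have i3: "integrable M (\<lambda>z. (S k z - Z z) * \<eta> k z)"
      "(expectation (\<lambda>z. \<bar>(S k z - Z z) * \<eta> k z\<bar>))\<^sup>2 \<le> expectation (\<lambda>z. (S k z - Z z)\<^sup>2)"
      using integral_Cauchy_Schwarz[of "\<lambda>z. S k z - Z z" M "\<eta> k"] S2(2)[of k] std_normal_second_moment[OF \<eta>[of k]] by auto
    have i3': "expectation (\<lambda>z. \<bar>(S k z - Z z) * \<eta> k z\<bar>) \<le> sqrt (expectation (\<lambda>z. (S k z - Z z)\<^sup>2))"
      using i3(2) by (rule real_le_rsqrt)
    have tri: "\<bar>a + b + c\<bar> \<le> \<bar>a\<bar> + \<bar>b\<bar> + \<bar>c\<bar>" for a b c :: real by arith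
    \<comment> \<open>The three errors come from the normalization, from the approximation by a
      product, and from replacing \<open>S k\<close> by \<open>Z\<close>. The first vanishes because
      \<open>\<rho>\<close> tends to 1; the last is bounded using the second moment 1 of
      \<open>\<eta> k\<close>.\<close>
    have eq: "X k z - Z z * \<eta> k z = (1 - \<rho> k) * X k z + (\<rho> k * X k z - S k z * \<eta> k z) + (S k z - Z z) * \<eta> k z" for z
      by (simp add: algebra_simps)
    have "\<bar>X k z - Z z * \<eta> k z\<bar> \<le> \<bar>1 - \<rho> k\<bar> * \<bar>X k z\<bar> + \<bar>\<rho> k * X k z - S k z * \<eta> k z\<bar> + \<bar>(S k z - Z z) * \<eta> k z\<bar>" for z
      unfolding eq using tri[of "(1 - \<rho> k) * X k z"] by (simp only: abs_mult[of "1 - \<rho> k" "X k z"])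
    then have "(\<integral>\<^sup>+z. ennreal \<bar>X k z - Z z * \<eta> k z\<bar> \<partial>M) \<le>
      (\<integral>\<^sup>+z. ennreal (\<bar>1 - \<rho> k\<bar> * \<bar>X k z\<bar> + \<bar>\<rho> k * X k z - S k z * \<eta> k z\<bar> + \<bar>(S k z - Z z) * \<eta> k z\<bar>) \<partial>M)"
      by (intro nn_integral_mono ennreal_leI)
    also have "\<dots> = ennreal (expectation (\<lambda>z. \<bar>1 - \<rho> k\<bar> * \<bar>X k z\<bar> + \<bar>\<rho> k * X k z - S k z * \<eta> k z\<bar> + \<bar>(S k z - Z z) * \<eta> k z\<bar>))"
      using i1(1) i2(1) i3(1)
      by (intro nn_integral_eq_integral Bochner_Integration.integrable_add integrable_mult_right integrable_abs) auto
    also have "expectation (\<lambda>z. \<bar>1 - \<rho> k\<bar> * \<bar>X k z\<bar> + \<bar>\<rho> k * X k z - S k z * \<eta> k z\<bar> + \<bar>(S k z - Z z) * \<eta> k z\<bar>) =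
       \<bar>1 - \<rho> k\<bar> * expectation (\<lambda>z. \<bar>X k z\<bar>) + expectation (\<lambda>z. \<bar>\<rho> k * X k z - S k z * \<eta> k z\<bar>) + expectation (\<lambda>z. \<bar>(S k z - Z z) * \<eta> k z\<bar>)"
      using integrable_abs[OF i1(1)] integrable_abs[OF i2(1)] integrable_abs[OF i3(1)] by simp
    also have "\<dots> \<le> \<bar>1 - \<rho> k\<bar> * sqrt (expectation (\<lambda>z. (X k z)\<^sup>2)) + sqrt (expectation (\<lambda>z. (\<rho> k * X k z - S k z * \<eta> k z)\<^sup>2)) +
       sqrt (expectation (\<lambda>z. (S k z - Z z)\<^sup>2))"
      using i1(2) i2(2) i3' by (intro add_mono mult_left_mono) auto
    finally show ?thesis by (simp add: ennreal_leI)
  qed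
  have "(\<lambda>k. \<bar>1 - \<rho> k\<bar> * sqrt (expectation (\<lambda>z. (X k z)\<^sup>2)) + sqrt (expectation (\<lambda>z. (\<rho> k * X k z - S k z * \<eta> k z)\<^sup>2)) +
       sqrt (expectation (\<lambda>z. (S k z - Z z)\<^sup>2))) \<longlonglongrightarrow> \<bar>1 - 1\<bar> * sqrt c + sqrt 0 + sqrt 0"
    unfolding c_def by (intro tendsto_intros \<rho>1 lim dX dS)
  then have "(\<lambda>k. ennreal (\<bar>1 - \<rho> k\<bar> * sqrt (expectation (\<lambda>z. (X k z)\<^sup>2)) + sqrt (expectation (\<lambda>z. (\<rho> k * X k z - S k z * \<eta> k z)\<^sup>2)) +
       sqrt (expectation (\<lambda>z. (S k z - Z z)\<^sup>2)))) \<longlonglongrightarrow> ennreal 0"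
    by (intro tendsto_ennrealI) simp
  then have lim0: "(\<lambda>k. ennreal (\<bar>1 - \<rho> k\<bar> * sqrt (expectation (\<lambda>z. (X k z)\<^sup>2)) + sqrt (expectation (\<lambda>z. (\<rho> k * X k z - S k z * \<eta> k z)\<^sup>2)) +
       sqrt (expectation (\<lambda>z. (S k z - Z z)\<^sup>2)))) \<longlonglongrightarrow> 0" by simp
  show ?thesis
    by (rule tendsto_sandwich[OF _ _ tendsto_const lim0]) (use bound in auto)
qed

end

context brownian_motion
begin

text \<open>Blocks are chosen recursively, each later in the sequence and further to the left than
  the preceding one. Increasing indices give the subsequence, separated supports give independence,
  and the tolerances \<open>1 / real (Suc k)\<close> send the errors to 0.\<close>

lemma rosenblatt_subsequence:
  fixes g :: "nat \<Rightarrow> real" and Z :: "nat \<Rightarrow> 'a \<Rightarrow> real"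
  assumes \<gamma>: "\<gamma>s \<in> Delta m" "m \<ge> 1" and g: "\<And>n. g n # \<gamma>s \<in> Delta (Suc m)" "g \<longlonglongrightarrow> - 1/2" and t: "t \<ge> 0"
    and A: "\<And>n. A n > 0" and Z: "\<And>n. has_wiener_ito M W (Suc m) (rosenblatt_kernel (A n) (g n # \<gamma>s) t) (Z n)"
    and EZ: "\<And>n. expectation (\<lambda>z. (Z n z)\<^sup>2) = t powr (2 * sum_list (g n # \<gamma>s) + 2 + real (Suc m))"
    and A': "A' > 0" and Z': "has_wiener_ito M W m (rosenblatt_kernel A' \<gamma>s t) Z'"
    and EZ': "expectation (\<lambda>z. (Z' z)\<^sup>2) = t powr (2 * sum_list \<gamma>s + 2 + real m)"
  obtains r \<eta> where "strict_mono (r :: nat \<Rightarrow> nat)" "\<And>k. distributed M lborel (\<eta> k) std_normal_density"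
    "\<And>i j. i < j \<Longrightarrow> indep_var borel (\<eta> i) borel (\<eta> j)"
    "(\<lambda>k. \<integral>\<^sup>+z. ennreal \<bar>Z (r k) z - Z' z * \<eta> k z\<bar> \<partial>M) \<longlonglongrightarrow> 0"
proof -
  \<comment> \<open>Bundles the data of a block into one tuple for dependent choice; the bounds
    \<open>n1\<close> and \<open>R1\<close> will be supplied by the preceding block.\<close>
  define blk where "blk n1 R1 e = (\<lambda>(n, R2, H, S, \<rho>). n \<ge> (n1::nat) \<and> R1 \<le> R2 \<and> elementary 1 {- real R2..- real R1} H \<and>
     distributed M lborel (elementary_int W H) std_normal_density \<and>
     S \<in> borel_measurable M \<and> indep_var borel S borel (elementary_int W H) \<and>
     (\<integral>\<^sup>+z. ennreal ((S z - Z' z)\<^sup>2) \<partial>M) \<le> ennreal e \<and> \<rho> > 0 \<and>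
     (\<integral>\<^sup>+z. ennreal ((\<rho> * Z n z - S z * elementary_int W H z)\<^sup>2) \<partial>M) \<le> ennreal e)" for n1 R1 e
  have ex: "\<exists>s. blk n1 R1 e s" if "e > 0" for n1 R1 e
    using rosenblatt_block[OF \<gamma> g t A Z A' Z' that, of n1 R1] unfolding blk_def by auto
  have pos: "1 / real (Suc k) > 0" for k by simp
  have "\<exists>f. \<forall>k. (\<exists>n1 R1. blk n1 R1 (1 / real (Suc k)) (f k)) \<and>
      blk (Suc (fst (f k))) (fst (snd (f k))) (1 / real (Suc (Suc k))) (f (Suc k))"
  proof (rule dependent_nat_choice)
    show "\<exists>s. \<exists>n1 R1. blk n1 R1 (1 / real (Suc 0)) s" using ex[OF pos[of 0]] by blast
  next
    fix s k
    show "\<exists>s'. (\<exists>n1 R1. blk n1 R1 (1 / real (Suc (Suc k))) s') \<and> blk (Suc (fst s)) (fst (snd s)) (1 / real (Suc (Suc k))) s'"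
      using ex[OF pos[of "Suc k"]] by blast
  qed
  then obtain f where f: "\<And>k. \<exists>n1 R1. blk n1 R1 (1 / real (Suc k)) (f k)"
    "\<And>k. blk (Suc (fst (f k))) (fst (snd (f k))) (1 / real (Suc (Suc k))) (f (Suc k))" by blast
  define r where "r k = fst (f k)" for k
  define R where "R k = fst (snd (f k))" for k
  define H where "H k = fst (snd (snd (f k)))" for k
  define S where "S k = fst (snd (snd (snd (f k))))" for k
  define \<rho> where "\<rho> k = snd (snd (snd (snd (f k))))" for k
  define \<eta> where "\<eta> k = elementary_int W (H k)" for k
  have fk: "f k = (r k, R k, H k, S k, \<rho> k)" for k by (simp add: r_def R_def H_def S_def \<rho>_def)
  have props: "distributed M lborel (\<eta> k) std_normal_density" "S k \<in> borel_measurable M"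
     "indep_var borel (S k) borel (\<eta> k)" "(\<integral>\<^sup>+z. ennreal ((S k z - Z' z)\<^sup>2) \<partial>M) \<le> ennreal (1 / real (Suc k))" "\<rho> k > 0"
     "(\<integral>\<^sup>+z. ennreal ((\<rho> k * Z (r k) z - S k z * \<eta> k z)\<^sup>2) \<partial>M) \<le> ennreal (1 / real (Suc k))"
     "\<exists>R1. elementary 1 {- real (R k)..- real R1} (H k)" for k
    using f(1)[of k] unfolding fk blk_def \<eta>_def by auto
  have step: "r (Suc k) \<ge> Suc (r k)" "R k \<le> R (Suc k)" "elementary 1 {- real (R (Suc k))..- real (R k)} (H (Suc k))" for k
    using f(2)[of k] unfolding fk blk_def by auto
  have r: "strict_mono r" using step(1) by (auto simp: strict_mono_Suc_iff Suc_le_eq)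
  have Rmono: "R i \<le> R j" if "i \<le> j" for i j using lift_Suc_mono_le[of R, OF step(2) that] .
  \<comment> \<open>The endpoints of \<open>H i\<close> are at least \<open>- real (R i)\<close>,
    and those of \<open>H j\<close> are at most \<open>- real (R j')\<close> with
    \<open>i \<le> j'\<close>. Hence \<open>- real (R i)\<close> separates them.\<close>
  have ind: "indep_var borel (\<eta> i) borel (\<eta> j)" if ij: "i < j" for i j
  proof -
    obtain j' where j': "j = Suc j'" using ij by (cases j) auto
    obtain R1 where "elementary 1 {- real (R i)..- real R1} (H i)" using props(7) by blast
    then have "elementary 1 {- real (R i)..} (H i)" by (rule elementary_mono) auto
    moreover have "elementary 1 {..- real (R i)} (H j)"
      using step(3)[of j'] Rmono[of i j'] ij unfolding j' by (elim elementary_mono) auto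
    ultimately show ?thesis unfolding \<eta>_def by (rule indep_var_elementary_int)
  qed
  have [measurable]: "Z n \<in> borel_measurable M" "Z' \<in> borel_measurable M" for n
    using Z Z' by (auto simp: has_wiener_ito_def)
  have Z2: "integrable M (\<lambda>z. (Z n z)\<^sup>2)" "integrable M (\<lambda>z. (Z' z)\<^sup>2)" for n
    using wiener_ito_square_integrable[OF Z] wiener_ito_square_integrable[OF Z'] by auto
  have "(\<lambda>k. \<integral>\<^sup>+z. ennreal \<bar>Z (r k) z - Z' z * \<eta> k z\<bar> \<partial>M) \<longlonglongrightarrow> 0"
  \<comment> \<open>At \<open>t = 0\<close> the second moments are 0, as
    \<open>0 powr a = 0\<close>, and the factors \<open>\<rho> k\<close> could not be determined by
    division. All variables are then almost surely 0.\<close>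
  proof (cases "t = 0")
    case True
    have nz: "AE z in M. Z n z = 0" for n
      using EZ[of n] True integral_nonneg_eq_0_iff_AE[OF Z2(1)[of n]] by simp
    have nz': "AE z in M. Z' z = 0"
      using EZ' True integral_nonneg_eq_0_iff_AE[OF Z2(2)] by simp
    have "AE z in M. ennreal \<bar>Z (r k) z - Z' z * \<eta> k z\<bar> = 0" for k
      using nz[of "r k"] nz' by eventually_elim simp
    then have "(\<integral>\<^sup>+z. ennreal \<bar>Z (r k) z - Z' z * \<eta> k z\<bar> \<partial>M) = (\<integral>\<^sup>+z. 0 \<partial>M)" for k
      by (rule nn_integral_cong_AE)
    then show ?thesis by simp
  next
    case False
    then have t0: "t > 0" using t by simp
    have gr: "(\<lambda>k. g (r k)) \<longlonglongrightarrow> - 1/2"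
      using LIMSEQ_subseq_LIMSEQ[OF g(2) r] by (simp add: o_def)
    \<comment> \<open>In the limit the first exponent contributes \<open>2 * (- 1/2)\<close>, which
      cancels the extra dimension; the prescribed second moments of order \<open>Suc m\<close> thus
      tend to the one of order \<open>m\<close>.\<close>
    have "(\<lambda>k. t powr (2 * sum_list (g (r k) # \<gamma>s) + 2 + real (Suc m))) \<longlonglongrightarrow>
        t powr (2 * (- 1/2 + sum_list \<gamma>s) + 2 + real (Suc m))"
      unfolding sum_list.Cons using t0 by (intro tendsto_intros gr) auto
    also have "2 * (- 1/2 + sum_list \<gamma>s) + 2 + real (Suc m) = 2 * sum_list \<gamma>s + 2 + real m" by simp
    finally have lim: "(\<lambda>k. expectation (\<lambda>z. (Z (r k) z)\<^sup>2)) \<longlonglongrightarrow> expectation (\<lambda>z. (Z' z)\<^sup>2)"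
      unfolding EZ EZ' .
    show ?thesis
      by (rule scaled_product_approximation[OF _ props(2) _ _ _ props(1,3,5,4,6) lim])
        (use Z2 EZ' t0 in auto)
  qed
  with r props(1) ind show ?thesis by (rule that)
qed

end

theorem theorem4p4:
  fixes M :: "'a measure" and W :: "real \<Rightarrow> 'a \<Rightarrow> real" and q :: nat
    and \<gamma>s :: "real list" and t :: real
    and Z :: "real list \<Rightarrow> real \<Rightarrow> 'a \<Rightarrow> real" and g :: "nat \<Rightarrow> real"
  assumes "q \<ge> 2"
    and "two_sided_brownian_motion M W"
    and "\<And>\<gamma>. \<gamma> \<in> Delta q \<Longrightarrow> generalized_rosenblatt M W \<gamma> (Z \<gamma>)"
    and "\<gamma>s \<in> Delta (q - 1)"
    and "generalized_rosenblatt M W \<gamma>s (Z \<gamma>s)"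
    and "t \<ge> 0"
    and "\<And>n. g n # \<gamma>s \<in> Delta q"
    and "g \<longlonglongrightarrow> - 1/2"
  shows "stable_conv_mixed_normal M (\<lambda>n. Z (g n # \<gamma>s) t) (Z \<gamma>s t)"
proof -
  interpret prob_space M using assms(2) by (simp add: two_sided_brownian_motion_def)
  interpret brownian_motion M W by unfold_locales (rule assms(2))
  define m where "m = q - 1"
  have m: "m \<ge> 1" "q = Suc m" using assms(1) by (auto simp: m_def)
  have len: "length \<gamma>s = m" "length (g n # \<gamma>s) = Suc m" for n
    using assms(4) by (auto simp: Delta_def m_def)
  obtain A' where A': "A' > 0" "has_wiener_ito M W m (rosenblatt_kernel A' \<gamma>s t) (Z \<gamma>s t)"
    "expectation (\<lambda>z. (Z \<gamma>s t z)\<^sup>2) = t powr (2 * sum_list \<gamma>s + 2 + real m)"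
    using assms(5,6) len(1) unfolding generalized_rosenblatt_def by auto
  have "\<exists>A>0. has_wiener_ito M W (Suc m) (rosenblatt_kernel A (g n # \<gamma>s) t) (Z (g n # \<gamma>s) t) \<and>
      expectation (\<lambda>z. (Z (g n # \<gamma>s) t z)\<^sup>2) = t powr (2 * sum_list (g n # \<gamma>s) + 2 + real (Suc m))" for n
    using assms(3)[OF assms(7)[of n]] assms(6) len(2)[of n] unfolding generalized_rosenblatt_def by metis
  then obtain A where A: "\<And>n. A n > 0"
    "\<And>n. has_wiener_ito M W (Suc m) (rosenblatt_kernel (A n) (g n # \<gamma>s) t) (Z (g n # \<gamma>s) t)"
    "\<And>n. expectation (\<lambda>z. (Z (g n # \<gamma>s) t z)\<^sup>2) = t powr (2 * sum_list (g n # \<gamma>s) + 2 + real (Suc m))" by metis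
  have meas: "Z \<gamma>s t \<in> borel_measurable M" "Z (g n # \<gamma>s) t \<in> borel_measurable M" for n
    using A'(2) A(2)[of n] by (auto simp: has_wiener_ito_def)
  show ?thesis
  proof (rule stable_conv_mixed_normalI[OF meas])
    fix l C :: real and Y :: "'a \<Rightarrow> real"
    assume Y: "Y \<in> borel_measurable M" "\<And>z. z \<in> space M \<Longrightarrow> \<bar>Y z\<bar> \<le> C"
    let ?a = "\<lambda>n. LINT z|M. complex_of_real (Y z) * iexp (l * Z (g n # \<gamma>s) t z)"
    let ?L = "complex_of_real (expectation (\<lambda>z. Y z * exp (- ((l * Z \<gamma>s t z)\<^sup>2) / 2)))"
    show "?a \<longlonglongrightarrow> ?L"
    \<comment> \<open>Only subsequences are under control. A failure of convergence would keep some
      subsequence at distance at least \<open>e\<close> from \<open>?L\<close>; the block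
      construction applies to that subsequence and yields a further one along which mixing gives the
      limit \<open>?L\<close>.\<close>
    proof (rule ccontr)
      assume "\<not> ?a \<longlonglongrightarrow> ?L"
      then obtain e r where r: "e > 0" "strict_mono (r :: nat \<Rightarrow> nat)" "\<forall>k. dist (?a (r k)) ?L \<ge> e"
        by (rule infinite_violation_subsequence)
      have g': "(\<lambda>k. g (r k)) \<longlonglongrightarrow> - 1/2"
        using LIMSEQ_subseq_LIMSEQ[OF assms(8) r(2)] by (simp add: o_def)
      obtain r' \<eta> where r': "strict_mono (r' :: nat \<Rightarrow> nat)" "\<And>k. distributed M lborel (\<eta> k) std_normal_density"
        "\<And>i j. i < j \<Longrightarrow> indep_var borel (\<eta> i) borel (\<eta> j)"
        "(\<lambda>k. \<integral>\<^sup>+z. ennreal \<bar>Z (g (r (r' k)) # \<gamma>s) t z - Z \<gamma>s t z * \<eta> k z\<bar> \<partial>M) \<longlonglongrightarrow> 0"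
        by (rule rosenblatt_subsequence[where g="\<lambda>k. g (r k)" and A="\<lambda>k. A (r k)" and Z="\<lambda>k. Z (g (r k) # \<gamma>s) t" and m=m and \<gamma>s=\<gamma>s and t=t and A'=A' and Z'="Z \<gamma>s t"])
          (use assms m A A' g' in auto)
      have "(\<lambda>k. ?a (r (r' k))) \<longlonglongrightarrow> ?L"
        by (rule stable_mixing[OF r'(2,3) Y meas(1) wiener_ito_square_integrable[OF A'(2)] meas(2) r'(4)])
      then obtain k where "dist (?a (r (r' k))) ?L < e"
        using r(1) by (auto simp: tendsto_iff dest!: spec[of _ e] eventually_happens'[OF sequentially_bot])
      with spec[OF r(3), of "r' k"] show False by simp
    qed
  qed
qed

end
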